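(* Let $\Bbbk$ be a commutative ring. The graded space $\mathcal{P}=\bigoplus_{n\geq 0}\Bbbk P_n$, where $P_n$ is the set of uniform block permutations of $[n]$, equipped with the product $\ast$, the coproduct $\Delta$, the unit $\emptyset$ and the counit $\varepsilon$ (all defined in the context), is a graded connected Hopf algebra over $\Bbbk$.
   Context: **Uniform block permutations.** For $n\ge 0$ let $[n]=\{1,\dots,n\}$. A set partition of $[n]$ is a collection of non-empty disjoint subsets (blocks) of $[n]$ with union $[n]$. A uniform block permutation of $[n]$ is a bijection $f:\mathcal{A}\to\mathcal{B}$ between two set partitions of $[n]$ such that $|f(A)|=|A|$ for every $A\in\mathcal{A}$; $\mathcal A$ is its domain and $\mathcal B$ its codomain. $P_n$ is the (finite) set of uniform block permutations of $[n]$; $P_0=\{\emptyset\}$, where $\emptyset$ denotes the empty uniform block permutation. **Monoid structure.** For $f:\mathcal{A}\to\mathcal{B}$ and $g:\mathcal{C}\to\mathcal{D}$ in $P_n$, the product $g\cdot f$ ("first $f$, then $g$") is defined as follows: let $\mathcal{E}$ be the finest set partition of $[n]$ such that every block of $\mathcal{B}$ and every block of $\mathcal{C}$ is contained in a block of $\mathcal{E}$; for each $E\in\mathcal{E}$, $g\cdot f$ has the domain block $\bigcup\{f^{-1}(B): B\in\mathcal{B}, B\subseteq E\}$ and sends it to $\bigcup\{g(C): C\in\mathcal{C}, C\subseteq E\}$. A permutation $\sigma\in S_n$ is identified with the uniform block permutation $\{i\}\mapsto\{\sigma(i)\}$; thus $S_n$ is a submonoid of $P_n$. $\Bbbk P_n$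 is the monoid algebra (free $\Bbbk$-module on $P_n$, product extended bilinearly). **Concatenation.** For $f\in P_n$, $g\in P_m$, $f\times g\in P_{n+m}$ is the uniform block permutation whose domain blocks are the domain blocks $A$ of $f$, with $A\mapsto f(A)$, and the sets $A'+n=\{a+n: a\in A'\}$ for $A'$ a domain block of $g$, with $A'+n\mapsto g(A')+n$. **Shuffles and product.** An $(n,m)$-shuffle is $\xi\in S_{n+m}$ with $\xi(1)<\cdots<\xi(n)$ and $\xi(n+1)<\cdots<\xi(n+m)$. $\mathrm{Sh}(n,m)$ is the set of these and $sh_{n,m}=\sum_{\xi\in \mathrm{Sh}(n,m)}\xi\in\Bbbk S_{n+m}$. For $f\in P_n$, $g\in P_m$ put $f\ast g=sh_{n,m}\cdot(f\times g)\in\Bbbk P_{n+m}$, extended bilinearly to $\mathcal{P}$. **Coproduct.** A breaking point of a set partition $\mathcal{B}$ of $[n]$ is $i\in\{0,1,\dots,n\}$ such that $\{1,\dots,i\}$ is a union of blocks of $\mathcal{B}$. For $f:\mathcal{A}\to\mathcal{B}$ in $P_n$, $B(f)$ is the set of breaking points of $\mathcal{B}$. For each $i\in B(f)$ there are a unique $\xi\in\mathrm{Sh}(i,n-i)$ and unique $f_{(i)}\in P_i$, $f'_{(n-i)}\in P_{n-i}$ with $f=(f_{(i)}\times f'_{(n-i)})\cdot\xi^{-1}$. Put $\Delta(f)=\sum_{i\in B(f)}f_{(i)}\otimes f'_{(n-i)}$, extended linearly. **Counit.** $\varepsilon(\emptyset)=1$ and $\varepsilon(f)=0$ for $f\in P_n$,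 $n\ge1$, extended linearly. **Grading.** The degree-$n$ component of $\mathcal{P}$ is $\Bbbk P_n$; connected means that the degree-$0$ component is $\Bbbk\cdot\emptyset\cong\Bbbk$. *)

theory Defs
  imports
    Complex_Main
    "HOL-Library.Poly_Mapping"
    "HOL-Library.Disjoint_Sets"
    "HOL-Combinatorics.Permutations"
begin

section \<open>Free modules\<close>

text \<open>
  The sort \<open>{comm_ring, comm_monoid_mult}\<close> is that of commutative rings with identity, without
  the requirement \<open>0 \<noteq> 1\<close> that is part of \<^class>\<open>comm_ring_1\<close> (and hence of the library locale
  \<^locale>\<open>module\<close>).  The free module on a set \<open>B\<close> consists of the finitely supported functions
  whose support is contained in \<open>B\<close>.
\<close>

definition free_module :: "'b set \<Rightarrow> ('b \<Rightarrow>\<^sub>0 'k::zero) set" where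
  "free_module B = {x. Poly_Mapping.keys x \<subseteq> B}"

definition basis :: "'b \<Rightarrow> ('b \<Rightarrow>\<^sub>0 'k::{comm_ring,comm_monoid_mult})" where
  "basis b = Poly_Mapping.single b 1"

definition scale :: "'k::{comm_ring,comm_monoid_mult} \<Rightarrow> ('b \<Rightarrow>\<^sub>0 'k) \<Rightarrow> ('b \<Rightarrow>\<^sub>0 'k)" where
  "scale c x = Poly_Mapping.map (\<lambda>a. c * a) x"

text \<open>The argument \<open>s\<close> is the scalar multiplication of the target module.\<close>

definition linear_map ::
  "('a \<Rightarrow>\<^sub>0 'k::{comm_ring,comm_monoid_mult}) set \<Rightarrow> 'v::ab_group_add set \<Rightarrow> ('k \<Rightarrow> 'v \<Rightarrow> 'v)
    \<Rightarrow> (('a \<Rightarrow>\<^sub>0 'k) \<Rightarrow> 'v) \<Rightarrow> bool" where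
  "linear_map V W s f \<longleftrightarrow>
     (\<forall>x\<in>V. f x \<in> W) \<and>
     (\<forall>x\<in>V. \<forall>y\<in>V. f (x + y) = f x + f y) \<and>
     (\<forall>c. \<forall>x\<in>V. f (scale c x) = s c (f x))"

definition linear_extension ::
  "('k::{comm_ring,comm_monoid_mult} \<Rightarrow> 'v::ab_group_add \<Rightarrow> 'v) \<Rightarrow> ('a \<Rightarrow> 'v)
    \<Rightarrow> ('a \<Rightarrow>\<^sub>0 'k) \<Rightarrow> 'v" where
  "linear_extension s F x = (\<Sum>a\<in>Poly_Mapping.keys x. s (Poly_Mapping.lookup x a) (F a))"

definition bilinear_extension ::
  "('a \<Rightarrow> 'b \<Rightarrow> ('c \<Rightarrow>\<^sub>0 'k)) \<Rightarrow> ('a \<Rightarrow>\<^sub>0 'k::{comm_ring,comm_monoid_mult})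
    \<Rightarrow> ('b \<Rightarrow>\<^sub>0 'k) \<Rightarrow> ('c \<Rightarrow>\<^sub>0 'k)" where
  "bilinear_extension F x y =
     (\<Sum>a\<in>Poly_Mapping.keys x. \<Sum>b\<in>Poly_Mapping.keys y.
        scale (Poly_Mapping.lookup x a * Poly_Mapping.lookup y b) (F a b))"

definition submodule :: "('b \<Rightarrow>\<^sub>0 'k::{comm_ring,comm_monoid_mult}) set \<Rightarrow> bool" where
  "submodule V \<longleftrightarrow> 0 \<in> V \<and> (\<forall>x\<in>V. \<forall>y\<in>V. x + y \<in> V) \<and> (\<forall>c. \<forall>x\<in>V. scale c x \<in> V)"

definition submodule_span ::
  "('b \<Rightarrow>\<^sub>0 'k::{comm_ring,comm_monoid_mult}) set \<Rightarrow> ('b \<Rightarrow>\<^sub>0 'k) set" where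
  "submodule_span X = \<Inter>{V. submodule V \<and> X \<subseteq> V}"


section \<open>Tensor products\<close>

text \<open>
  The tensor product of the free modules on \<open>A\<close> and \<open>B\<close> is realised as the free module on
  \<open>A \<times> B\<close>, with \<open>a \<otimes> b\<close> being the basis element \<open>(a, b)\<close>.
\<close>

definition tensor ::
  "('a \<Rightarrow>\<^sub>0 'k::{comm_ring,comm_monoid_mult}) \<Rightarrow> ('b \<Rightarrow>\<^sub>0 'k) \<Rightarrow> ('a \<times> 'b \<Rightarrow>\<^sub>0 'k)" where
  "tensor = bilinear_extension (\<lambda>a b. basis (a, b))"

definition tensor_map ::
  "(('a \<Rightarrow>\<^sub>0 'k) \<Rightarrow> ('c \<Rightarrow>\<^sub>0 'k)) \<Rightarrow> (('b \<Rightarrow>\<^sub>0 'k) \<Rightarrow> ('d \<Rightarrow>\<^sub>0 'k))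
    \<Rightarrow> ('a \<times> 'b \<Rightarrow>\<^sub>0 'k::{comm_ring,comm_monoid_mult}) \<Rightarrow> ('c \<times> 'd \<Rightarrow>\<^sub>0 'k)" where
  "tensor_map F G = linear_extension scale (\<lambda>(a, b). tensor (F (basis a)) (G (basis b)))"

definition tensor_assoc ::
  "(('a \<times> 'b) \<times> 'c \<Rightarrow>\<^sub>0 'k::{comm_ring,comm_monoid_mult}) \<Rightarrow> ('a \<times> ('b \<times> 'c) \<Rightarrow>\<^sub>0 'k)" where
  "tensor_assoc = linear_extension scale (\<lambda>((a, b), c). basis (a, (b, c)))"

text \<open>The linear map \<open>H \<otimes> H \<rightarrow> H\<close> induced by a bilinear \<open>m\<close>.\<close>

definition tensor_lift ::
  "(('b \<Rightarrow>\<^sub>0 'k) \<Rightarrow> ('b \<Rightarrow>\<^sub>0 'k) \<Rightarrow> ('b \<Rightarrow>\<^sub>0 'k))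
    \<Rightarrow> ('b \<times> 'b \<Rightarrow>\<^sub>0 'k::{comm_ring,comm_monoid_mult}) \<Rightarrow> ('b \<Rightarrow>\<^sub>0 'k)" where
  "tensor_lift m = linear_extension scale (\<lambda>(a, b). m (basis a) (basis b))"

text \<open>The product \<open>(a \<otimes> b) (c \<otimes> d) = a c \<otimes> b d\<close> on \<open>H \<otimes> H\<close> (no signs are involved).\<close>

definition tensor_mult ::
  "(('b \<Rightarrow>\<^sub>0 'k) \<Rightarrow> ('b \<Rightarrow>\<^sub>0 'k) \<Rightarrow> ('b \<Rightarrow>\<^sub>0 'k))
    \<Rightarrow> ('b \<times> 'b \<Rightarrow>\<^sub>0 'k::{comm_ring,comm_monoid_mult}) \<Rightarrow> ('b \<times> 'b \<Rightarrow>\<^sub>0 'k)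
    \<Rightarrow> ('b \<times> 'b \<Rightarrow>\<^sub>0 'k)" where
  "tensor_mult m =
     bilinear_extension (\<lambda>(a, b) (c, d). tensor (m (basis a) (basis c)) (m (basis b) (basis d)))"

text \<open>The maps \<open>\<epsilon> \<otimes> id\<close> and \<open>id \<otimes> \<epsilon>\<close>, followed by \<open>k \<otimes> H \<cong> H\<close> and \<open>H \<otimes> k \<cong> H\<close>.\<close>

definition counit_tensor_left ::
  "(('b \<Rightarrow>\<^sub>0 'k) \<Rightarrow> 'k) \<Rightarrow> ('b \<times> 'b \<Rightarrow>\<^sub>0 'k::{comm_ring,comm_monoid_mult}) \<Rightarrow> ('b \<Rightarrow>\<^sub>0 'k)" where
  "counit_tensor_left e = linear_extension scale (\<lambda>(a, b). scale (e (basis a)) (basis b))"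

definition counit_tensor_right ::
  "(('b \<Rightarrow>\<^sub>0 'k) \<Rightarrow> 'k) \<Rightarrow> ('b \<times> 'b \<Rightarrow>\<^sub>0 'k::{comm_ring,comm_monoid_mult}) \<Rightarrow> ('b \<Rightarrow>\<^sub>0 'k)" where
  "counit_tensor_right e = linear_extension scale (\<lambda>(a, b). scale (e (basis b)) (basis a))"


section \<open>Hopf algebras whose underlying module is free\<close>

text \<open>
  In the following locales the underlying module is the free module on \<open>B\<close>.  The structure maps
  are HOL functions on the whole type of finitely supported functions; only their restrictions to
  the free module on \<open>B\<close> matter.
\<close>

locale algebra_on =
  fixes B :: "'b set"
    and mul :: "('b \<Rightarrow>\<^sub>0 'k::{comm_ring,comm_monoid_mult}) \<Rightarrow> ('b \<Rightarrow>\<^sub>0 'k) \<Rightarrow> ('b \<Rightarrow>\<^sub>0 'k)"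
    and unit :: "'b \<Rightarrow>\<^sub>0 'k"
  assumes mult_linear_right:
      "x \<in> free_module B \<Longrightarrow> linear_map (free_module B) (free_module B) scale (\<lambda>y. mul x y)"
    and mult_linear_left:
      "y \<in> free_module B \<Longrightarrow> linear_map (free_module B) (free_module B) scale (\<lambda>x. mul x y)"
    and mult_assoc:
      "\<lbrakk>x \<in> free_module B; y \<in> free_module B; z \<in> free_module B\<rbrakk>
        \<Longrightarrow> mul (mul x y) z = mul x (mul y z)"
    and unit_closed: "unit \<in> free_module B"
    and unit_left: "x \<in> free_module B \<Longrightarrow> mul unit x = x"
    and unit_right: "x \<in> free_module B \<Longrightarrow> mul x unit = x"

locale coalgebra_on =
  fixes B :: "'b set"
    and comult :: "('b \<Rightarrow>\<^sub>0 'k::{comm_ring,comm_monoid_mult}) \<Rightarrow> ('b \<times> 'b \<Rightarrow>\<^sub>0 'k)"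
    and counit :: "('b \<Rightarrow>\<^sub>0 'k) \<Rightarrow> 'k"
  assumes comult_linear: "linear_map (free_module B) (free_module (B \<times> B)) scale comult"
    and counit_linear: "linear_map (free_module B) UNIV (*) counit"
    and comult_coassoc:
      "x \<in> free_module B \<Longrightarrow>
        tensor_assoc (tensor_map comult (\<lambda>y. y) (comult x)) = tensor_map (\<lambda>y. y) comult (comult x)"
    and counit_left: "x \<in> free_module B \<Longrightarrow> counit_tensor_left counit (comult x) = x"
    and counit_right: "x \<in> free_module B \<Longrightarrow> counit_tensor_right counit (comult x) = x"

locale bialgebra_on = algebra_on B mul unit + coalgebra_on B comult counit
  for B :: "'b set"
    and mul :: "('b \<Rightarrow>\<^sub>0 'k::{comm_ring,comm_monoid_mult}) \<Rightarrow> ('b \<Rightarrow>\<^sub>0 'k) \<Rightarrow> ('b \<Rightarrow>\<^sub>0 'k)"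
    and unit :: "'b \<Rightarrow>\<^sub>0 'k"
    and comult :: "('b \<Rightarrow>\<^sub>0 'k) \<Rightarrow> ('b \<times> 'b \<Rightarrow>\<^sub>0 'k)"
    and counit :: "('b \<Rightarrow>\<^sub>0 'k) \<Rightarrow> 'k" +
  assumes comult_mult:
      "\<lbrakk>x \<in> free_module B; y \<in> free_module B\<rbrakk>
        \<Longrightarrow> comult (mul x y) = tensor_mult mul (comult x) (comult y)"
    and comult_unit: "comult unit = tensor unit unit"
    and counit_mult:
      "\<lbrakk>x \<in> free_module B; y \<in> free_module B\<rbrakk> \<Longrightarrow> counit (mul x y) = counit x * counit y"
    and counit_unit: "counit unit = 1"

definition is_antipode ::
  "'b set \<Rightarrow> (('b \<Rightarrow>\<^sub>0 'k) \<Rightarrow> ('b \<Rightarrow>\<^sub>0 'k) \<Rightarrow> ('b \<Rightarrow>\<^sub>0 'k)) \<Rightarrow> ('b \<Rightarrow>\<^sub>0 'k)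
    \<Rightarrow> (('b \<Rightarrow>\<^sub>0 'k) \<Rightarrow> ('b \<times> 'b \<Rightarrow>\<^sub>0 'k)) \<Rightarrow> (('b \<Rightarrow>\<^sub>0 'k) \<Rightarrow> 'k)
    \<Rightarrow> (('b \<Rightarrow>\<^sub>0 'k::{comm_ring,comm_monoid_mult}) \<Rightarrow> ('b \<Rightarrow>\<^sub>0 'k)) \<Rightarrow> bool" where
  "is_antipode B mul unit comult counit S \<longleftrightarrow>
     linear_map (free_module B) (free_module B) scale S \<and>
     (\<forall>x\<in>free_module B. tensor_lift mul (tensor_map S (\<lambda>y. y) (comult x)) = scale (counit x) unit) \<and>
     (\<forall>x\<in>free_module B. tensor_lift mul (tensor_map (\<lambda>y. y) S (comult x)) = scale (counit x) unit)"

locale hopf_algebra_on = bialgebra_on B mul unit comult counit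
  for B :: "'b set"
    and mul :: "('b \<Rightarrow>\<^sub>0 'k::{comm_ring,comm_monoid_mult}) \<Rightarrow> ('b \<Rightarrow>\<^sub>0 'k) \<Rightarrow> ('b \<Rightarrow>\<^sub>0 'k)"
    and unit :: "'b \<Rightarrow>\<^sub>0 'k"
    and comult :: "('b \<Rightarrow>\<^sub>0 'k) \<Rightarrow> ('b \<times> 'b \<Rightarrow>\<^sub>0 'k)"
    and counit :: "('b \<Rightarrow>\<^sub>0 'k) \<Rightarrow> 'k" +
  assumes antipode_exists: "\<exists>S. is_antipode B mul unit comult counit S"

definition direct_sum_decomposition ::
  "('b \<Rightarrow>\<^sub>0 'k::{comm_ring,comm_monoid_mult}) set \<Rightarrow> (nat \<Rightarrow> ('b \<Rightarrow>\<^sub>0 'k) set) \<Rightarrow> bool" where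
  "direct_sum_decomposition V H \<longleftrightarrow>
     (\<forall>n. submodule (H n) \<and> H n \<subseteq> V) \<and>
     (\<forall>x\<in>V. \<exists>!y. (\<forall>n. y n \<in> H n) \<and> finite {n. y n \<noteq> 0} \<and> x = (\<Sum>n | y n \<noteq> 0. y n))"

text \<open>
  A Hopf algebra graded by the nonnegative integers: \<open>H n\<close> is the homogeneous component of degree
  \<open>n\<close>, and all structure maps (including the antipode) are homogeneous of degree \<open>0\<close>.
\<close>

locale graded_hopf_algebra_on = hopf_algebra_on B mul unit comult counit
  for B :: "'b set"
    and mul :: "('b \<Rightarrow>\<^sub>0 'k::{comm_ring,comm_monoid_mult}) \<Rightarrow> ('b \<Rightarrow>\<^sub>0 'k) \<Rightarrow> ('b \<Rightarrow>\<^sub>0 'k)"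
    and unit :: "'b \<Rightarrow>\<^sub>0 'k"
    and comult :: "('b \<Rightarrow>\<^sub>0 'k) \<Rightarrow> ('b \<times> 'b \<Rightarrow>\<^sub>0 'k)"
    and counit :: "('b \<Rightarrow>\<^sub>0 'k) \<Rightarrow> 'k" +
  fixes H :: "nat \<Rightarrow> ('b \<Rightarrow>\<^sub>0 'k) set"
  assumes grading: "direct_sum_decomposition (free_module B) H"
    and graded_mult: "\<lbrakk>x \<in> H p; y \<in> H q\<rbrakk> \<Longrightarrow> mul x y \<in> H (p + q)"
    and graded_unit: "unit \<in> H 0"
    and graded_comult:
      "x \<in> H n \<Longrightarrow> comult x \<in> submodule_span {tensor y z | y z p q. p + q = n \<and> y \<in> H p \<and> z \<in> H q}"
    and graded_counit: "\<lbrakk>x \<in> H n; n \<ge> 1\<rbrakk> \<Longrightarrow> counit x = 0"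
    and graded_antipode:
      "is_antipode B mul unit comult counit S \<Longrightarrow> x \<in> H n \<Longrightarrow> S x \<in> H n"

text \<open>Connectedness: \<open>c \<mapsto> c \<cdot> 1\<close> is an isomorphism of the ground ring onto the component of degree \<open>0\<close>.\<close>

locale graded_connected_hopf_algebra_on = graded_hopf_algebra_on B mul unit comult counit H
  for B :: "'b set"
    and mul :: "('b \<Rightarrow>\<^sub>0 'k::{comm_ring,comm_monoid_mult}) \<Rightarrow> ('b \<Rightarrow>\<^sub>0 'k) \<Rightarrow> ('b \<Rightarrow>\<^sub>0 'k)"
    and unit :: "'b \<Rightarrow>\<^sub>0 'k"
    and comult :: "('b \<Rightarrow>\<^sub>0 'k) \<Rightarrow> ('b \<times> 'b \<Rightarrow>\<^sub>0 'k)"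
    and counit :: "('b \<Rightarrow>\<^sub>0 'k) \<Rightarrow> 'k"
    and H :: "nat \<Rightarrow> ('b \<Rightarrow>\<^sub>0 'k) set" +
  assumes connected: "bij_betw (\<lambda>c. scale c unit) UNIV (H 0)"


section \<open>Uniform block permutations\<close>

text \<open>
  A uniform block permutation is represented by its graph, the set of all pairs \<open>(A, f A)\<close>.  Its
  domain and codomain are the relational \<^const>\<open>Domain\<close> and \<^const>\<open>Range\<close>, and the empty uniform
  block permutation is the empty set.
\<close>

type_synonym ubp = "(nat set \<times> nat set) set"

definition UBP :: "nat \<Rightarrow> ubp set" where
  "UBP n = {f. partition_on {1..n} (Domain f) \<and> partition_on {1..n} (Range f) \<and>
               single_valued f \<and> single_valued (f\<inverse>) \<and> (\<forall>(A, A')\<in>f. card A' = card A)}"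

definition UBPs :: "ubp set" where
  "UBPs = (\<Union>n. UBP n)"

definition ubp_size :: "ubp \<Rightarrow> nat" where
  "ubp_size f = (THE n. f \<in> UBP n)"

definition finest_coarsening :: "nat \<Rightarrow> nat set set \<Rightarrow> nat set set \<Rightarrow> nat set set" where
  "finest_coarsening n P Q =
     (THE E. refines {1..n} P E \<and> refines {1..n} Q E \<and>
        (\<forall>E'. refines {1..n} P E' \<and> refines {1..n} Q E' \<longrightarrow> refines {1..n} E E'))"

text \<open>\<open>ubp_comp n g f\<close> is the product \<open>g \<cdot> f\<close> in \<open>UBP n\<close>: first \<open>f\<close>, then \<open>g\<close>.\<close>

definition ubp_comp :: "nat \<Rightarrow> ubp \<Rightarrow> ubp \<Rightarrow> ubp" where
  "ubp_comp n g f =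
     {(\<Union>{A. \<exists>A'. (A, A') \<in> f \<and> A' \<subseteq> E}, \<Union>{C'. \<exists>C. (C, C') \<in> g \<and> C \<subseteq> E}) | E.
        E \<in> finest_coarsening n (Range f) (Domain g)}"

definition perm_ubp :: "nat \<Rightarrow> (nat \<Rightarrow> nat) \<Rightarrow> ubp" where
  "perm_ubp n \<sigma> = {({i}, {\<sigma> i}) | i. i \<in> {1..n}}"

text \<open>\<open>ubp_concat n f g\<close> is \<open>f \<times> g\<close> for \<open>f\<close> in \<open>UBP n\<close>.\<close>

definition ubp_concat :: "nat \<Rightarrow> ubp \<Rightarrow> ubp \<Rightarrow> ubp" where
  "ubp_concat n f g = f \<union> {((\<lambda>a. a + n) ` A, (\<lambda>a. a + n) ` A') | A A'. (A, A') \<in> g}"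

definition Sh :: "nat \<Rightarrow> nat \<Rightarrow> (nat \<Rightarrow> nat) set" where
  "Sh n m = {\<xi>. \<xi> permutes {1..n + m} \<and> strict_mono_on {1..n} \<xi> \<and> strict_mono_on {n + 1..n + m} \<xi>}"

definition breaking_points :: "nat \<Rightarrow> nat set set \<Rightarrow> nat set" where
  "breaking_points n P = {i. i \<le> n \<and> (\<exists>Q\<subseteq>P. {1..i} = \<Union>Q)}"

text \<open>The triple \<open>(\<xi>, g, h)\<close> with \<open>f = (g \<times> h) \<cdot> \<xi>\<^sup>-\<^sup>1\<close>, for a breaking point \<open>i\<close> of the codomain of
  \<open>f\<close>.\<close>

definition ubp_split :: "ubp \<Rightarrow> nat \<Rightarrow> (nat \<Rightarrow> nat) \<times> ubp \<times> ubp" where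
  "ubp_split f i = (let n = ubp_size f in
     THE (\<xi>, g, h). \<xi> \<in> Sh i (n - i) \<and> g \<in> UBP i \<and> h \<in> UBP (n - i) \<and>
       f = ubp_comp n (ubp_concat i g h) (perm_ubp n (inv \<xi>)))"


section \<open>The Hopf algebra of uniform block permutations\<close>

text \<open>The product of the monoid algebra of \<open>UBP n\<close>.\<close>

definition monoid_algebra_mult ::
  "nat \<Rightarrow> (ubp \<Rightarrow>\<^sub>0 'k::{comm_ring,comm_monoid_mult}) \<Rightarrow> (ubp \<Rightarrow>\<^sub>0 'k) \<Rightarrow> (ubp \<Rightarrow>\<^sub>0 'k)" where
  "monoid_algebra_mult n = bilinear_extension (\<lambda>g f. basis (ubp_comp n g f))"

definition shuffle_sum :: "nat \<Rightarrow> nat \<Rightarrow> (ubp \<Rightarrow>\<^sub>0 'k::{comm_ring,comm_monoid_mult})" where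
  "shuffle_sum n m = (\<Sum>\<xi>\<in>Sh n m. basis (perm_ubp (n + m) \<xi>))"

definition ubp_mult ::
  "(ubp \<Rightarrow>\<^sub>0 'k::{comm_ring,comm_monoid_mult}) \<Rightarrow> (ubp \<Rightarrow>\<^sub>0 'k) \<Rightarrow> (ubp \<Rightarrow>\<^sub>0 'k)" where
  "ubp_mult = bilinear_extension (\<lambda>f g. let n = ubp_size f; m = ubp_size g in
     monoid_algebra_mult (n + m) (shuffle_sum n m) (basis (ubp_concat n f g)))"

definition ubp_unit :: "ubp \<Rightarrow>\<^sub>0 'k::{comm_ring,comm_monoid_mult}" where
  "ubp_unit = basis {}"

definition ubp_comult ::
  "(ubp \<Rightarrow>\<^sub>0 'k::{comm_ring,comm_monoid_mult}) \<Rightarrow> (ubp \<times> ubp \<Rightarrow>\<^sub>0 'k)" where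
  "ubp_comult = linear_extension scale (\<lambda>f.
     \<Sum>i\<in>breaking_points (ubp_size f) (Range f).
       case ubp_split f i of (\<xi>, g, h) \<Rightarrow> tensor (basis g) (basis h))"

definition ubp_counit :: "(ubp \<Rightarrow>\<^sub>0 'k::{comm_ring,comm_monoid_mult}) \<Rightarrow> 'k" where
  "ubp_counit = linear_extension (*) (\<lambda>f. if f = {} then 1 else 0)"

definition ubp_degree_component ::
  "nat \<Rightarrow> (ubp \<Rightarrow>\<^sub>0 'k::{comm_ring,comm_monoid_mult}) set" where
  "ubp_degree_component n = free_module (UBP n)"

end

(*
  If i is a breaking point of the codomain of f, then f_(i) and f'_(n-i) are the standardisations of
  the two parts of f lying over {1..i} and over {i+1..n}: their underlying sets are renumbered
  monotonically. Standardisation is invariant under monotone relabelling, so splitting f successively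
  at two breaking points gives the same three parts in either order; this is coassociativity. The
  shuffle product f * g is the sum of those u whose inverse splits at n into the inverses of f and g,
  so associativity is the same statement read for inverses. A shuffle is determined by the set
  S of its first n values, and cutting S at i makes the splittings at i of the terms of f * g correspond
  to pairs of breaking points of f and g together with a shuffle of the left parts and one of the right
  parts. The antipode exists because the bialgebra is graded and connected: a left and a right
  convolution inverse of the identity are defined by recursion on the degree, and they coincide.
*)
theory Submission
  imports Defs
begin


section \<open>Linear maps between free modules\<close>

text \<open>General composition through a finest common coarsening never has to be computed: every
  product in the Hopf structure has a permutation as one factor, and such a product only renumbers
  one side. A shuffle on the left renumbers codomains (in the product), an inverse shuffle on the
  right renumbers domains (in the splitting); this asymmetry is why inversion is needed to compare
  the two. The obstacle in the compatibility of product and coproduct is a gap in the domain: after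
  cutting a product, the part coming from g is shifted by n, whereas multiplying the cut parts
  shifts it only by the size of the part of f. Standardisation closes the gap. The ring may be
  trivial, so a basis element may be 0 and a sum need not determine its index set; the identities
  between sums are proved by bijections of index sets. Homogeneity is demanded of every antipode,
  not only of the constructed one, so the recursion on the degree is run again on the antipode law
  itself.\<close>

abbreviation lin :: "(('a \<Rightarrow>\<^sub>0 'k::{comm_ring,comm_monoid_mult}) \<Rightarrow> ('b \<Rightarrow>\<^sub>0 'k)) \<Rightarrow> bool" where
  "lin \<equiv> linear_map UNIV UNIV scale"

lemma lookup_scale [simp]:
  "Poly_Mapping.lookup (scale c x) a = c * Poly_Mapping.lookup x a"
  by (simp add: scale_def Poly_Mapping.map.rep_eq when_def)

lemma lookup_basis: "Poly_Mapping.lookup (basis b) a = (if a = b then 1 else 0)"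
  by (simp add: basis_def lookup_single when_def)

lemma scale_zero_right [simp]: "scale c 0 = 0"
  and scale_zero_left [simp]: "scale 0 x = 0"
  and scale_one [simp]: "scale 1 x = x"
  and scale_scale: "scale c (scale d x) = scale (c * d) x"
  and scale_add: "scale c (x + y) = scale c x + scale c y"
  and scale_add_left: "scale (c + d) x = scale c x + scale d x"
  by (rule poly_mapping_eqI; simp add: lookup_add algebra_simps)+

lemma scale_sum: "scale c (\<Sum>i\<in>I. x i) = (\<Sum>i\<in>I. scale c (x i))"
  by (induction I rule: infinite_finite_induct) (simp_all add: scale_add)

text \<open>Only an inclusion: over the trivial ring \<open>basis b\<close> is 0 and has no
  keys.\<close>

lemma keys_basis: "Poly_Mapping.keys (basis b) \<subseteq> {b}"
  by (simp add: basis_def)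

lemma sum_basis_expansion:
  "x = (\<Sum>a\<in>Poly_Mapping.keys x. scale (Poly_Mapping.lookup x a) (basis a))"
  by (rule poly_mapping_eqI)
    (auto simp: lookup_sum lookup_basis if_distrib [of "\<lambda>c. _ * c"] sum.delta'
      not_in_keys_iff_lookup_eq_zero cong: if_cong)

lemma basis_in_free_module [simp]: "b \<in> B \<Longrightarrow> basis b \<in> free_module B"
  using keys_basis by (fastforce simp: free_module_def)

lemma submodule_free_module: "submodule (free_module B)"
  by (auto simp: submodule_def free_module_def in_keys_iff subset_iff lookup_add)
    (metis add_0 mult_zero_right)+

lemma free_module_zero [simp]: "0 \<in> free_module B"
  by (simp add: free_module_def)

lemma
  fixes x y :: "'b \<Rightarrow>\<^sub>0 'k::{comm_ring,comm_monoid_mult}"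
  shows free_module_add: "\<lbrakk>x \<in> free_module B; y \<in> free_module B\<rbrakk> \<Longrightarrow> x + y \<in> free_module B"
    and free_module_scale: "x \<in> free_module B \<Longrightarrow> scale c x \<in> free_module B"
  using submodule_free_module [of B, where ?'b = 'k] by (auto simp: submodule_def)

lemma free_module_uminus: "x \<in> free_module B \<Longrightarrow> - x \<in> free_module B"
  by (simp add: free_module_def)

lemma free_module_sum:
  fixes x :: "'i \<Rightarrow> 'b \<Rightarrow>\<^sub>0 'k::{comm_ring,comm_monoid_mult}"
  shows "(\<And>i. i \<in> I \<Longrightarrow> x i \<in> free_module B) \<Longrightarrow> (\<Sum>i\<in>I. x i) \<in> free_module B"
  by (induction I rule: infinite_finite_induct) (auto intro: free_module_add)

lemma free_module_mono: "A \<subseteq> B \<Longrightarrow> x \<in> free_module A \<Longrightarrow> x \<in> free_module B"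
  by (auto simp: free_module_def)

text \<open>Every element is a finite sum of scaled basis elements. Unlike \<open>lin_eqI\<close>
  below, this also serves for scalar-valued maps and for maps that are linear on the free module
  only.\<close>

lemma free_module_induct [consumes 1, case_names zero scale_basis add]:
  assumes "x \<in> free_module B"
    and "P 0"
    and "\<And>c b. b \<in> B \<Longrightarrow> P (scale c (basis b))"
    and "\<And>x y. P x \<Longrightarrow> P y \<Longrightarrow> P (x + y)"
  shows "P x"
proof -
  \<comment> \<open>Generalised from the full support to its subsets, so that induction on a finite
    set applies.\<close>
  have "P (\<Sum>a\<in>A. scale (Poly_Mapping.lookup x a) (basis a))"
    if "A \<subseteq> Poly_Mapping.keys x" for A
  proof -
    have "finite A"
      using that finite_keys by (rule finite_subset)
    then show ?thesis
      using that assms by (induction A) (auto simp: free_module_def)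
  qed
  from this [OF subset_refl] show ?thesis
    using sum_basis_expansion [of x] by simp
qed

section \<open>Linear maps and linear extensions\<close>

lemma lin_add: "lin F \<Longrightarrow> F (x + y) = F x + F y"
  and lin_scale: "lin F \<Longrightarrow> F (scale c x) = scale c (F x)"
  by (auto simp: linear_map_def)

lemma lin_zero: "lin F \<Longrightarrow> F 0 = 0"
  using lin_scale [of F 0 0] by simp

lemma lin_sum: "lin F \<Longrightarrow> F (\<Sum>i\<in>I. x i) = (\<Sum>i\<in>I. F (x i))"
  by (induction I rule: infinite_finite_induct) (auto simp: lin_zero lin_add)

lemma lin_comp: "lin F \<Longrightarrow> lin G \<Longrightarrow> lin (\<lambda>x. F (G x))"
  by (auto simp: linear_map_def)

lemma lin_id [simp]: "lin (\<lambda>x. x)"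
  by (auto simp: linear_map_def)

text \<open>The structure maps with values in a free module are linear extensions, hence linear on
  the whole type; composites can therefore be compared on basis elements without tracking where
  intermediate values lie.\<close>

lemma lin_eqI:
  assumes "x \<in> free_module B" "lin F" "lin G" "\<And>b. b \<in> B \<Longrightarrow> F (basis b) = G (basis b)"
  shows "F x = G x"
  using assms(1) by (induction rule: free_module_induct) (simp_all add: assms lin_zero lin_add lin_scale)

lemma lin_in_free_module:
  assumes "x \<in> free_module A" "lin F" "\<And>b. b \<in> A \<Longrightarrow> F (basis b) \<in> free_module B"
  shows "F x \<in> free_module B"
  using assms(1)
  by (induction rule: free_module_induct)
    (simp_all add: assms lin_zero lin_add lin_scale free_module_add free_module_scale)

lemma lin_imp_linear_map:
  assumes "lin F" "\<And>b. b \<in> A \<Longrightarrow> F (basis b) \<in> free_module B"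
  shows "linear_map (free_module A) (free_module B) scale F"
  using assms lin_in_free_module [OF _ assms]
  by (auto simp: linear_map_def)

text \<open>Keys outside the support contribute 0. This allows x, y and x + y to be expanded over
  one common index set, although cancellation may shrink the support of x + y.\<close>

lemma linear_extension_superset:
  assumes "finite A" "Poly_Mapping.keys x \<subseteq> A"
  shows "linear_extension scale F x = (\<Sum>a\<in>A. scale (Poly_Mapping.lookup x a) (F a))"
  unfolding linear_extension_def using assms
  by (intro sum.mono_neutral_left) (auto simp: not_in_keys_iff_lookup_eq_zero)

lemma lin_linear_extension: "lin (linear_extension scale F)"
proof -
  have "linear_extension scale F (x + y)
      = linear_extension scale F x + linear_extension scale F y" for x y
  proof -
    let ?A = "Poly_Mapping.keys x \<union> Poly_Mapping.keys y"
    have "Poly_Mapping.keys (x + y) \<subseteq> ?A"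
      by (rule keys_add)
    then show ?thesis
      by (simp add: linear_extension_superset [of ?A] lookup_add scale_add_left sum.distrib)
  qed
  moreover have "linear_extension scale F (scale c x) = scale c (linear_extension scale F x)" for c x
  proof -
    have "Poly_Mapping.keys (scale c x) \<subseteq> Poly_Mapping.keys x"
      by (auto simp: in_keys_iff)
    then show ?thesis
      by (simp add: linear_extension_superset [of "Poly_Mapping.keys x"] scale_sum scale_scale)
  qed
  ultimately show ?thesis
    by (simp add: linear_map_def)
qed

lemma linear_extension_basis [simp]: "linear_extension scale F (basis b) = F b"
  using linear_extension_superset [OF _ keys_basis] by (simp add: lookup_basis)

lemma bilinear_extension_eq:
  "bilinear_extension F x y = linear_extension scale (\<lambda>a. linear_extension scale (F a) y) x"
  by (simp add: bilinear_extension_def linear_extension_def scale_sum scale_scale)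

lemma lin_bilinear_extension_left: "lin (\<lambda>x. bilinear_extension F x y)"
  unfolding bilinear_extension_eq by (rule lin_linear_extension)

text \<open>Interchanging the two sums makes linearity in the second argument another instance of
  \<open>lin_linear_extension\<close>; the ring has to be commutative for this.\<close>

lemma bilinear_extension_eq':
  "bilinear_extension F x y = linear_extension scale (\<lambda>b. linear_extension scale (\<lambda>a. F a b) x) y"
  unfolding bilinear_extension_def linear_extension_def scale_sum scale_scale
  by (subst sum.swap) (simp add: mult.commute)

lemma lin_bilinear_extension_right: "lin (bilinear_extension F x)"
  unfolding bilinear_extension_eq' [abs_def] by (rule lin_linear_extension)

lemma bilinear_extension_basis [simp]: "bilinear_extension F (basis a) (basis b) = F a b"
  by (simp add: bilinear_extension_eq)

section \<open>Tensor products of free modules\<close>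

lemma tensor_basis [simp]: "tensor (basis a) (basis b) = basis (a, b)"
  by (simp add: tensor_def)

lemma lin_tensor_left: "lin (\<lambda>x. tensor x y)"
  and lin_tensor_right: "lin (tensor x)"
  by (simp_all add: tensor_def lin_bilinear_extension_left lin_bilinear_extension_right)

lemma lin_tensor_map: "lin (tensor_map F G)"
  and lin_tensor_lift: "lin (tensor_lift m)"
  and lin_tensor_assoc: "lin tensor_assoc"
  and lin_counit_tensor_left: "lin (counit_tensor_left e)"
  and lin_counit_tensor_right: "lin (counit_tensor_right e)"
  by (simp_all add: tensor_map_def tensor_lift_def tensor_assoc_def counit_tensor_left_def
      counit_tensor_right_def lin_linear_extension)

lemma lin_tensor_mult_left: "lin (\<lambda>x. tensor_mult m x y)"
  and lin_tensor_mult_right: "lin (tensor_mult m x)"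
  by (simp_all add: tensor_mult_def lin_bilinear_extension_left lin_bilinear_extension_right)

lemma tensor_map_basis [simp]: "tensor_map F G (basis (a, b)) = tensor (F (basis a)) (G (basis b))"
  and tensor_lift_basis [simp]: "tensor_lift m (basis (a, b)) = m (basis a) (basis b)"
  and tensor_assoc_basis [simp]: "tensor_assoc (basis ((a, b), c)) = basis (a, (b, c))"
  and counit_tensor_left_basis [simp]:
    "counit_tensor_left e (basis (a, b)) = scale (e (basis a)) (basis b)"
  and counit_tensor_right_basis [simp]:
    "counit_tensor_right e (basis (a, b)) = scale (e (basis b)) (basis a)"
  and tensor_mult_basis [simp]: "tensor_mult m (basis (a, b)) (basis (a', b'))
      = tensor (m (basis a) (basis a')) (m (basis b) (basis b'))"
  by (simp_all add: tensor_map_def tensor_lift_def tensor_assoc_def counit_tensor_left_def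
      counit_tensor_right_def tensor_mult_def)

text \<open>\<open>tensor_lift m\<close> is given on pairs of basis elements only; bilinearity of
  \<open>m\<close> extends the formula. The general form is needed because an antipode does not map
  basis elements to basis elements.\<close>

lemma tensor_lift_tensor:
  assumes "\<And>y. lin (\<lambda>x. m x y)" "\<And>x. lin (m x)"
  shows "tensor_lift m (tensor x y) = m x y"
proof -
  have x: "z \<in> free_module UNIV" for z :: "'a \<Rightarrow>\<^sub>0 'b"
    by (simp add: free_module_def)
  have "tensor_lift m (tensor x (basis b)) = m x (basis b)" for b
    by (rule lin_eqI [OF x lin_comp [OF lin_tensor_lift lin_tensor_left] assms(1)]) simp
  then show ?thesis
    by (rule lin_eqI [OF x lin_comp [OF lin_tensor_lift lin_tensor_right] assms(2)])
qed

text \<open>The component in \<open>D n\<close> is the restriction of x to the keys in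
  \<open>D n\<close>. Since the sets are disjoint, the coefficients of a sum determine its
  components.\<close>

lemma direct_sum_decomposition_free_module:
  fixes D :: "nat \<Rightarrow> 'b set"
  assumes disj: "\<And>m n. m \<noteq> n \<Longrightarrow> D m \<inter> D n = {}"
  shows "direct_sum_decomposition
    (free_module (\<Union>n. D n) :: ('b \<Rightarrow>\<^sub>0 'k::{comm_ring,comm_monoid_mult}) set) (\<lambda>n. free_module (D n))"
  unfolding direct_sum_decomposition_def
proof (intro conjI allI ballI)
  fix n
  show "submodule (free_module (D n) :: ('b \<Rightarrow>\<^sub>0 'k) set)"
    by (rule submodule_free_module)
  show "free_module (D n) \<subseteq> (free_module (\<Union>n. D n) :: ('b \<Rightarrow>\<^sub>0 'k) set)"
    by (auto simp: free_module_def)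
next
  fix x :: "'b \<Rightarrow>\<^sub>0 'k"
  assume x: "x \<in> free_module (\<Union>n. D n)"
  define y where "y n = (\<Sum>a\<in>Poly_Mapping.keys x \<inter> D n. scale (Poly_Mapping.lookup x a) (basis a))" for n
  have lookup_y: "Poly_Mapping.lookup (y n) b = (if b \<in> D n then Poly_Mapping.lookup x b else 0)" for n b
    by (auto simp: y_def lookup_sum lookup_basis if_distrib [of "\<lambda>c. _ * c"] sum.delta'
        not_in_keys_iff_lookup_eq_zero cong: if_cong)
  have index: "\<exists>n. b \<in> D n" if "b \<in> Poly_Mapping.keys x" for b
    using that x by (auto simp: free_module_def)
  \<comment> \<open>At a key of \<open>D m\<close> all summands but the m-th vanish. This gives both
    the decomposition and its uniqueness.\<close>
  have lookup_sum_y: "Poly_Mapping.lookup (\<Sum>n | z n \<noteq> 0. z n) b = Poly_Mapping.lookup (z m) b"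
    if "\<And>n. z n \<in> free_module (D n)" "finite {n. z n \<noteq> 0}" "b \<in> D m"
    for z :: "nat \<Rightarrow> 'b \<Rightarrow>\<^sub>0 'k" and b m
  proof -
    have "Poly_Mapping.lookup (z n) b = 0" if "n \<noteq> m" for n
    proof -
      have "b \<notin> D n"
        using disj [OF that] \<open>b \<in> D m\<close> by auto
      then show ?thesis
        using \<open>\<And>n. z n \<in> free_module (D n)\<close> [of n]
        by (auto simp: free_module_def not_in_keys_iff_lookup_eq_zero [symmetric])
    qed
    then have "Poly_Mapping.lookup (\<Sum>n | z n \<noteq> 0. z n) b
        = (\<Sum>n | z n \<noteq> 0. if n = m then Poly_Mapping.lookup (z m) b else 0)"
      unfolding lookup_sum by (intro sum.cong) auto
    also have "\<dots> = Poly_Mapping.lookup (z m) b"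
      using that(2) by auto
    finally show ?thesis .
  qed
  have y_D: "y n \<in> free_module (D n)" for n
    by (auto simp: y_def intro!: free_module_sum free_module_scale)
  \<comment> \<open>A nonzero component contains a key of x, and by disjointness that key determines
    the index of the component; the support of x is finite.\<close>
  have fin_y: "finite {n. y n \<noteq> 0}"
  proof -
    have "\<exists>b\<in>Poly_Mapping.keys x. b \<in> D n" if "y n \<noteq> 0" for n
    proof (rule ccontr)
      assume "\<not> ?thesis"
      then have "Poly_Mapping.keys x \<inter> D n = {}"
        by auto
      then show False
        using that by (simp add: y_def)
    qed
    moreover have "n = m" if "b \<in> D n" "b \<in> D m" for b m n
      using disj [of m n] that by auto
    then have "(THE m. b \<in> D m) = n" if "b \<in> D n" for b n
      using that by blast
    ultimately have "{n. y n \<noteq> 0} \<subseteq> (\<lambda>b. THE n. b \<in> D n) ` Poly_Mapping.keys x"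
      unfolding image_def by blast
    then show ?thesis
      using finite_surj finite_keys by blast
  qed
  have "x = (\<Sum>n | y n \<noteq> 0. y n)"
  proof (rule poly_mapping_eqI)
    fix b
    show "Poly_Mapping.lookup x b = Poly_Mapping.lookup (\<Sum>n | y n \<noteq> 0. y n) b"
    proof (cases "\<exists>m. b \<in> D m")
      case True
      then show ?thesis
        using lookup_sum_y [OF y_D fin_y] lookup_y by auto
    next
      case False
      then show ?thesis
        using index [of b] lookup_y by (auto simp: lookup_sum not_in_keys_iff_lookup_eq_zero [symmetric])
    qed
  qed
  moreover have "z = y" if "\<And>n. z n \<in> free_module (D n)" "finite {n. z n \<noteq> 0}"
    "x = (\<Sum>n | z n \<noteq> 0. z n)" for z
  proof (intro ext poly_mapping_eqI)
    fix n b
    show "Poly_Mapping.lookup (z n) b = Poly_Mapping.lookup (y n) b"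
    proof (cases "b \<in> D n")
      case True
      then show ?thesis
        using lookup_sum_y [OF that(1,2) True] that(3) lookup_y [of n b] by simp
    next
      case False
      then show ?thesis
        using that(1) [of n] lookup_y [of n b]
        by (auto simp: free_module_def subset_iff in_keys_iff)
    qed
  qed
  ultimately show "\<exists>!y. (\<forall>n. y n \<in> free_module (D n)) \<and> finite {n. y n \<noteq> 0}
      \<and> x = (\<Sum>n | y n \<noteq> 0. y n)"
    using y_D fin_y by (intro ex1I [of _ y]) auto
qed


section \<open>Ranks in finite sets of natural numbers\<close>

text \<open>On S this is the increasing bijection onto an initial interval. Defining it by counting
  keeps it meaningful outside S: at a cut point i it tells how many elements of S lie on the lower
  side.\<close>

definition rank :: "nat set \<Rightarrow> nat \<Rightarrow> nat" where
  "rank S x = card {y \<in> S. y \<le> x}"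

lemma rank_less:
  assumes "finite S" "y \<in> S" "x < y"
  shows "rank S x < rank S y"
  unfolding rank_def
proof (rule psubset_card_mono)
  show "{z \<in> S. z \<le> x} \<subset> {z \<in> S. z \<le> y}"
    using assms by (auto simp: psubset_eq set_eq_iff intro: exI [of _ y])
qed (use assms in simp)

lemma strict_mono_on_rank: "finite S \<Longrightarrow> strict_mono_on S (rank S)"
  by (simp add: strict_mono_on_def rank_less)

lemma rank_mem: "finite S \<Longrightarrow> x \<in> S \<Longrightarrow> rank S x \<in> {1..card S}"
  by (auto simp: rank_def Suc_le_eq card_gt_0_iff intro: card_mono)

lemma bij_betw_rank:
  assumes "finite S"
  shows "bij_betw (rank S) S {1..card S}"
proof -
  have inj: "inj_on (rank S) S"
    using strict_mono_on_rank [OF assms] by (rule strict_mono_on_imp_inj_on)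
  moreover have "rank S ` S \<subseteq> {1..card S}"
    using rank_mem [OF assms] by auto
  ultimately show ?thesis
    using card_subset_eq [of "{1..card S}" "rank S ` S"] by (simp add: bij_betw_def card_image)
qed

text \<open>Ranks depend on the order of the elements only; the invariance of
  \<open>standardise\<close> comes from here.\<close>

lemma rank_image:
  assumes "strict_mono_on S \<phi>" "x \<in> S"
  shows "rank (\<phi> ` S) (\<phi> x) = rank S x"
proof -
  have "{y \<in> \<phi> ` S. y \<le> \<phi> x} = \<phi> ` {y \<in> S. y \<le> x}"
    using assms strict_mono_on_less_eq [OF assms(1)] by auto
  moreover have "inj_on \<phi> {y \<in> S. y \<le> x}"
    using strict_mono_on_imp_inj_on [OF assms(1)] by (rule inj_on_subset) auto
  ultimately show ?thesis
    by (simp add: rank_def card_image)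
qed

text \<open>The codomains of the two halves of a split are intervals, so renumbering them is a mere
  subtraction, and the identity when i = 0.\<close>

lemma rank_interval: "x \<in> {Suc i..n} \<Longrightarrow> rank {Suc i..n} x = x - i"
proof -
  assume "x \<in> {Suc i..n}"
  then have "{y \<in> {Suc i..n}. y \<le> x} = {Suc i..x}"
    by auto
  then show ?thesis
    by (simp add: rank_def)
qed

text \<open>\<open>nth_elem S k\<close> is the \<open>k\<close>-th smallest element of \<open>S\<close>, counting from 1.\<close>

definition nth_elem :: "nat set \<Rightarrow> nat \<Rightarrow> nat" where
  "nth_elem S = inv_into S (rank S)"

lemma
  assumes "finite S" "k \<in> {1..card S}"
  shows nth_elem_mem: "nth_elem S k \<in> S"
    and rank_nth_elem: "rank S (nth_elem S k) = k"
  using bij_betw_rank [OF assms(1)] assms(2)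
  by (auto simp: nth_elem_def bij_betw_def inv_into_into f_inv_into_f)

lemma nth_elem_eqI: "\<lbrakk>finite S; x \<in> S; rank S x = k\<rbrakk> \<Longrightarrow> nth_elem S k = x"
  using bij_betw_rank [of S] by (auto simp: nth_elem_def bij_betw_def)

lemma nth_elem_less:
  assumes "finite S" "k \<in> {1..card S}" "l \<in> {1..card S}" "k < l"
  shows "nth_elem S k < nth_elem S l"
  using strict_mono_on_less [OF strict_mono_on_rank [OF assms(1)]] nth_elem_mem rank_nth_elem assms
  by metis

lemma strict_mono_on_nth_elem: "finite S \<Longrightarrow> strict_mono_on {1..card S} (nth_elem S)"
  by (simp add: strict_mono_on_def nth_elem_less)

lemma nth_elem_image:
  assumes "finite S"
  shows "nth_elem S ` {1..card S} = S"
proof (intro equalityI subsetI)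
  fix x assume "x \<in> S"
  then show "x \<in> nth_elem S ` {1..card S}"
    using rank_mem [OF assms] nth_elem_eqI [OF assms] by (metis image_eqI)
qed (use nth_elem_mem [OF assms] in auto)

text \<open>An increasing map on an initial interval is determined by its image; this is why a
  shuffle can be replaced by a set.\<close>

lemma strict_mono_on_eq_nth_elem:
  assumes "strict_mono_on {1..n} \<phi>" "k \<in> {1..n}"
  shows "\<phi> k = nth_elem (\<phi> ` {1..n}) k"
  using assms rank_image [OF assms] rank_interval [of k 0 n]
  by (intro nth_elem_eqI [symmetric]) auto

text \<open>A Galois connection between enumeration and rank: it turns a cut of the values at i into
  a cut of the positions at \<open>rank S i\<close>.\<close>

lemma nth_elem_le_iff:
  assumes "finite S" "k \<in> {1..card S}"
  shows "nth_elem S k \<le> i \<longleftrightarrow> k \<le> rank S i"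
proof
  assume le: "nth_elem S k \<le> i"
  have "rank S (nth_elem S k) \<le> rank S i"
    unfolding rank_def using le assms(1) by (intro card_mono) auto
  then show "k \<le> rank S i"
    using rank_nth_elem [OF assms] by simp
next
  assume "k \<le> rank S i"
  then show "nth_elem S k \<le> i"
    using rank_less [OF assms(1) nth_elem_mem [OF assms], of i] rank_nth_elem [OF assms]
    by linarith
qed

text \<open>The elements up to i occupy the first \<open>rank S i\<close> positions, so removing the
  later ones does not change their enumeration.\<close>

lemma nth_elem_initial:
  assumes "finite S" "k \<in> {1..rank S i}"
  shows "nth_elem (S \<inter> {..i}) k = nth_elem S k"
proof (rule nth_elem_eqI)
  have "rank S i \<le> card S"
    unfolding rank_def using assms(1) by (intro card_mono) auto
  then have k: "k \<in> {1..card S}"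
    using assms(2) by auto
  show "nth_elem S k \<in> S \<inter> {..i}"
    using nth_elem_mem [OF assms(1) k] nth_elem_le_iff [OF assms(1) k] assms(2) by auto
  then have "{y \<in> S \<inter> {..i}. y \<le> nth_elem S k} = {y \<in> S. y \<le> nth_elem S k}"
    by auto
  then show "rank (S \<inter> {..i}) (nth_elem S k) = k"
    using rank_nth_elem [OF assms(1) k] by (simp add: rank_def)
qed (use assms in simp)

text \<open>The elements beyond i occupy the positions past \<open>rank S i\<close>; positions and
  values are both moved back so as to start from 1.\<close>

lemma nth_elem_final:
  assumes "finite S" "k \<in> {Suc (rank S i)..card S}"
  shows "nth_elem ((\<lambda>x. x - i) ` (S \<inter> {i<..})) (k - rank S i) = nth_elem S k - i"
proof (rule nth_elem_eqI)
  have k: "k \<in> {1..card S}"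
    using assms(2) by auto
  define x where "x = nth_elem S k"
  have x: "x \<in> S" "i < x"
    using nth_elem_mem [OF assms(1) k] nth_elem_le_iff [OF assms(1) k, of i] assms(2)
    by (auto simp: x_def)
  show "nth_elem S k - i \<in> (\<lambda>x. x - i) ` (S \<inter> {i<..})"
    using x by (auto simp: x_def)
  have mono: "strict_mono_on (S \<inter> {i<..}) (\<lambda>x. x - i)"
    by (auto simp: strict_mono_on_def)
  \<comment> \<open>Counting up to i and between i and x separately shows that the positions
    subtract.\<close>
  have "{y \<in> S. y \<le> x} = {y \<in> S. y \<le> i} \<union> {y \<in> S \<inter> {i<..}. y \<le> x}"
    using x by auto
  then have "rank S x = rank S i + rank (S \<inter> {i<..}) x"
    unfolding rank_def using assms(1) by (subst card_Un_disjoint [symmetric]) auto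
  moreover have "rank S x = k"
    using rank_nth_elem [OF assms(1) k] by (simp add: x_def)
  ultimately show "rank ((\<lambda>x. x - i) ` (S \<inter> {i<..})) (nth_elem S k - i) = k - rank S i"
    using rank_image [OF mono, of x] x by (simp add: x_def)
qed (use assms in simp)


section \<open>Relabelling and standardisation\<close>

text \<open>The two sides get independent maps because multiplication by a permutation affects only
  one of them.\<close>

definition relabel :: "(nat \<Rightarrow> nat) \<Rightarrow> (nat \<Rightarrow> nat) \<Rightarrow> ubp \<Rightarrow> ubp" where
  "relabel \<phi> \<psi> f = (\<lambda>(A, A'). (\<phi> ` A, \<psi> ` A')) ` f"

lemma Domain_relabel: "Domain (relabel \<phi> \<psi> f) = (`) \<phi> ` Domain f"
  and Range_relabel: "Range (relabel \<phi> \<psi> f) = (`) \<psi> ` Range f"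
  by (force simp: relabel_def)+

lemma Union_Domain_relabel [simp]: "\<Union>(Domain (relabel \<phi> \<psi> f)) = \<phi> ` \<Union>(Domain f)"
  and Union_Range_relabel [simp]: "\<Union>(Range (relabel \<phi> \<psi> f)) = \<psi> ` \<Union>(Range f)"
  by (auto simp: Domain_relabel Range_relabel)

lemma converse_relabel: "(relabel \<phi> \<psi> f)\<inverse> = relabel \<psi> \<phi> (f\<inverse>)"
  by (force simp: relabel_def)

lemma relabel_Un: "relabel \<phi> \<psi> (f \<union> g) = relabel \<phi> \<psi> f \<union> relabel \<phi> \<psi> g"
  by (auto simp: relabel_def)

lemma relabel_relabel:
  "relabel \<phi> \<psi> (relabel \<phi>' \<psi>' f) = relabel (\<lambda>x. \<phi> (\<phi>' x)) (\<lambda>x. \<psi> (\<psi>' x)) f"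
  by (simp add: relabel_def image_image split_def)

lemma relabel_cong:
  assumes "\<And>x. x \<in> \<Union>(Domain f) \<Longrightarrow> \<phi> x = \<phi>' x" "\<And>x. x \<in> \<Union>(Range f) \<Longrightarrow> \<psi> x = \<psi>' x"
  shows "relabel \<phi> \<psi> f = relabel \<phi>' \<psi>' f"
  unfolding relabel_def using assms by (force intro!: image_cong)

lemma relabel_id:
  assumes "\<And>x. x \<in> \<Union>(Domain f) \<Longrightarrow> \<phi> x = x" "\<And>x. x \<in> \<Union>(Range f) \<Longrightarrow> \<psi> x = x"
  shows "relabel \<phi> \<psi> f = f"
proof -
  have "relabel \<phi> \<psi> f = relabel (\<lambda>x. x) (\<lambda>x. x) f"
    using assms by (rule relabel_cong)
  then show ?thesis
    by (simp add: relabel_def)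
qed

definition standardise :: "ubp \<Rightarrow> ubp" where
  "standardise f = relabel (rank (\<Union>(Domain f))) (rank (\<Union>(Range f))) f"

text \<open>Immediate from \<open>rank_image\<close>. Monotonicity is asked on the underlying sets
  only, which admits truncated subtraction as a relabelling.\<close>

lemma standardise_relabel:
  assumes "strict_mono_on (\<Union>(Domain f)) \<phi>" "strict_mono_on (\<Union>(Range f)) \<psi>"
  shows "standardise (relabel \<phi> \<psi> f) = standardise f"
  unfolding standardise_def relabel_relabel Union_Domain_relabel Union_Range_relabel
  using assms by (intro relabel_cong rank_image)

text \<open>Uniform block permutations with arbitrary, possibly different underlying sets on the two
  sides: the halves of a split have this form before they are standardised.\<close>

definition block_bij :: "nat set \<Rightarrow> nat set \<Rightarrow> ubp \<Rightarrow> bool" where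
  "block_bij X Y f \<longleftrightarrow> partition_on X (Domain f) \<and> partition_on Y (Range f) \<and>
     single_valued f \<and> single_valued (f\<inverse>) \<and> (\<forall>(A, A')\<in>f. card A' = card A)"

lemma UBP_iff_block_bij: "f \<in> UBP n \<longleftrightarrow> block_bij {1..n} {1..n} f"
  by (simp add: UBP_def block_bij_def)

lemma
  assumes "block_bij X Y f"
  shows block_bij_Domain: "\<Union>(Domain f) = X" and block_bij_Range: "\<Union>(Range f) = Y"
  using assms by (auto simp: block_bij_def partition_on_def)

lemma block_bij_converse: "block_bij X Y f \<Longrightarrow> block_bij Y X (f\<inverse>)"
  by (auto simp: block_bij_def)

lemma block_bij_nonempty: "block_bij X Y f \<Longrightarrow> (A, A') \<in> f \<Longrightarrow> A \<noteq> {} \<and> A' \<noteq> {}"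
  by (auto simp: block_bij_def partition_on_def)

lemma block_bij_subset:
  "block_bij X Y f \<Longrightarrow> g \<subseteq> f \<Longrightarrow> block_bij (\<Union>(Domain g)) (\<Union>(Range g)) g"
  unfolding block_bij_def partition_on_def
  using Domain_mono [of g f] Range_mono [of g f] single_valued_subset [of g f]
    single_valued_subset [of "g\<inverse>" "f\<inverse>"]
    pairwise_subset [of disjnt "Domain f" "Domain g"] pairwise_subset [of disjnt "Range f" "Range g"]
  by simp blast

text \<open>Corresponding blocks have equal size, so summing over blocks gives the same total on
  both sides. Thus the two sides of a part are renumbered onto the same interval.\<close>

lemma block_bij_card:
  assumes "block_bij X Y f" "finite X" "finite Y"
  shows "card X = card Y"
proof -
  have fin: "finite A" if "A \<in> Domain f \<or> A \<in> Range f" for A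
    using that assms block_bij_Domain [OF assms(1)] block_bij_Range [OF assms(1)]
    by (meson Union_upper finite_subset)
  have "inj_on fst f" "inj_on snd f"
    using assms(1) unfolding block_bij_def single_valued_def inj_on_def
    by (metis converse_iff prod.collapse)+
  then have bij: "bij_betw fst f (Domain f)" "bij_betw snd f (Range f)"
    by (simp_all add: bij_betw_def Domain_fst Range_snd)
  have "card X = (\<Sum>A\<in>Domain f. card A)"
    using assms(1) fin card_Union_disjoint [of "Domain f"]
    by (auto simp: block_bij_def partition_on_def)
  also have "\<dots> = (\<Sum>p\<in>f. card (fst p))"
    using sum.reindex_bij_betw [OF bij(1), of card] by simp
  also have "\<dots> = (\<Sum>p\<in>f. card (snd p))"
    using assms(1) by (intro sum.cong) (auto simp: block_bij_def)
  also have "\<dots> = (\<Sum>A\<in>Range f. card A)"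
    using sum.reindex_bij_betw [OF bij(2), of card] by simp
  also have "\<dots> = card Y"
    using assms(1) fin card_Union_disjoint [of "Range f"]
    by (auto simp: block_bij_def partition_on_def)
  finally show ?thesis .
qed

lemma block_bij_relabel:
  assumes f: "block_bij X Y f" and \<phi>: "inj_on \<phi> X" and \<psi>: "inj_on \<psi> Y"
  shows "block_bij (\<phi> ` X) (\<psi> ` Y) (relabel \<phi> \<psi> f)"
proof -
  have sub: "A \<subseteq> X" "A' \<subseteq> Y" if "(A, A') \<in> f" for A A'
    using f that by (auto simp: block_bij_def partition_on_def)
  have "partition_on (\<phi> ` X) ((`) \<phi> ` Domain f - {{}})" "partition_on (\<psi> ` Y) ((`) \<psi> ` Range f - {{}})"
    using f by (auto intro: partition_on_inj_image \<phi> \<psi> simp: block_bij_def)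
  moreover have "{} \<notin> (`) \<phi> ` Domain f" "{} \<notin> (`) \<psi> ` Range f"
    using f by (auto simp: block_bij_def partition_on_def)
  moreover have "single_valued (relabel \<phi> \<psi> f)"
    using f inj_on_image_eq_iff [OF \<phi>] sub(1)
    by (auto simp: block_bij_def single_valued_def relabel_def) (metis image_iff)+
  moreover have "single_valued ((relabel \<phi> \<psi> f)\<inverse>)"
    using f inj_on_image_eq_iff [OF \<psi>] sub(2)
    by (auto simp: block_bij_def single_valued_def relabel_def) (metis image_iff)+
  moreover have "\<forall>(A, A')\<in>relabel \<phi> \<psi> f. card A' = card A"
    using f sub inj_on_subset [OF \<phi>] inj_on_subset [OF \<psi>]
    by (auto simp: block_bij_def relabel_def card_image)
  ultimately show ?thesis
    by (simp add: block_bij_def Domain_relabel Range_relabel)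
qed

lemma block_bij_Un:
  assumes "block_bij X Y f" "block_bij X' Y' g" "X \<inter> X' = {}" "Y \<inter> Y' = {}"
  shows "block_bij (X \<union> X') (Y \<union> Y') (f \<union> g)"
proof -
  have disj: "A \<inter> B = {}" if "A \<in> Domain f" "B \<in> Domain g" for A B
  proof -
    have "A \<subseteq> X" "B \<subseteq> X'"
      using that block_bij_Domain [OF assms(1)] block_bij_Domain [OF assms(2)] by blast+
    then show ?thesis
      using assms(3) by blast
  qed
  have disj': "A \<inter> B = {}" if "A \<in> Range f" "B \<in> Range g" for A B
  proof -
    have "A \<subseteq> Y" "B \<subseteq> Y'"
      using that block_bij_Range [OF assms(1)] block_bij_Range [OF assms(2)] by blast+
    then show ?thesis
      using assms(4) by blast
  qed
  \<comment> \<open>A block common to f and g would be disjoint from itself, hence empty.\<close>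
  have "{} \<notin> Domain f" "{} \<notin> Range f"
    using assms(1) by (simp_all add: block_bij_def partition_on_def)
  then have "Domain f \<inter> Domain g = {}" "Range f \<inter> Range g = {}"
    using disj disj' by (metis disjoint_iff inf.idem)+
  then have "single_valued (f \<union> g)" "single_valued ((f \<union> g)\<inverse>)"
    using assms(1,2) by (auto simp: block_bij_def single_valued_def; blast)+
  moreover have "partition_on (X \<union> X') (Domain (f \<union> g))"
    using assms(1,2)
    using disjoint_union [of "Domain f" "Domain g"] assms(3)
    by (simp add: block_bij_def partition_on_def Domain_Un_eq)
  moreover have "partition_on (Y \<union> Y') (Range (f \<union> g))"
    using assms(1,2)
    using disjoint_union [of "Range f" "Range g"] assms(4)
    by (simp add: block_bij_def partition_on_def Range_Un_eq)
  ultimately show ?thesis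
    using assms(1,2) by (auto simp: block_bij_def)
qed

lemma standardise_UBP:
  assumes "block_bij X Y f" "finite X" "finite Y"
  shows "standardise f \<in> UBP (card X)"
proof -
  have "block_bij (rank X ` X) (rank Y ` Y) (standardise f)"
    unfolding standardise_def block_bij_Domain [OF assms(1)] block_bij_Range [OF assms(1)]
    using assms by (intro block_bij_relabel strict_mono_on_imp_inj_on strict_mono_on_rank)
  then show ?thesis
    using bij_betw_rank assms block_bij_card [OF assms]
    by (simp add: UBP_iff_block_bij bij_betw_def)
qed

lemma standardise_ident: "f \<in> UBP n \<Longrightarrow> standardise f = f"
  unfolding standardise_def using rank_interval [of _ 0 n]
  by (intro relabel_id) (auto simp: UBP_iff_block_bij block_bij_Domain block_bij_Range)

lemma UBP_converse: "f \<in> UBP n \<Longrightarrow> f\<inverse> \<in> UBP n"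
  by (simp add: UBP_iff_block_bij block_bij_converse)

lemma UBP_unique: "f \<in> UBP n \<Longrightarrow> f \<in> UBP m \<Longrightarrow> n = m"
  by (metis UBP_iff_block_bij block_bij_Domain card_atLeastAtMost diff_Suc_1)

lemma ubp_size_eq: "f \<in> UBP n \<Longrightarrow> ubp_size f = n"
  unfolding ubp_size_def by (blast intro: UBP_unique)

lemma UBP_0: "UBP 0 = {{}}"
  by (auto simp: UBP_def partition_on_empty Domain_empty_iff)

lemma finite_UBP: "finite (UBP n)"
proof (rule finite_subset)
  show "UBP n \<subseteq> Pow (Pow {1..n} \<times> Pow {1..n})"
    by (force simp: UBP_def partition_on_def)
qed simp


section \<open>Splitting at breaking points\<close>

definition lower :: "nat \<Rightarrow> ubp \<Rightarrow> ubp" where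
  "lower i f = {(A, A') \<in> f. A' \<subseteq> {..i}}"

definition upper :: "nat \<Rightarrow> ubp \<Rightarrow> ubp" where
  "upper i f = {(A, A') \<in> f. A' \<subseteq> {i<..}}"

text \<open>The breaking points of the codomain, tested block by block: no block straddles i. In
  this form the condition passes directly through relabellings and unions.\<close>

definition breaks :: "ubp \<Rightarrow> nat set" where
  "breaks f = {i. i \<le> ubp_size f \<and> (\<forall>A'\<in>Range f. A' \<subseteq> {..i} \<or> A' \<subseteq> {i<..})}"

definition left_part :: "nat \<Rightarrow> ubp \<Rightarrow> ubp" where
  "left_part i f = standardise (lower i f)"

definition right_part :: "nat \<Rightarrow> ubp \<Rightarrow> ubp" where
  "right_part i f = standardise (upper i f)"

lemma lower_subset: "lower i f \<subseteq> f" and upper_subset: "upper i f \<subseteq> f"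
  by (auto simp: lower_def upper_def)

lemma finite_breaks [simp]: "finite (breaks f)"
  by (rule finite_subset [of _ "{..ubp_size f}"]) (auto simp: breaks_def)

text \<open>The required family consists of all blocks below i. Conversely, a block outside a family
  with union {1..i} is disjoint from that union and hence lies above i.\<close>

lemma breaks_eq_breaking_points:
  assumes "f \<in> UBP n"
  shows "breaks f = breaking_points n (Range f)"
proof -
  have part: "partition_on {1..n} (Range f)"
    using assms by (simp add: UBP_def)
  have "(\<forall>A'\<in>Range f. A' \<subseteq> {..i} \<or> A' \<subseteq> {i<..}) \<longleftrightarrow> (\<exists>Q\<subseteq>Range f. {1..i} = \<Union>Q)"
    if "i \<le> n" for i
  proof
    assume *: "\<forall>A'\<in>Range f. A' \<subseteq> {..i} \<or> A' \<subseteq> {i<..}"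
    have "{1..i} = \<Union>{A' \<in> Range f. A' \<subseteq> {..i}}"
    proof (intro equalityI subsetI)
      fix x assume x: "x \<in> {1..i}"
      then have "x \<in> \<Union>(Range f)"
        using part that by (auto simp: partition_on_def)
      then obtain A' where "A' \<in> Range f" "x \<in> A'"
        by auto
      moreover have "\<not> A' \<subseteq> {i<..}"
        using \<open>x \<in> A'\<close> x by auto
      ultimately show "x \<in> \<Union>{A' \<in> Range f. A' \<subseteq> {..i}}"
        using * by blast
    next
      fix x assume "x \<in> \<Union>{A' \<in> Range f. A' \<subseteq> {..i}}"
      then show "x \<in> {1..i}"
        using partition_onD1 [OF part] by fastforce
    qed
    then show "\<exists>Q\<subseteq>Range f. {1..i} = \<Union>Q"
      by (intro exI [of _ "{A' \<in> Range f. A' \<subseteq> {..i}}"]) auto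
  next
    assume "\<exists>Q\<subseteq>Range f. {1..i} = \<Union>Q"
    then obtain Q where Q: "Q \<subseteq> Range f" "{1..i} = \<Union>Q"
      by blast
    show "\<forall>A'\<in>Range f. A' \<subseteq> {..i} \<or> A' \<subseteq> {i<..}"
    proof
      fix A' assume A': "A' \<in> Range f"
      show "A' \<subseteq> {..i} \<or> A' \<subseteq> {i<..}"
      proof (cases "A' \<in> Q")
        case True
        then have "A' \<subseteq> {1..i}"
          using Q(2) by blast
        then show ?thesis
          by auto
      next
        case False
        have "A' \<inter> C = {}" if "C \<in> Q" for C
          using that False A' Q(1) partition_onD2 [OF part] by (metis disjointD subsetD)
        then have "A' \<inter> {1..i} = {}"
          unfolding Q(2) by blast
        moreover have "A' \<subseteq> {1..n}"
          using partition_onD1 [OF part] A' by auto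
        ultimately have "A' \<subseteq> {i<..}"
          by fastforce
        then show ?thesis ..
      qed
    qed
  qed
  then show ?thesis
    unfolding breaks_def breaking_points_def ubp_size_eq [OF assms] by (intro Collect_cong) blast
qed

section \<open>The two halves of a uniform block permutation at a breaking point\<close>

context
  fixes f n i
  assumes f: "f \<in> UBP n" and i: "i \<in> breaks f"
begin

private lemma le: "i \<le> n"
  using i ubp_size_eq [OF f] by (simp add: breaks_def)

private lemma split: "f = lower i f \<union> upper i f"
  using i unfolding breaks_def lower_def upper_def by blast

private lemma block: "block_bij {1..n} {1..n} f"
  using f by (simp add: UBP_iff_block_bij)

lemma Union_Range_lower: "\<Union>(Range (lower i f)) = {1..i}"
  and Union_Range_upper: "\<Union>(Range (upper i f)) = {Suc i..n}"
proof -
  have "\<Union>(Range (lower i f)) \<union> \<Union>(Range (upper i f)) = {1..n}"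
    using arg_cong [OF split, of "\<lambda>f. \<Union>(Range f)"] block_bij_Range [OF block] by auto
  moreover have "\<Union>(Range (lower i f)) \<subseteq> {..i}" "\<Union>(Range (upper i f)) \<subseteq> {i<..}"
    by (auto simp: lower_def upper_def)
  ultimately have *: "x \<in> {1..n} \<longleftrightarrow> x \<in> \<Union>(Range (lower i f)) \<or> x \<in> \<Union>(Range (upper i f))"
    "x \<in> \<Union>(Range (lower i f)) \<Longrightarrow> x \<le> i" "x \<in> \<Union>(Range (upper i f)) \<Longrightarrow> i < x" for x
    by blast+
  have "x \<in> \<Union>(Range (lower i f)) \<longleftrightarrow> x \<in> {1..i}" for x
    using * [of x] le by (metis atLeastAtMost_iff le_trans not_less)
  then show "\<Union>(Range (lower i f)) = {1..i}"
    by blast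
  have "x \<in> \<Union>(Range (upper i f)) \<longleftrightarrow> x \<in> {Suc i..n}" for x
    using * [of x] le by (metis One_nat_def Suc_leI Suc_le_lessD atLeastAtMost_iff le_less_trans
        not_less zero_le)
  then show "\<Union>(Range (upper i f)) = {Suc i..n}"
    by blast
qed

lemma block_bij_lower: "block_bij (\<Union>(Domain (lower i f))) {1..i} (lower i f)"
  and block_bij_upper: "block_bij (\<Union>(Domain (upper i f))) {Suc i..n} (upper i f)"
  using block_bij_subset [OF block lower_subset [of i]] block_bij_subset [OF block upper_subset [of i]]
  by (simp_all only: Union_Range_lower Union_Range_upper)

lemma Union_Domain_lower: "\<Union>(Domain (lower i f)) \<subseteq> {1..n}"
  and Union_Domain_upper: "\<Union>(Domain (upper i f)) = {1..n} - \<Union>(Domain (lower i f))"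
proof -
  have un: "\<Union>(Domain (lower i f)) \<union> \<Union>(Domain (upper i f)) = {1..n}"
    using arg_cong [OF split, of "\<lambda>f. \<Union>(Domain f)"] block_bij_Domain [OF block] by auto
  then show "\<Union>(Domain (lower i f)) \<subseteq> {1..n}"
    by blast
  \<comment> \<open>A nonempty codomain block cannot lie on both sides of i, so the two images
    differ; then so do the domain blocks, and these belong to one partition.\<close>
  have "A \<inter> B = {}" if A: "(A, A') \<in> lower i f" and B: "(B, B') \<in> upper i f" for A A' B B'
  proof -
    have sub: "A' \<subseteq> {..i}" "B' \<subseteq> {i<..}" and f: "(A, A') \<in> f" "(B, B') \<in> f"
      using A B by (simp_all add: lower_def upper_def)
    have "A' \<inter> B' = {}"
      using sub by force
    then have "A' \<noteq> B'"
      using block_bij_nonempty [OF block f(1)] by auto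
    then have "A \<noteq> B"
      using f block by (auto simp: block_bij_def dest: single_valuedD)
    moreover have "disjoint (Domain f)"
      using block by (simp add: block_bij_def partition_on_def)
    ultimately show ?thesis
      using f by (blast dest: disjointD)
  qed
  then have "\<Union>(Domain (lower i f)) \<inter> \<Union>(Domain (upper i f)) = {}"
    by blast
  then show "\<Union>(Domain (upper i f)) = {1..n} - \<Union>(Domain (lower i f))"
    using un by blast
qed

lemma finite_Union_Domain_lower: "finite (\<Union>(Domain (lower i f)))"
  and finite_Union_Domain_upper: "finite (\<Union>(Domain (upper i f)))"
  using Union_Domain_lower Union_Domain_upper by (auto intro: finite_subset)

text \<open>Uniformity carries the size over from the codomain half, which is an interval, to the
  domain half, which may be scattered.\<close>

lemma card_Union_Domain_lower: "card (\<Union>(Domain (lower i f))) = i"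
  and card_Union_Domain_upper: "card (\<Union>(Domain (upper i f))) = n - i"
  using block_bij_card [OF block_bij_lower] block_bij_card [OF block_bij_upper]
    finite_Union_Domain_lower finite_Union_Domain_upper by simp_all

lemma left_part_UBP: "left_part i f \<in> UBP i"
  and right_part_UBP: "right_part i f \<in> UBP (n - i)"
  using standardise_UBP [OF block_bij_lower] standardise_UBP [OF block_bij_upper]
    finite_Union_Domain_lower finite_Union_Domain_upper
  by (simp_all add: left_part_def right_part_def card_Union_Domain_lower card_Union_Domain_upper)

text \<open>The codomain of the lower half is already {1..i}, so only the domain is really
  renumbered.\<close>

lemma left_part_eq: "left_part i f = relabel (rank (\<Union>(Domain (lower i f)))) (\<lambda>x. x) (lower i f)"
  unfolding left_part_def standardise_def
  using rank_interval [of _ 0 i] by (intro relabel_cong) (auto simp: Union_Range_lower)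

lemma right_part_eq:
  "right_part i f = relabel (rank (\<Union>(Domain (upper i f)))) (\<lambda>x. x - i) (upper i f)"
  unfolding right_part_def standardise_def
  by (intro relabel_cong) (auto simp: Union_Range_upper rank_interval simp del: Union_iff)

end

lemma lower_relabel: "lower k (relabel \<phi> \<psi> f) = relabel \<phi> \<psi> {(A, A') \<in> f. \<psi> ` A' \<subseteq> {..k}}"
  and upper_relabel: "upper k (relabel \<phi> \<psi> f) = relabel \<phi> \<psi> {(A, A') \<in> f. \<psi> ` A' \<subseteq> {k<..}}"
  by (auto simp: lower_def upper_def relabel_def)

lemma standardise_relabel_subset:
  assumes "g \<subseteq> f" "strict_mono_on (\<Union>(Domain f)) \<phi>" "strict_mono_on (\<Union>(Range f)) \<psi>"
  shows "standardise (relabel \<phi> \<psi> g) = standardise g"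
  using assms by (intro standardise_relabel; elim monotone_on_subset) auto

text \<open>\<open>left_part j f\<close> is the lower half with its domain relabelled increasingly.
  Cutting looks at codomains only and commutes with this, and a further standardisation forgets it.
  The middle part is kept in the form in which the two orders of splitting meet.\<close>

lemma
  assumes f: "f \<in> UBP n" and j: "j \<in> breaks f" and "i \<le> j"
  shows breaks_left_part: "i \<in> breaks (left_part j f) \<longleftrightarrow> i \<in> breaks f"
    and left_part_left_part: "left_part i (left_part j f) = left_part i f"
    and right_part_left_part:
      "right_part i (left_part j f) = standardise (upper i (lower j f))"
proof -
  define \<alpha> where "\<alpha> = rank (\<Union>(Domain (lower j f)))"
  have mono: "strict_mono_on (\<Union>(Domain (lower j f))) \<alpha>"
    unfolding \<alpha>_def by (rule strict_mono_on_rank [OF finite_Union_Domain_lower [OF f j]])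
  have eq: "left_part j f = relabel \<alpha> (\<lambda>x. x) (lower j f)"
    unfolding \<alpha>_def by (rule left_part_eq [OF f j])
  have lower: "lower i (left_part j f) = relabel \<alpha> (\<lambda>x. x) (lower i f)"
    unfolding eq lower_relabel using \<open>i \<le> j\<close>
    by (intro arg_cong [of _ _ "relabel \<alpha> (\<lambda>x. x)"]) (auto simp: lower_def)
  have upper: "upper i (left_part j f) = relabel \<alpha> (\<lambda>x. x) (upper i (lower j f))"
    unfolding eq upper_relabel by (simp add: upper_def)
  have sub: "lower i f \<subseteq> lower j f"
    using \<open>i \<le> j\<close> by (auto simp: lower_def)
  show "left_part i (left_part j f) = left_part i f"
    unfolding left_part_def [of i] lower
    using sub mono by (rule standardise_relabel_subset) (simp add: strict_mono_on_def)
  show "right_part i (left_part j f) = standardise (upper i (lower j f))"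
    unfolding right_part_def upper
    using upper_subset mono by (rule standardise_relabel_subset) (simp add: strict_mono_on_def)
  have "ubp_size (left_part j f) = j" "ubp_size f = n"
    using left_part_UBP [OF f j] f ubp_size_eq by blast+
  moreover have "Range (left_part j f) = Range (lower j f)"
    unfolding eq Range_relabel by simp
  moreover have "(\<forall>A'\<in>Range (lower j f). A' \<subseteq> {..i} \<or> A' \<subseteq> {i<..})
      \<longleftrightarrow> (\<forall>A'\<in>Range f. A' \<subseteq> {..i} \<or> A' \<subseteq> {i<..})"
  proof -
    \<comment> \<open>A block missing from the lower half lies beyond j, hence beyond i, and cannot
      spoil the break at i.\<close>
    have "A' \<in> Range (lower j f) \<or> A' \<subseteq> {i<..}" if "A' \<in> Range f" for A'
    proof -
      have "A' \<subseteq> {..j} \<or> A' \<subseteq> {j<..}"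
        using that j by (simp add: breaks_def)
      then show ?thesis
        using that \<open>i \<le> j\<close> by (auto simp: lower_def)
    qed
    then show ?thesis
      using Range_mono [OF lower_subset] by (metis subsetD)
  qed
  moreover have "j \<le> ubp_size f"
    using j by (simp add: breaks_def)
  ultimately show "i \<in> breaks (left_part j f) \<longleftrightarrow> i \<in> breaks f"
    using \<open>i \<le> j\<close> by (simp add: breaks_def)
qed

text \<open>As for the left part, but the codomain has been moved down by i, so a cut at k
  corresponds to a cut of f at i + k. The middle part gets the same expression as before.\<close>

lemma
  assumes f: "f \<in> UBP n" and i: "i \<in> breaks f"
  shows breaks_right_part: "k \<in> breaks (right_part i f) \<longleftrightarrow> i + k \<in> breaks f"
    and right_part_right_part: "right_part k (right_part i f) = right_part (i + k) f"
    and left_part_right_part: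
      "left_part k (right_part i f) = standardise (upper i (lower (i + k) f))"
proof -
  define \<beta> where "\<beta> = rank (\<Union>(Domain (upper i f)))"
  have mono: "strict_mono_on (\<Union>(Domain (upper i f))) \<beta>"
    unfolding \<beta>_def by (rule strict_mono_on_rank [OF finite_Union_Domain_upper [OF f i]])
  have mono': "strict_mono_on (\<Union>(Range (upper i f))) (\<lambda>x. x - i)"
    unfolding Union_Range_upper [OF f i] by (auto simp: strict_mono_on_def)
  have eq: "right_part i f = relabel \<beta> (\<lambda>x. x - i) (upper i f)"
    unfolding \<beta>_def by (rule right_part_eq [OF f i])
  \<comment> \<open>Truncation is harmless: x - i \<le> k is equivalent to x \<le> i + k for all
    natural numbers.\<close>
  have le_iff: "(\<lambda>x. x - i) ` A' \<subseteq> {..k} \<longleftrightarrow> A' \<subseteq> {..i + k}"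
    and gt_iff: "(\<lambda>x. x - i) ` A' \<subseteq> {k<..} \<longleftrightarrow> A' \<subseteq> {i + k<..}" for A'
    by (simp_all add: image_subset_iff subset_eq [of A'] le_diff_conv less_diff_conv add.commute)
  have lower: "lower k (right_part i f) = relabel \<beta> (\<lambda>x. x - i) (upper i (lower (i + k) f))"
    unfolding eq lower_relabel le_iff
    by (intro arg_cong [of _ _ "relabel \<beta> (\<lambda>x. x - i)"]) (auto simp: upper_def lower_def)
  have upper: "upper k (right_part i f) = relabel \<beta> (\<lambda>x. x - i) (upper (i + k) f)"
    unfolding eq upper_relabel gt_iff
    by (intro arg_cong [of _ _ "relabel \<beta> (\<lambda>x. x - i)"]) (auto simp: upper_def)
  show "right_part k (right_part i f) = right_part (i + k) f"
    unfolding right_part_def [of k] right_part_def [of "i + k"] upper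
    using mono mono' by (intro standardise_relabel_subset [of _ "upper i f"]) (auto simp: upper_def)
  show "left_part k (right_part i f) = standardise (upper i (lower (i + k) f))"
    unfolding left_part_def lower
    using mono mono'
    by (intro standardise_relabel_subset [of _ "upper i f"]) (auto simp: upper_def lower_def)
  have size: "ubp_size (right_part i f) = n - i" "ubp_size f = n"
    using right_part_UBP [OF f i] f ubp_size_eq by blast+
  have upper_or_le: "A' \<in> Range (upper i f) \<or> A' \<subseteq> {..i + k}" if "A' \<in> Range f" for A'
  proof -
    have "A' \<subseteq> {..i} \<or> A' \<subseteq> {i<..}"
      using that i by (simp add: breaks_def)
    then show ?thesis
      using that by (auto simp: upper_def)
  qed
  have "(\<forall>A'\<in>Range (right_part i f). A' \<subseteq> {..k} \<or> A' \<subseteq> {k<..})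
      \<longleftrightarrow> (\<forall>A'\<in>Range f. A' \<subseteq> {..i + k} \<or> A' \<subseteq> {i + k<..})"
    unfolding eq Range_relabel ball_simps le_iff gt_iff
    using upper_or_le Range_mono [OF upper_subset] by (metis subsetD)
  moreover have "k \<le> n - i \<longleftrightarrow> i + k \<le> n"
    using i by (auto simp: breaks_def size)
  ultimately show "k \<in> breaks (right_part i f) \<longleftrightarrow> i + k \<in> breaks f"
    by (simp add: breaks_def size)
qed

lemma UBP_block_subset:
  assumes "f \<in> UBP n" "(A, A') \<in> f"
  shows "A \<subseteq> {1..n}" "A' \<subseteq> {1..n}"
  using assms(2) block_bij_Domain [OF assms(1) [unfolded UBP_iff_block_bij]]
    block_bij_Range [OF assms(1) [unfolded UBP_iff_block_bij]] by blast+

text \<open>The extreme cuts carry the unit and counit laws. The empty part has degree 0, and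
  \<open>UBP 0\<close> has just one element.\<close>

lemma
  assumes f: "f \<in> UBP n"
  shows zero_in_breaks: "0 \<in> breaks f" and size_in_breaks: "n \<in> breaks f"
    and left_part_zero: "left_part 0 f = {}" and right_part_zero: "right_part 0 f = f"
    and left_part_size: "left_part n f = f" and right_part_size: "right_part n f = {}"
proof -
  have sub: "A' \<subseteq> {1..n}" if "A' \<in> Range f" for A'
    using that UBP_block_subset [OF f] by blast
  have sub0: "A' \<subseteq> {0<..}" and subn: "A' \<subseteq> {..n}" if "A' \<in> Range f" for A'
    using sub [OF that] by (auto simp: subset_iff)
  show 0: "0 \<in> breaks f" and n: "n \<in> breaks f"
    using sub0 subn ubp_size_eq [OF f] by (simp_all add: breaks_def)
  show "left_part 0 f = {}" "right_part n f = {}"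
    using left_part_UBP [OF f 0] right_part_UBP [OF f n] by (simp_all add: UBP_0)
  have "upper 0 f = f" "lower n f = f"
    using sub0 subn by (auto simp: upper_def lower_def)
  then show "right_part 0 f = f" "left_part n f = f"
    using standardise_ident [OF f] by (simp_all add: right_part_def left_part_def)
qed


section \<open>Products with permutations\<close>

text \<open>Q is a common coarsening, and any other one is coarser than Q. No other case is needed:
  one factor is always a permutation, and its singleton blocks refine every partition.\<close>

lemma
  assumes "refines {1..n} P Q"
  shows finest_coarsening_right: "finest_coarsening n P Q = Q"
    and finest_coarsening_left: "finest_coarsening n Q P = Q"
proof -
  have Q: "refines {1..n} Q Q"
    using assms by (intro refines_refl) (simp add: refines_def)
  have "E = Q" if "refines {1..n} Q E" "\<forall>E'. refines {1..n} P E' \<and> refines {1..n} Q E' \<longrightarrow> refines {1..n} E E'" for E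
    using that assms Q refines_asym by metis
  then show "finest_coarsening n P Q = Q" "finest_coarsening n Q P = Q"
    unfolding finest_coarsening_def using assms Q by (intro the_equality; metis)+
qed

lemma refines_singletons: "partition_on X P \<Longrightarrow> refines X ((\<lambda>x. {x}) ` X) P"
  by (auto simp: refines_def partition_on_singletons) (auto simp: partition_on_def)

lemma Domain_perm_ubp: "Domain (perm_ubp n \<sigma>) = (\<lambda>x. {x}) ` {1..n}"
  by (auto simp: perm_ubp_def)

lemma Range_perm_ubp: "\<sigma> permutes {1..n} \<Longrightarrow> Range (perm_ubp n \<sigma>) = (\<lambda>x. {x}) ` {1..n}"
proof -
  assume "\<sigma> permutes {1..n}"
  then have "(\<lambda>x. {x}) ` {1..n} = (\<lambda>x. {x}) ` \<sigma> ` {1..n}"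
    by (simp only: permutes_image)
  moreover have "Range (perm_ubp n \<sigma>) = (\<lambda>x. {x}) ` \<sigma> ` {1..n}"
    unfolding perm_ubp_def by blast
  ultimately show ?thesis
    by simp
qed

text \<open>Blocks are nonempty and disjoint, so inclusion between them forces equality. The unions
  in \<open>ubp_comp\<close> thereby collapse to single blocks.\<close>

lemma block_subset_iff:
  assumes "block_bij X Y f" "(A, A') \<in> f"
  shows "(\<exists>B'. (B, B') \<in> f \<and> B' \<subseteq> A') \<longleftrightarrow> B = A"
    and "(\<exists>B. (B, B') \<in> f \<and> B \<subseteq> A) \<longleftrightarrow> B' = A'"
proof -
  have *: "B' = A' \<and> B = A" if "(B, B') \<in> f" "B' \<subseteq> A' \<or> B \<subseteq> A" for B B'
  proof -
    have "B' \<inter> A' \<noteq> {} \<or> B \<inter> A \<noteq> {}"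
      using block_bij_nonempty [OF assms(1) that(1)] that(2) by blast
    moreover have "disjoint (Range f)" "disjoint (Domain f)"
      using assms(1) by (simp_all add: block_bij_def partition_on_def)
    ultimately have "B' = A' \<or> B = A"
      using that(1) assms(2) by (blast dest: disjointD)
    then show ?thesis
      using assms that(1) by (auto simp: block_bij_def dest: single_valuedD)
  qed
  show "(\<exists>B'. (B, B') \<in> f \<and> B' \<subseteq> A') \<longleftrightarrow> B = A" "(\<exists>B. (B, B') \<in> f \<and> B \<subseteq> A) \<longleftrightarrow> B' = A'"
    using * assms(2) by blast+
qed

lemma ubp_comp_perm_left:
  assumes f: "f \<in> UBP n" and \<sigma>: "\<sigma> permutes {1..n}"
  shows "ubp_comp n (perm_ubp n \<sigma>) f = relabel (\<lambda>x. x) \<sigma> f"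
proof -
  have "finest_coarsening n (Range f) (Domain (perm_ubp n \<sigma>)) = Range f"
    unfolding Domain_perm_ubp using f
    by (intro finest_coarsening_left refines_singletons) (simp add: UBP_def)
  moreover have "\<Union>{B. \<exists>B'. (B, B') \<in> f \<and> B' \<subseteq> snd x} = fst x"
    and "\<Union>{C'. \<exists>C. (C, C') \<in> perm_ubp n \<sigma> \<and> C \<subseteq> snd x} = \<sigma> ` snd x" if "x \<in> f" for x
  proof -
    have x: "(fst x, snd x) \<in> f"
      using that by simp
    show "\<Union>{B. \<exists>B'. (B, B') \<in> f \<and> B' \<subseteq> snd x} = fst x"
      using block_subset_iff(1) [OF f [unfolded UBP_iff_block_bij] x] by simp
    have "{C'. \<exists>C. (C, C') \<in> perm_ubp n \<sigma> \<and> C \<subseteq> snd x} = (\<lambda>i. {\<sigma> i}) ` ({1..n} \<inter> snd x)"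
      unfolding perm_ubp_def by (auto intro: exI [of _ "{_}"])
    also have "{1..n} \<inter> snd x = snd x"
      using UBP_block_subset [OF f x] by blast
    finally show "\<Union>{C'. \<exists>C. (C, C') \<in> perm_ubp n \<sigma> \<and> C \<subseteq> snd x} = \<sigma> ` snd x"
      by auto
  qed
  ultimately show ?thesis
    unfolding ubp_comp_def relabel_def Setcompr_eq_image
    by (simp add: Range_snd image_image split_def cong: image_cong)
qed

text \<open>Stated with \<open>inv \<sigma>\<close>, the form occurring in \<open>ubp_split\<close>:
  the points that \<open>inv \<sigma>\<close> sends into a block are the image of the block under
  \<open>\<sigma>\<close>.\<close>

lemma ubp_comp_perm_right:
  assumes f: "f \<in> UBP n" and \<sigma>: "\<sigma> permutes {1..n}"
  shows "ubp_comp n f (perm_ubp n (inv \<sigma>)) = relabel \<sigma> (\<lambda>x. x) f"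
proof -
  have "finest_coarsening n (Range (perm_ubp n (inv \<sigma>))) (Domain f) = Domain f"
    unfolding Range_perm_ubp [OF permutes_inv [OF \<sigma>]] using f
    by (intro finest_coarsening_right refines_singletons) (simp add: UBP_def)
  moreover have "\<Union>{C'. \<exists>C. (C, C') \<in> f \<and> C \<subseteq> fst x} = snd x"
    and "\<Union>{C. \<exists>C'. (C, C') \<in> perm_ubp n (inv \<sigma>) \<and> C' \<subseteq> fst x} = \<sigma> ` fst x" if "x \<in> f" for x
  proof -
    have x: "(fst x, snd x) \<in> f"
      using that by simp
    show "\<Union>{C'. \<exists>C. (C, C') \<in> f \<and> C \<subseteq> fst x} = snd x"
      using block_subset_iff(2) [OF f [unfolded UBP_iff_block_bij] x] by simp
    have "fst x \<subseteq> {1..n}"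
      using UBP_block_subset [OF f x] by simp
    then have "y \<in> \<sigma> ` fst x \<longleftrightarrow> y \<in> {1..n} \<and> inv \<sigma> y \<in> fst x" for y
      using permutes_inverses [OF \<sigma>] permutes_in_image [OF \<sigma>] by (metis image_iff subsetD)
    moreover have "{C. \<exists>C'. (C, C') \<in> perm_ubp n (inv \<sigma>) \<and> C' \<subseteq> fst x}
        = (\<lambda>i. {i}) ` {y \<in> {1..n}. inv \<sigma> y \<in> fst x}"
      by (auto simp: perm_ubp_def)
    ultimately show "\<Union>{C. \<exists>C'. (C, C') \<in> perm_ubp n (inv \<sigma>) \<and> C' \<subseteq> fst x} = \<sigma> ` fst x"
      by (simp add: set_eq_iff)
  qed
  ultimately show ?thesis
    unfolding ubp_comp_def relabel_def Setcompr_eq_image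
    by (simp add: Domain_fst image_image split_def cong: image_cong)
qed

lemma ubp_concat_eq: "ubp_concat n f g = f \<union> relabel (\<lambda>x. x + n) (\<lambda>x. x + n) g"
  by (auto simp: ubp_concat_def relabel_def)

lemma shift_interval: "(\<lambda>x. x + n) ` {1..m} = {Suc n..n + m}" for n :: nat
  using image_add_atLeastAtMost' [of n 1 m] by (simp add: add.commute)

lemma ubp_concat_UBP:
  assumes "f \<in> UBP n" "g \<in> UBP m"
  shows "ubp_concat n f g \<in> UBP (n + m)"
proof -
  have "block_bij ({1..n} \<union> {Suc n..n + m}) ({1..n} \<union> {Suc n..n + m}) (ubp_concat n f g)"
    unfolding ubp_concat_eq shift_interval [symmetric] using assms
    by (intro block_bij_Un block_bij_relabel) (auto simp: UBP_iff_block_bij)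
  moreover have "{1..n} \<union> {Suc n..n + m} = {1..n + m}"
    by auto
  ultimately show ?thesis
    by (simp add: UBP_iff_block_bij)
qed


section \<open>Shuffles as subsets\<close>

definition shuffle_sets :: "nat \<Rightarrow> nat \<Rightarrow> nat set set" where
  "shuffle_sets n m = {S. S \<subseteq> {1..n + m} \<and> card S = n}"

lemma
  assumes "S \<in> shuffle_sets n m"
  shows shuffle_set_finite: "finite S"
    and shuffle_set_card: "card S = n"
    and shuffle_set_compl_card: "card ({1..n + m} - S) = m"
proof -
  have S: "S \<subseteq> {1..n + m}" "card S = n"
    using assms by (simp_all add: shuffle_sets_def)
  then show "finite S" "card S = n"
    by (auto intro: finite_subset)
  then show "card ({1..n + m} - S) = m"
    using card_Diff_subset [OF \<open>finite S\<close> S(1)] by simp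
qed

text \<open>An increasing map enumerates its image, and since a shuffle is a permutation the images
  of its two intervals are complementary.\<close>

lemma
  assumes \<xi>: "\<xi> \<in> Sh n m"
  shows shuffle_image: "\<xi> ` {1..n} \<in> shuffle_sets n m"
    and shuffle_eq_lower: "k \<in> {1..n} \<Longrightarrow> \<xi> k = nth_elem (\<xi> ` {1..n}) k"
    and shuffle_eq_upper: "k \<in> {1..m} \<Longrightarrow> \<xi> (k + n) = nth_elem ({1..n + m} - \<xi> ` {1..n}) k"
proof -
  have perm: "\<xi> permutes {1..n + m}"
    and mono: "strict_mono_on {1..n} \<xi>" "strict_mono_on {n + 1..n + m} \<xi>"
    using \<xi> by (simp_all add: Sh_def)
  have inj: "inj \<xi>"
    using perm by (rule permutes_inj)
  have "\<xi> ` {1..n} \<subseteq> \<xi> ` {1..n + m}"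
    by (rule image_mono) auto
  then show "\<xi> ` {1..n} \<in> shuffle_sets n m"
    using permutes_image [OF perm] card_image [OF inj_on_subset [OF inj subset_UNIV], of "{1..n}"]
    by (simp add: shuffle_sets_def)
  show "\<xi> k = nth_elem (\<xi> ` {1..n}) k" if "k \<in> {1..n}"
    using mono(1) that by (rule strict_mono_on_eq_nth_elem)
  have "(\<lambda>k. \<xi> (k + n)) ` {1..m} = \<xi> ` {Suc n..n + m}"
    using shift_interval [of n m] by (metis image_image)
  also have "{Suc n..n + m} = {1..n + m} - {1..n}"
    by auto
  also have "\<xi> ` \<dots> = {1..n + m} - \<xi> ` {1..n}"
    using image_set_diff [OF inj] permutes_image [OF perm] by simp
  finally show "\<xi> (k + n) = nth_elem ({1..n + m} - \<xi> ` {1..n}) k" if "k \<in> {1..m}"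
    using strict_mono_on_eq_nth_elem [of m "\<lambda>k. \<xi> (k + n)", OF _ that] mono(2)
    by (simp add: strict_mono_on_def)
qed

lemma shuffle_exists:
  assumes S: "S \<in> shuffle_sets n m"
  shows "\<exists>\<xi>\<in>Sh n m. \<xi> ` {1..n} = S"
proof -
  define T where "T = {1..n + m} - S"
  have fin: "finite S" "finite T" and card: "card S = n" "card T = m"
    using shuffle_set_finite [OF S] shuffle_set_card [OF S] shuffle_set_compl_card [OF S]
    by (simp_all add: T_def)
  \<comment> \<open>Enumerates S, then its complement, in increasing order; elsewhere it is the
    identity, as \<open>permutes\<close> requires.\<close>
  define \<xi> where "\<xi> k = (if k \<in> {1..n} then nth_elem S k
      else if k \<in> {Suc n..n + m} then nth_elem T (k - n) else k)" for k
  have image1: "\<xi> ` {1..n} = S"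
    using nth_elem_image [OF fin(1)] by (simp add: card \<xi>_def)
  have "\<xi> ` {Suc n..n + m} = (\<lambda>k. \<xi> (k + n)) ` {1..m}"
    using shift_interval [of n m] by (metis image_image)
  also have "\<dots> = nth_elem T ` {1..m}"
    by (intro image_cong) (auto simp: \<xi>_def)
  finally have image2: "\<xi> ` {Suc n..n + m} = T"
    using nth_elem_image [OF fin(2)] by (simp add: card)
  have "{1..n + m} = {1..n} \<union> {Suc n..n + m}"
    by auto
  then have "\<xi> ` {1..n + m} = S \<union> T"
    using image1 image2 by (metis image_Un)
  also have "\<dots> = {1..n + m}"
    using S by (auto simp: T_def shuffle_sets_def)
  finally have "\<xi> permutes {1..n + m}"
    by (intro bij_imp_permutes) (auto simp: bij_betw_def eq_card_imp_inj_on \<xi>_def)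
  moreover have "strict_mono_on {1..n} \<xi>"
    using strict_mono_on_nth_elem [OF fin(1)] by (simp add: card \<xi>_def strict_mono_on_def)
  moreover have "strict_mono_on {n + 1..n + m} \<xi>"
    using nth_elem_less [OF fin(2)] by (auto simp: card \<xi>_def strict_mono_on_def)
  ultimately show ?thesis
    using image1 by (auto simp: Sh_def)
qed

lemma bij_betw_shuffle_sets: "bij_betw (\<lambda>\<xi>. \<xi> ` {1..n}) (Sh n m) (shuffle_sets n m)"
  unfolding bij_betw_def
proof
  show "inj_on (\<lambda>\<xi>. \<xi> ` {1..n}) (Sh n m)"
  proof (intro inj_onI ext)
    fix \<xi> \<eta> k assume \<xi>: "\<xi> \<in> Sh n m" and \<eta>: "\<eta> \<in> Sh n m" and eq: "\<xi> ` {1..n} = \<eta> ` {1..n}"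
    \<comment> \<open>Equality as functions concerns all natural numbers; outside {1..n + m} both
      permutations are the identity.\<close>
    consider "k \<in> {1..n}" | l where "k = l + n" "l \<in> {1..m}" | "k \<notin> {1..n + m}"
    proof (cases "k \<in> {1..n}")
      case False
      then have "k = k - n + n \<and> k - n \<in> {1..m}" if "k \<in> {1..n + m}"
        using that by auto
      then show ?thesis
        using that by metis
    qed (use that in blast)
    then show "\<xi> k = \<eta> k"
    proof cases
      case 1
      then show ?thesis
        using shuffle_eq_lower [OF \<xi>] shuffle_eq_lower [OF \<eta>] eq by metis
    next
      case 2
      then show ?thesis
        using shuffle_eq_upper [OF \<xi>] shuffle_eq_upper [OF \<eta>] eq by metis
    next
      case 3
      then show ?thesis
        using \<xi> \<eta> by (auto simp: Sh_def permutes_def)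
    qed
  qed
  show "(\<lambda>\<xi>. \<xi> ` {1..n}) ` Sh n m = shuffle_sets n m"
    using shuffle_image shuffle_exists by blast
qed


section \<open>Product and coproduct of basis elements\<close>

text \<open>
  The product \<open>\<xi> \<cdot> (f \<times> g)\<close>, where \<open>S\<close> is the image of \<open>{1..n}\<close> under the shuffle \<open>\<xi>\<close>.
\<close>

definition merge :: "nat \<Rightarrow> nat \<Rightarrow> nat set \<Rightarrow> ubp \<Rightarrow> ubp \<Rightarrow> ubp" where
  "merge n m S f g =
     relabel (\<lambda>x. x) (nth_elem S) f \<union> relabel (\<lambda>x. x + n) (nth_elem ({1..n + m} - S)) g"

lemma converse_merge: "(merge n m S f g)\<inverse> =
    relabel (nth_elem S) (\<lambda>x. x) (f\<inverse>) \<union> relabel (nth_elem ({1..n + m} - S)) (\<lambda>x. x + n) (g\<inverse>)"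
  by (simp add: merge_def converse_Un converse_relabel)

lemma shuffle_concat:
  assumes \<xi>: "\<xi> \<in> Sh n m" and f: "f \<in> UBP n" and g: "g \<in> UBP m"
  shows "relabel (\<lambda>x. x) \<xi> (ubp_concat n f g) = merge n m (\<xi> ` {1..n}) f g"
  unfolding ubp_concat_eq merge_def relabel_Un relabel_relabel
proof (rule arg_cong2 [of _ _ _ _ "(\<union>)"])
  show "relabel (\<lambda>x. x) \<xi> f = relabel (\<lambda>x. x) (nth_elem (\<xi> ` {1..n})) f"
    using shuffle_eq_lower [OF \<xi>] block_bij_Range [OF f [unfolded UBP_iff_block_bij]]
    by (intro relabel_cong) simp_all
  show "relabel (\<lambda>x. x + n) (\<lambda>x. \<xi> (x + n)) g
      = relabel (\<lambda>x. x + n) (nth_elem ({1..n + m} - \<xi> ` {1..n})) g"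
    using shuffle_eq_upper [OF \<xi>] block_bij_Range [OF g [unfolded UBP_iff_block_bij]]
    by (intro relabel_cong) simp_all
qed

text \<open>Exchanging domain and codomain turns the action of a shuffle on domains, which occurs in
  the splitting, into its action on codomains, which occurs in the product; one description by
  \<open>merge\<close> then serves both.\<close>

lemma concat_shuffle:
  assumes \<xi>: "\<xi> \<in> Sh n m" and f: "f \<in> UBP n" and g: "g \<in> UBP m"
  shows "relabel \<xi> (\<lambda>x. x) (ubp_concat n f g) = (merge n m (\<xi> ` {1..n}) (f\<inverse>) (g\<inverse>))\<inverse>"
proof -
  have "(ubp_concat n f g)\<inverse> = ubp_concat n (f\<inverse>) (g\<inverse>)"
    by (simp add: ubp_concat_eq converse_Un converse_relabel)
  then show ?thesis
    using shuffle_concat [OF \<xi> UBP_converse [OF f] UBP_converse [OF g]]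
    by (metis converse_converse converse_relabel)
qed

lemma merge_UBP:
  assumes S: "S \<in> shuffle_sets n m" and f: "f \<in> UBP n" and g: "g \<in> UBP m"
  shows "merge n m S f g \<in> UBP (n + m)"
proof -
  obtain \<xi> where \<xi>: "\<xi> \<in> Sh n m" "\<xi> ` {1..n} = S"
    using shuffle_exists [OF S] by blast
  then have perm: "\<xi> permutes {1..n + m}"
    by (simp add: Sh_def)
  have "block_bij ((\<lambda>x. x) ` {1..n + m}) (\<xi> ` {1..n + m}) (relabel (\<lambda>x. x) \<xi> (ubp_concat n f g))"
    using ubp_concat_UBP [OF f g] inj_on_subset [OF permutes_inj [OF perm] subset_UNIV]
    by (intro block_bij_relabel) (auto simp: UBP_iff_block_bij)
  then show ?thesis
    unfolding shuffle_concat [OF \<xi>(1) f g] \<xi>(2) permutes_image [OF perm]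
    by (simp add: UBP_iff_block_bij)
qed

text \<open>The codomain blocks of the inverse are the domain blocks of f, inside {1..n}, and those
  of g shifted past n, so none straddles n. Standardisation undoes the enumerations of S and of its
  complement. Recovering S gives injectivity of merging in S.\<close>

lemma
  assumes S: "S \<in> shuffle_sets n m" and f: "f \<in> UBP n" and g: "g \<in> UBP m"
  shows breaks_converse_merge: "n \<in> breaks ((merge n m S f g)\<inverse>)"
    and left_part_converse_merge: "left_part n ((merge n m S f g)\<inverse>) = f\<inverse>"
    and right_part_converse_merge: "right_part n ((merge n m S f g)\<inverse>) = g\<inverse>"
    and Union_Domain_lower_converse_merge: "\<Union>(Domain (lower n ((merge n m S f g)\<inverse>))) = S"
proof -
  let ?u = "(merge n m S f g)\<inverse>"
  define p where "p = relabel (nth_elem S) (\<lambda>x. x) (f\<inverse>)"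
  define q where "q = relabel (nth_elem ({1..n + m} - S)) (\<lambda>x. x + n) (g\<inverse>)"
  have u: "?u = p \<union> q"
    by (simp add: p_def q_def converse_merge)
  have f': "f\<inverse> \<in> UBP n" and g': "g\<inverse> \<in> UBP m"
    using f g by (simp_all add: UBP_converse)
  have p: "A' \<subseteq> {..n}" "\<not> A' \<subseteq> {n<..}" if A: "(A, A') \<in> p" for A A'
  proof -
    obtain B where B: "(B, A') \<in> f\<inverse>"
      using A by (auto simp: p_def relabel_def)
    then have "A' \<noteq> {}" "A' \<subseteq> {1..n}"
      using UBP_block_subset [OF f' B] block_bij_nonempty [OF f' [unfolded UBP_iff_block_bij] B]
      by simp_all
    then show "A' \<subseteq> {..n}" "\<not> A' \<subseteq> {n<..}"
      by force+
  qed
  have q: "A' \<subseteq> {n<..}" "\<not> A' \<subseteq> {..n}" if A: "(A, A') \<in> q" for A A'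
  proof -
    obtain B B' where B: "(B, B') \<in> g\<inverse>" "A' = (\<lambda>x. x + n) ` B'"
      using A by (auto simp: q_def relabel_def)
    then have "B' \<noteq> {}" "B' \<subseteq> {1..m}"
      using UBP_block_subset [OF g' B(1)] block_bij_nonempty [OF g' [unfolded UBP_iff_block_bij] B(1)]
      by simp_all
    then show "A' \<subseteq> {n<..}" "\<not> A' \<subseteq> {..n}"
      unfolding B(2) by force+
  qed
  have lower: "lower n ?u = p" and upper: "upper n ?u = q"
    unfolding u lower_def upper_def using p q by blast+
  have "?u \<in> UBP (n + m)"
    by (intro UBP_converse merge_UBP S f g)
  then have "ubp_size ?u = n + m"
    by (rule ubp_size_eq)
  then show "n \<in> breaks ?u"
    unfolding breaks_def u using p(1) q(1) by (simp add: Range_iff) blast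
  have fin: "finite S" "finite ({1..n + m} - S)"
    and card: "card S = n" "card ({1..n + m} - S) = m"
    using S shuffle_set_finite shuffle_set_card shuffle_set_compl_card by auto
  have supp: "\<Union>(Domain (f\<inverse>)) = {1..n}" "\<Union>(Domain (g\<inverse>)) = {1..m}"
    using f' g' block_bij_Domain by (simp_all only: UBP_iff_block_bij)
  show "left_part n ?u = f\<inverse>"
    unfolding left_part_def lower p_def
    using standardise_relabel [of "f\<inverse>" "nth_elem S" "\<lambda>x. x"] strict_mono_on_nth_elem [OF fin(1)]
    by (simp only: supp card standardise_ident [OF f']) (simp add: strict_mono_on_def)
  show "right_part n ?u = g\<inverse>"
    unfolding right_part_def upper q_def
    using standardise_relabel [of "g\<inverse>" "nth_elem ({1..n + m} - S)" "\<lambda>x. x + n"]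
      strict_mono_on_nth_elem [OF fin(2)]
    by (simp only: supp card standardise_ident [OF g']) (simp add: strict_mono_on_def)
  show "\<Union>(Domain (lower n ?u)) = S"
    unfolding lower p_def Union_Domain_relabel supp
    using nth_elem_image [OF fin(1)] by (simp only: card)
qed

text \<open>S is the domain of the lower half. Enumerating S and its complement inverts the ranks by
  which the two parts were renumbered.\<close>

lemma converse_merge_parts:
  assumes u: "u \<in> UBP (n + m)" and n: "n \<in> breaks u"
  obtains S where "S \<in> shuffle_sets n m"
    and "u = (merge n m S ((left_part n u)\<inverse>) ((right_part n u)\<inverse>))\<inverse>"
proof
  define S where "S = \<Union>(Domain (lower n u))"
  have T: "{1..n + m} - S = \<Union>(Domain (upper n u))"
    using Union_Domain_upper [OF u n] by (simp add: S_def)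
  show S: "S \<in> shuffle_sets n m"
    using Union_Domain_lower [OF u n] card_Union_Domain_lower [OF u n]
    by (simp add: shuffle_sets_def S_def)
  have fin: "finite S" "finite ({1..n + m} - S)"
    using shuffle_set_finite [OF S] by auto
  have "relabel (nth_elem S) (\<lambda>x. x) (left_part n u) = lower n u"
    unfolding left_part_eq [OF u n] relabel_relabel S_def [symmetric]
    using nth_elem_eqI [OF fin(1)] by (intro relabel_id) (simp_all only: S_def [symmetric])
  moreover have "relabel (nth_elem ({1..n + m} - S)) (\<lambda>x. x + n) (right_part n u) = upper n u"
    unfolding right_part_eq [OF u n] relabel_relabel T [symmetric]
    using nth_elem_eqI [OF fin(2)] Union_Range_upper [OF u n]
    by (intro relabel_id) (simp_all only: T [symmetric], simp)
  moreover have "u = lower n u \<union> upper n u"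
    using n unfolding breaks_def lower_def upper_def by blast
  ultimately show "u = (merge n m S ((left_part n u)\<inverse>) ((right_part n u)\<inverse>))\<inverse>"
    by (simp add: converse_merge)
qed

text \<open>The definite description is justified: \<open>converse_merge_parts\<close> provides a
  triple, and the parts and the image set of the shuffle can be read off from f. The shuffle stays
  unspecified because the coproduct discards it.\<close>

lemma ubp_split_eq:
  assumes f: "f \<in> UBP n" and i: "i \<in> breaks f"
  obtains \<xi> where "ubp_split f i = (\<xi>, left_part i f, right_part i f)"
proof -
  have "i \<le> n"
    using i ubp_size_eq [OF f] by (simp add: breaks_def)
  then have n: "i + (n - i) = n"
    by simp
  have comp: "ubp_comp n (ubp_concat i g h) (perm_ubp n (inv \<xi>))
      = (merge i (n - i) (\<xi> ` {1..i}) (g\<inverse>) (h\<inverse>))\<inverse>"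
    if "\<xi> \<in> Sh i (n - i)" "g \<in> UBP i" "h \<in> UBP (n - i)" for \<xi> g h
  proof -
    have "\<xi> permutes {1..n}"
      using that(1) by (simp add: Sh_def n)
    moreover have "ubp_concat i g h \<in> UBP n"
      using ubp_concat_UBP [OF that(2,3)] by (simp add: n)
    ultimately show ?thesis
      using concat_shuffle [OF that] by (simp add: ubp_comp_perm_right)
  qed
  have f': "f \<in> UBP (i + (n - i))"
    using f by (simp add: n)
  obtain S where S: "S \<in> shuffle_sets i (n - i)"
    and f_eq: "f = (merge i (n - i) S ((left_part i f)\<inverse>) ((right_part i f)\<inverse>))\<inverse>"
    using converse_merge_parts [OF f' i] .
  obtain \<xi> where \<xi>: "\<xi> \<in> Sh i (n - i)" "\<xi> ` {1..i} = S"
    using shuffle_exists [OF S] by blast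
  have "ubp_split f i = (\<xi>, left_part i f, right_part i f)"
    unfolding ubp_split_def Let_def ubp_size_eq [OF f]
  proof (rule the_equality)
    show "case (\<xi>, left_part i f, right_part i f) of (\<xi>, g, h) \<Rightarrow>
        \<xi> \<in> Sh i (n - i) \<and> g \<in> UBP i \<and> h \<in> UBP (n - i) \<and>
        f = ubp_comp n (ubp_concat i g h) (perm_ubp n (inv \<xi>))"
      using \<xi> f_eq comp left_part_UBP [OF f i] right_part_UBP [OF f i] by simp
  next
    fix t assume t: "case t of (\<xi>, g, h) \<Rightarrow>
        \<xi> \<in> Sh i (n - i) \<and> g \<in> UBP i \<and> h \<in> UBP (n - i) \<and>
        f = ubp_comp n (ubp_concat i g h) (perm_ubp n (inv \<xi>))"
    obtain \<eta> g h where t_eq: "t = (\<eta>, g, h)"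
      by (cases t)
    then have \<eta>: "\<eta> \<in> Sh i (n - i)" and g: "g \<in> UBP i" and h: "h \<in> UBP (n - i)"
      and eq: "f = (merge i (n - i) (\<eta> ` {1..i}) (g\<inverse>) (h\<inverse>))\<inverse>"
      using t comp by auto
    note parts = shuffle_image [OF \<eta>] UBP_converse [OF g] UBP_converse [OF h]
    have "g = left_part i f" "h = right_part i f"
      using left_part_converse_merge [OF parts] right_part_converse_merge [OF parts] eq by simp_all
    moreover have "S = \<Union>(Domain (lower i f))"
      using Union_Domain_lower_converse_merge [OF S UBP_converse UBP_converse,
          OF left_part_UBP [OF f i] right_part_UBP [OF f i]] f_eq by simp
    then have "\<eta> ` {1..i} = \<xi> ` {1..i}"
      using Union_Domain_lower_converse_merge [OF parts] eq \<xi>(2) by simp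
    then have "\<eta> = \<xi>"
      using bij_betw_shuffle_sets [of i "n - i"] \<eta> \<xi>(1) by (auto simp: bij_betw_def dest: inj_onD)
    ultimately show "t = (\<xi>, left_part i f, right_part i f)"
      by (simp add: t_eq)
  qed
  then show ?thesis
    by (rule that)
qed

lemma ubp_comult_basis:
  assumes "f \<in> UBP n"
  shows "ubp_comult (basis f) = (\<Sum>i\<in>breaks f. basis (left_part i f, right_part i f))"
  unfolding ubp_comult_def linear_extension_basis ubp_size_eq [OF assms]
    breaks_eq_breaking_points [OF assms, symmetric]
proof (rule sum.cong [OF refl])
  fix i assume "i \<in> breaks f"
  then obtain \<xi> where "ubp_split f i = (\<xi>, left_part i f, right_part i f)"
    using ubp_split_eq [OF assms] by blast
  then show "(case ubp_split f i of (\<xi>, g, h) \<Rightarrow> tensor (basis g) (basis h))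
      = basis (left_part i f, right_part i f)"
    by simp
qed

lemma lin_ubp_mult_left: "lin (\<lambda>x. ubp_mult x y)"
  and lin_ubp_mult_right: "lin (ubp_mult x)"
  unfolding ubp_mult_def by (rule lin_bilinear_extension_left lin_bilinear_extension_right)+

lemma lin_ubp_comult: "lin ubp_comult"
  unfolding ubp_comult_def by (rule lin_linear_extension)

lemma ubp_mult_basis:
  assumes f: "f \<in> UBP n" and g: "g \<in> UBP m"
  shows "ubp_mult (basis f) (basis g) = (\<Sum>S\<in>shuffle_sets n m. basis (merge n m S f g))"
proof -
  have "ubp_mult (basis f) (basis g)
      = (\<Sum>\<xi>\<in>Sh n m. basis (ubp_comp (n + m) (perm_ubp (n + m) \<xi>) (ubp_concat n f g)))"
    by (simp add: ubp_mult_def ubp_size_eq [OF f] ubp_size_eq [OF g] monoid_algebra_mult_def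
        shuffle_sum_def lin_sum [OF lin_bilinear_extension_left])
  also have "\<dots> = (\<Sum>\<xi>\<in>Sh n m. basis (merge n m (\<xi> ` {1..n}) f g))"
  proof (rule sum.cong [OF refl])
    fix \<xi> assume "\<xi> \<in> Sh n m"
    then show "basis (ubp_comp (n + m) (perm_ubp (n + m) \<xi>) (ubp_concat n f g))
        = basis (merge n m (\<xi> ` {1..n}) f g)"
      using shuffle_concat [OF _ f g] ubp_comp_perm_left [OF ubp_concat_UBP [OF f g]]
      by (simp add: Sh_def)
  qed
  also have "\<dots> = (\<Sum>S\<in>shuffle_sets n m. basis (merge n m S f g))"
    by (rule sum.reindex_bij_betw [OF bij_betw_shuffle_sets])
  finally show ?thesis .
qed

text \<open>The fibre over (f, g) of the splitting at n.\<close>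

definition unsplits :: "nat \<Rightarrow> nat \<Rightarrow> ubp \<Rightarrow> ubp \<Rightarrow> ubp set" where
  "unsplits n m f g =
     {u \<in> UBP (n + m). n \<in> breaks u \<and> left_part n u = f \<and> right_part n u = g}"

lemma finite_unsplits: "finite (unsplits n m f g)"
  by (rule finite_subset [OF _ finite_UBP [of "n + m"]]) (auto simp: unsplits_def)

text \<open>
  Inversion turns the product into the dual of the coproduct, so that its associativity is
  an instance of the coassociativity of splitting.
\<close>

lemma ubp_mult_basis_unsplits:
  assumes f: "f \<in> UBP n" and g: "g \<in> UBP m"
  shows "ubp_mult (basis f) (basis g) = (\<Sum>u\<in>unsplits n m (f\<inverse>) (g\<inverse>). basis (u\<inverse>))"
proof -
  have "bij_betw (\<lambda>S. (merge n m S f g)\<inverse>) (shuffle_sets n m) (unsplits n m (f\<inverse>) (g\<inverse>))"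
  proof (rule bij_betw_imageI)
    show "inj_on (\<lambda>S. (merge n m S f g)\<inverse>) (shuffle_sets n m)"
    proof (rule inj_onI)
      fix S T assume S: "S \<in> shuffle_sets n m" and T: "T \<in> shuffle_sets n m"
        and eq: "(merge n m S f g)\<inverse> = (merge n m T f g)\<inverse>"
      show "S = T"
        using Union_Domain_lower_converse_merge [OF S f g] Union_Domain_lower_converse_merge [OF T f g]
        unfolding eq by (rule trans [OF sym])
    qed
    have "(merge n m S f g)\<inverse> \<in> unsplits n m (f\<inverse>) (g\<inverse>)" if "S \<in> shuffle_sets n m" for S
      using breaks_converse_merge [OF that f g] left_part_converse_merge [OF that f g]
        right_part_converse_merge [OF that f g] UBP_converse [OF merge_UBP [OF that f g]]
      by (simp add: unsplits_def)
    moreover have "u \<in> (\<lambda>S. (merge n m S f g)\<inverse>) ` shuffle_sets n m"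
      if "u \<in> unsplits n m (f\<inverse>) (g\<inverse>)" for u
    proof -
      have u: "u \<in> UBP (n + m)" "n \<in> breaks u" "left_part n u = f\<inverse>" "right_part n u = g\<inverse>"
        using that by (simp_all add: unsplits_def)
      obtain S where "S \<in> shuffle_sets n m" "u = (merge n m S f g)\<inverse>"
        using converse_merge_parts [OF u(1,2)] u(3,4) by (metis converse_converse)
      then show ?thesis
        by blast
    qed
    ultimately show "(\<lambda>S. (merge n m S f g)\<inverse>) ` shuffle_sets n m = unsplits n m (f\<inverse>) (g\<inverse>)"
      by blast
  qed
  from sum.reindex_bij_betw [OF this, of "\<lambda>u. basis (u\<inverse>)"] show ?thesis
    by (simp add: ubp_mult_basis [OF f g])
qed


section \<open>Associativity and coassociativity\<close>

text \<open>Both sums run over the pairs i \<le> j of breaking points of f; the second one writes j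
  as i + k. The function \<open>\<phi>\<close> is arbitrary so that the reindexing serves
  coassociativity as well as associativity of convolution.\<close>

lemma sum_split_coassoc:
  fixes \<phi> :: "ubp \<Rightarrow> ubp \<Rightarrow> ubp \<Rightarrow> 'v::ab_group_add"
  assumes f: "f \<in> UBP n"
  shows "(\<Sum>j\<in>breaks f. \<Sum>i\<in>breaks (left_part j f).
      \<phi> (left_part i (left_part j f)) (right_part i (left_part j f)) (right_part j f))
    = (\<Sum>i\<in>breaks f. \<Sum>k\<in>breaks (right_part i f).
      \<phi> (left_part i f) (left_part k (right_part i f)) (right_part k (right_part i f)))"
    (is "?lhs = ?rhs")
proof -
  have "?lhs = (\<Sum>(j, i)\<in>(SIGMA j:breaks f. breaks (left_part j f)).
      \<phi> (left_part i (left_part j f)) (right_part i (left_part j f)) (right_part j f))"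
    by (simp add: sum.Sigma)
  also have "\<dots> = (\<Sum>(i, k)\<in>(SIGMA i:breaks f. breaks (right_part i f)).
      \<phi> (left_part i f) (left_part k (right_part i f)) (right_part k (right_part i f)))"
  proof -
    have fwd: "i \<le> j \<and> i \<in> breaks f \<and> j - i \<in> breaks (right_part i f)
        \<and> left_part i (left_part j f) = left_part i f
        \<and> left_part (j - i) (right_part i f) = right_part i (left_part j f)
        \<and> right_part (j - i) (right_part i f) = right_part j f"
      if j: "j \<in> breaks f" and i: "i \<in> breaks (left_part j f)" for i j
    proof -
      have "i \<le> j"
        using i ubp_size_eq [OF left_part_UBP [OF f j]] by (simp add: breaks_def)
      moreover from this have "i \<in> breaks f"
        using i breaks_left_part [OF f j] by blast
      ultimately show ?thesis
        using breaks_right_part [OF f, of i "j - i"] left_part_right_part [OF f, of i "j - i"]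
          right_part_right_part [OF f, of i "j - i"] left_part_left_part [OF f j, of i]
          right_part_left_part [OF f j, of i] j by simp
    qed
    have bwd: "i + k \<in> breaks f \<and> i \<in> breaks (left_part (i + k) f)"
      if "i \<in> breaks f" "k \<in> breaks (right_part i f)" for i k
      using breaks_right_part [OF f that(1), of k] breaks_left_part [OF f, of "i + k" i] that by simp
    show ?thesis
      by (rule sum.reindex_bij_witness [of _ "\<lambda>(i, k). (i + k, i)" "\<lambda>(j, i). (i, j - i)"])
        (clarsimp; (frule (1) fwd | frule (1) bwd); simp)+
  qed
  also have "\<dots> = ?rhs"
    by (simp add: sum.Sigma)
  finally show ?thesis .
qed

lemma ubp_comult_coassoc_basis:
  assumes f: "f \<in> UBP n"
  shows "tensor_assoc (tensor_map ubp_comult (\<lambda>y. y) (ubp_comult (basis f)))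
    = tensor_map (\<lambda>y. y) ubp_comult (ubp_comult (basis f))"
proof -
  have comult: "ubp_comult (basis (left_part i f))
      = (\<Sum>k\<in>breaks (left_part i f). basis (left_part k (left_part i f), right_part k (left_part i f)))"
    "ubp_comult (basis (right_part i f))
      = (\<Sum>k\<in>breaks (right_part i f). basis (left_part k (right_part i f), right_part k (right_part i f)))"
    if "i \<in> breaks f" for i
    using ubp_comult_basis left_part_UBP [OF f that] right_part_UBP [OF f that] by blast+
  have "tensor_assoc (tensor_map ubp_comult (\<lambda>y. y) (ubp_comult (basis f)))
      = (\<Sum>j\<in>breaks f. \<Sum>i\<in>breaks (left_part j f). basis (left_part i (left_part j f),
          right_part i (left_part j f), right_part j f))"
    by (simp add: ubp_comult_basis [OF f] comult cong: sum.cong_simp add: lin_sum [OF lin_tensor_map]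
        lin_sum [OF lin_tensor_left] lin_sum [OF lin_tensor_assoc])
  also have "\<dots> = (\<Sum>i\<in>breaks f. \<Sum>k\<in>breaks (right_part i f). basis (left_part i f,
      left_part k (right_part i f), right_part k (right_part i f)))"
    by (rule sum_split_coassoc [OF f, of "\<lambda>p q r. basis (p, q, r)"])
  also have "\<dots> = tensor_map (\<lambda>y. y) ubp_comult (ubp_comult (basis f))"
    by (simp add: ubp_comult_basis [OF f] comult cong: sum.cong_simp add: lin_sum [OF lin_tensor_map]
        lin_sum [OF lin_tensor_right])
  finally show ?thesis .
qed

text \<open>Both sides enumerate the u with breaking points n and n + m whose three parts are the
  inverses of f, g and h. The inverse of the intermediate product is determined by u: it is the left
  part at n + m for one bracketing, the right part at n for the other.\<close>

lemma ubp_mult_assoc_basis: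
  assumes f: "f \<in> UBP n" and g: "g \<in> UBP m" and h: "h \<in> UBP p"
  shows "ubp_mult (ubp_mult (basis f) (basis g)) (basis h)
    = ubp_mult (basis f) (ubp_mult (basis g) (basis h))"
proof -
  have UBP: "u\<inverse> \<in> UBP (i + j)" if "u \<in> unsplits i j q r" for u i j q r
    using that by (simp add: unsplits_def UBP_converse)
  have "ubp_mult (ubp_mult (basis f) (basis g)) (basis h)
      = (\<Sum>v\<in>unsplits n m (f\<inverse>) (g\<inverse>). \<Sum>u\<in>unsplits (n + m) p v (h\<inverse>). basis (u\<inverse>))"
    by (simp add: ubp_mult_basis_unsplits [OF f g] lin_sum [OF lin_ubp_mult_left]
        ubp_mult_basis_unsplits [OF UBP h])
  also have "\<dots> = (\<Sum>(v, u)\<in>(SIGMA v:unsplits n m (f\<inverse>) (g\<inverse>). unsplits (n + m) p v (h\<inverse>)). basis (u\<inverse>))"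
    by (simp add: sum.Sigma finite_unsplits)
  also have "\<dots> = (\<Sum>(w, u)\<in>(SIGMA w:unsplits m p (g\<inverse>) (h\<inverse>). unsplits n (m + p) (f\<inverse>) w). basis (u\<inverse>))"
  proof -
    have fwd: "right_part n u \<in> unsplits m p (g\<inverse>) (h\<inverse>) \<and> u \<in> unsplits n (m + p) (f\<inverse>) (right_part n u)
        \<and> left_part (n + m) u = v"
      if v: "v \<in> unsplits n m (f\<inverse>) (g\<inverse>)" and u: "u \<in> unsplits (n + m) p v (h\<inverse>)" for u v
    proof -
      have u: "u \<in> UBP (n + m + p)" "n + m \<in> breaks u" "v = left_part (n + m) u" "right_part (n + m) u = h\<inverse>"
        and v: "n \<in> breaks v" "left_part n v = f\<inverse>" "right_part n v = g\<inverse>"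
        using u v by (simp_all add: unsplits_def)
      have n: "n \<in> breaks u"
        using breaks_left_part [OF u(1,2), of n] v(1) u(3) by simp
      then show ?thesis
        using u v breaks_right_part [OF u(1) n, of m] right_part_UBP [OF u(1) n]
          left_part_right_part [OF u(1) n, of m] right_part_right_part [OF u(1) n, of m]
          left_part_left_part [OF u(1,2), of n] right_part_left_part [OF u(1,2), of n]
        by (simp add: unsplits_def add.assoc)
    qed
    have bwd: "left_part (n + m) u \<in> unsplits n m (f\<inverse>) (g\<inverse>)
        \<and> u \<in> unsplits (n + m) p (left_part (n + m) u) (h\<inverse>) \<and> right_part n u = w"
      if w: "w \<in> unsplits m p (g\<inverse>) (h\<inverse>)" and u: "u \<in> unsplits n (m + p) (f\<inverse>) w" for u w
    proof -
      have u: "u \<in> UBP (n + m + p)" "n \<in> breaks u" "w = right_part n u" "left_part n u = f\<inverse>"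
        and w: "m \<in> breaks w" "left_part m w = g\<inverse>" "right_part m w = h\<inverse>"
        using u w by (simp_all add: unsplits_def add.assoc)
      have nm: "n + m \<in> breaks u"
        using breaks_right_part [OF u(1,2), of m] w(1) u(3) by simp
      then show ?thesis
        using u w breaks_left_part [OF u(1) nm, of n] left_part_UBP [OF u(1) nm]
          left_part_right_part [OF u(1,2), of m] right_part_right_part [OF u(1,2), of m]
          left_part_left_part [OF u(1) nm, of n] right_part_left_part [OF u(1) nm, of n]
        by (simp add: unsplits_def)
    qed
    show ?thesis
      by (rule sum.reindex_bij_witness [of _ "\<lambda>(w, u). (left_part (n + m) u, u)"
            "\<lambda>(v, u). (right_part n u, u)"])
        (clarsimp; (frule (1) fwd | frule (1) bwd); simp)+
  qed
  also have "\<dots> = (\<Sum>w\<in>unsplits m p (g\<inverse>) (h\<inverse>). \<Sum>u\<in>unsplits n (m + p) (f\<inverse>) w. basis (u\<inverse>))"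
    by (simp add: sum.Sigma finite_unsplits)
  also have "\<dots> = ubp_mult (basis f) (ubp_mult (basis g) (basis h))"
    by (simp add: ubp_mult_basis_unsplits [OF g h] lin_sum [OF lin_ubp_mult_right]
        ubp_mult_basis_unsplits [OF f UBP])
  finally show ?thesis .
qed


section \<open>Compatibility of the product and the coproduct\<close>

text \<open>This closes the gap in the domain. In both arguments all of p precedes all of q, so one
  increasing map transforms the right one into the left one: \<open>\<alpha>\<close> up to n and,
  beyond n, \<open>\<beta>\<close> after undoing the shift.\<close>

lemma standardise_Un_shift:
  assumes p: "\<Union>(Domain p) \<subseteq> {1..n}" and q: "\<Union>(Domain q) \<subseteq> {1..m}"
    and \<alpha>: "strict_mono_on (\<Union>(Domain p)) \<alpha>" "\<And>x. x \<in> \<Union>(Domain p) \<Longrightarrow> \<alpha> x \<le> c"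
    and \<beta>: "strict_mono_on (\<Union>(Domain q)) \<beta>" "\<And>x. x \<in> \<Union>(Domain q) \<Longrightarrow> 1 \<le> \<beta> x"
    and \<psi>: "strict_mono_on (\<Union>(Range p) \<union> \<Union>(Range q)) \<psi>"
  shows "standardise (relabel \<alpha> \<psi> p \<union> relabel (\<lambda>x. \<beta> x + c) \<psi> q)
    = standardise (p \<union> relabel (\<lambda>x. x + n) (\<lambda>x. x) q)"
proof -
  let ?u = "p \<union> relabel (\<lambda>x. x + n) (\<lambda>x. x) q"
  define \<phi> where "\<phi> x = (if x \<le> n then \<alpha> x else \<beta> (x - n) + c)" for x
  have le: "x \<le> n" if "x \<in> \<Union>(Domain p)" for x
    using that p by (meson atLeastAtMost_iff subsetD)
  have pos: "0 < x" if "x \<in> \<Union>(Domain q)" for x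
    using that q by fastforce
  have Domain: "\<Union>(Domain ?u) = \<Union>(Domain p) \<union> (\<lambda>x. x + n) ` \<Union>(Domain q)"
    by (simp add: Domain_Un_eq)
  have Range: "\<Union>(Range ?u) = \<Union>(Range p) \<union> \<Union>(Range q)"
    by (simp add: Range_Un_eq)
  have "relabel \<alpha> \<psi> p = relabel \<phi> \<psi> p"
    using le by (intro relabel_cong) (simp_all add: \<phi>_def)
  moreover have "relabel (\<lambda>x. \<beta> x + c) \<psi> q = relabel \<phi> \<psi> (relabel (\<lambda>x. x + n) (\<lambda>x. x) q)"
  proof -
    have "\<phi> (x + n) = \<beta> x + c" if "x \<in> \<Union>(Domain q)" for x
      using pos [OF that] by (simp add: \<phi>_def)
    then show ?thesis
      unfolding relabel_relabel by (intro relabel_cong) simp_all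
  qed
  moreover have "strict_mono_on (\<Union>(Domain ?u)) \<phi>"
    unfolding Domain
  proof (rule strict_mono_onI)
    fix x y assume x: "x \<in> \<Union>(Domain p) \<union> (\<lambda>x. x + n) ` \<Union>(Domain q)"
      and y: "y \<in> \<Union>(Domain p) \<union> (\<lambda>x. x + n) ` \<Union>(Domain q)" and "x < y"
    consider "x \<in> \<Union>(Domain p)" "y \<in> \<Union>(Domain p)"
      | z where "x \<in> \<Union>(Domain p)" "z \<in> \<Union>(Domain q)" "y = z + n"
      | w z where "w \<in> \<Union>(Domain q)" "z \<in> \<Union>(Domain q)" "x = w + n" "y = z + n"
    proof -
      \<comment> \<open>Excludes the fourth combination, with x on the side of q and y on the side
        of p.\<close>
      have "n \<le> z" if "z \<in> (\<lambda>x. x + n) ` \<Union>(Domain q)" for z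
        using that by auto
      then have "\<not> (x \<in> (\<lambda>x. x + n) ` \<Union>(Domain q) \<and> y \<in> \<Union>(Domain p))"
        using le [of y] \<open>x < y\<close> by (meson leD le_trans)
      then show ?thesis
        using x y that by (elim UnE imageE) blast+
    qed
    then show "\<phi> x < \<phi> y"
    proof cases
      case 1
      then show ?thesis
        using le \<open>x < y\<close> strict_mono_onD [OF \<alpha>(1)] by (simp only: \<phi>_def) simp
    next
      \<comment> \<open>The two bounds in the hypotheses give
        \<open>\<alpha> x \<le> c < \<beta> z + c\<close>.\<close>
      case 2
      then show ?thesis
        using le [OF 2(1)] pos [OF 2(2)] \<alpha>(2) [OF 2(1)] \<beta>(2) [OF 2(2)] 2(3)
        by (simp add: \<phi>_def)
    next
      case 3
      then show ?thesis
        using pos [OF 3(1)] pos [OF 3(2)] \<open>x < y\<close> strict_mono_onD [OF \<beta>(1) 3(1,2)] 3(3,4)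
        by (simp add: \<phi>_def)
    qed
  qed
  ultimately show ?thesis
    using standardise_relabel [of ?u \<phi> \<psi>] \<psi> by (simp only: Range relabel_Un)
qed

text \<open>Each of 1, ..., i belongs either to S or to its complement. A cut of a merge at i thus
  induces cuts of the two factors whose positions add up to i.\<close>

lemma rank_add_rank_compl:
  assumes "S \<subseteq> {1..N}" "i \<le> N"
  shows "rank S i + rank ({1..N} - S) i = i"
proof -
  have "finite S"
    using assms(1) by (rule finite_subset) simp
  then have "rank S i + rank ({1..N} - S) i = card ({y \<in> S. y \<le> i} \<union> {y \<in> {1..N} - S. y \<le> i})"
    unfolding rank_def by (intro card_Un_disjoint [symmetric]) auto
  also have "{y \<in> S. y \<le> i} \<union> {y \<in> {1..N} - S. y \<le> i} = {1..i}"
    using assms by auto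
  finally show ?thesis
    by simp
qed

lemma rank_le_card: "finite S \<Longrightarrow> rank S i \<le> card S"
  unfolding rank_def by (intro card_mono) auto

lemma nth_elem_image_le_iff:
  assumes "finite S" "A \<subseteq> {1..card S}"
  shows "nth_elem S ` A \<subseteq> {..i} \<longleftrightarrow> A \<subseteq> {..rank S i}"
    and "nth_elem S ` A \<subseteq> {i<..} \<longleftrightarrow> A \<subseteq> {rank S i<..}"
proof -
  have *: "nth_elem S k \<le> i \<longleftrightarrow> k \<le> rank S i" if "k \<in> A" for k
    using that assms by (intro nth_elem_le_iff) auto
  show "nth_elem S ` A \<subseteq> {..i} \<longleftrightarrow> A \<subseteq> {..rank S i}"
    unfolding image_subset_iff subset_eq [of A] using * by simp
  show "nth_elem S ` A \<subseteq> {i<..} \<longleftrightarrow> A \<subseteq> {rank S i<..}"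
    unfolding image_subset_iff subset_eq [of A] using * by (simp add: not_le [symmetric])
qed

section \<open>Cutting a merge at a point\<close>

context
  fixes n m S f g i
  assumes S: "S \<in> shuffle_sets n m" and f: "f \<in> UBP n" and g: "g \<in> UBP m" and i: "i \<le> n + m"
begin

private abbreviation "T \<equiv> {1..n + m} - S"
text \<open>The cut induced on f: how many of the values up to i come from f; \<open>b\<close> plays
  this role for g.\<close>

private abbreviation "a \<equiv> rank S i"
private abbreviation "b \<equiv> rank T i"

private lemma fin: "finite S" "finite T" and card: "card S = n" "card T = m"
  using shuffle_set_finite [OF S] shuffle_set_card [OF S] shuffle_set_compl_card [OF S] by auto

private lemma ab: "a + b = i" "a \<le> n" "b \<le> m"
  using rank_add_rank_compl [of S "n + m" i] i S rank_le_card [OF fin(1), of i]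
    rank_le_card [OF fin(2), of i] unfolding card by (simp_all add: shuffle_sets_def)

private lemma image_le_iff:
  shows "A \<in> Range f \<Longrightarrow> nth_elem S ` A \<subseteq> {..i} \<longleftrightarrow> A \<subseteq> {..a}"
    and "A \<in> Range f \<Longrightarrow> nth_elem S ` A \<subseteq> {i<..} \<longleftrightarrow> A \<subseteq> {a<..}"
    and "A \<in> Range g \<Longrightarrow> nth_elem T ` A \<subseteq> {..i} \<longleftrightarrow> A \<subseteq> {..b}"
    and "A \<in> Range g \<Longrightarrow> nth_elem T ` A \<subseteq> {i<..} \<longleftrightarrow> A \<subseteq> {b<..}"
proof -
  have sub: "A \<in> Range f \<Longrightarrow> A \<subseteq> {1..card S}" "A \<in> Range g \<Longrightarrow> A \<subseteq> {1..card T}"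
    unfolding card using UBP_block_subset(2) [OF f] UBP_block_subset(2) [OF g] by (metis RangeE)+
  show "A \<in> Range f \<Longrightarrow> nth_elem S ` A \<subseteq> {..i} \<longleftrightarrow> A \<subseteq> {..a}"
    "A \<in> Range f \<Longrightarrow> nth_elem S ` A \<subseteq> {i<..} \<longleftrightarrow> A \<subseteq> {a<..}"
    by (rule nth_elem_image_le_iff [OF fin(1) sub(1)]; assumption)+
  show "A \<in> Range g \<Longrightarrow> nth_elem T ` A \<subseteq> {..i} \<longleftrightarrow> A \<subseteq> {..b}"
    "A \<in> Range g \<Longrightarrow> nth_elem T ` A \<subseteq> {i<..} \<longleftrightarrow> A \<subseteq> {b<..}"
    by (rule nth_elem_image_le_iff [OF fin(2) sub(2)]; assumption)+
qed

text \<open>Enumerating S sends positions up to a to values up to i and later positions beyond i, so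
  a block of f straddles a exactly when its image straddles i; likewise for g with b.\<close>

lemma breaks_merge: "i \<in> breaks (merge n m S f g) \<longleftrightarrow> a \<in> breaks f \<and> b \<in> breaks g"
proof -
  have "ubp_size (merge n m S f g) = n + m"
    by (intro ubp_size_eq merge_UBP S f g)
  moreover have "Range (merge n m S f g) = (`) (nth_elem S) ` Range f \<union> (`) (nth_elem T) ` Range g"
    by (simp add: merge_def Range_Un_eq Range_relabel)
  ultimately show ?thesis
    using i ab image_le_iff by (simp add: breaks_def ubp_size_eq [OF f] ubp_size_eq [OF g] ball_Un)
qed

private lemma lower_merge: "lower i (merge n m S f g)
    = relabel (\<lambda>x. x) (nth_elem S) (lower a f) \<union> relabel (\<lambda>x. x + n) (nth_elem T) (lower b g)"
proof -
  have "lower i (merge n m S f g) = lower i (relabel (\<lambda>x. x) (nth_elem S) f)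
      \<union> lower i (relabel (\<lambda>x. x + n) (nth_elem T) g)"
    by (auto simp: merge_def lower_def)
  moreover have "{(A, A') \<in> f. nth_elem S ` A' \<subseteq> {..i}} = lower a f"
    "{(A, A') \<in> g. nth_elem T ` A' \<subseteq> {..i}} = lower b g"
    unfolding lower_def using image_le_iff(1,3) by blast+
  ultimately show ?thesis
    by (simp only: lower_relabel)
qed

private lemma upper_merge: "upper i (merge n m S f g)
    = relabel (\<lambda>x. x) (nth_elem S) (upper a f) \<union> relabel (\<lambda>x. x + n) (nth_elem T) (upper b g)"
proof -
  have "upper i (merge n m S f g) = upper i (relabel (\<lambda>x. x) (nth_elem S) f)
      \<union> upper i (relabel (\<lambda>x. x + n) (nth_elem T) g)"
    by (auto simp: merge_def upper_def)
  moreover have "{(A, A') \<in> f. nth_elem S ` A' \<subseteq> {i<..}} = upper a f"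
    "{(A, A') \<in> g. nth_elem T ` A' \<subseteq> {i<..}} = upper b g"
    unfolding upper_def using image_le_iff(2,4) by blast+
  ultimately show ?thesis
    by (simp only: upper_relabel)
qed

text \<open>Of the n elements of S, a lie up to i and n - a beyond; a + b = i makes the sizes of the
  surrounding intervals fit.\<close>

lemma shuffle_set_lower: "S \<inter> {..i} \<in> shuffle_sets a b"
  and shuffle_set_upper: "(\<lambda>x. x - i) ` (S \<inter> {i<..}) \<in> shuffle_sets (n - a) (m - b)"
proof -
  have S': "S \<subseteq> {1..n + m}"
    using S by (simp add: shuffle_sets_def)
  have "S \<inter> {..i} = {y \<in> S. y \<le> i}"
    by auto
  moreover have "S \<inter> {..i} \<subseteq> {1..i}"
    using S' by auto
  ultimately show "S \<inter> {..i} \<in> shuffle_sets a b"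
    unfolding shuffle_sets_def ab(1) by (simp add: rank_def)
  have "card S = card (S \<inter> {..i}) + card (S \<inter> {i<..})"
    using fin(1) by (subst card_Un_disjoint [symmetric]) (auto intro: arg_cong [of _ _ card])
  then have "card (S \<inter> {i<..}) = n - a"
    using \<open>S \<inter> {..i} = {y \<in> S. y \<le> i}\<close> by (simp add: card rank_def)
  moreover have "inj_on (\<lambda>x. x - i) (S \<inter> {i<..})"
    by (auto simp: inj_on_def)
  moreover have "n - a + (m - b) = n + m - i"
    using ab by simp
  moreover have "(\<lambda>x. x - i) ` (S \<inter> {i<..}) \<subseteq> {1..n + m - i}"
    using S' by force
  ultimately show "(\<lambda>x. x - i) ` (S \<inter> {i<..}) \<in> shuffle_sets (n - a) (m - b)"
    by (simp add: shuffle_sets_def card_image)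
qed

context
  assumes a: "a \<in> breaks f" and b: "b \<in> breaks g"
begin

text \<open>The right-hand side is already standard, so it is enough to compare standardisations.
  Its g-part is shifted in the domain by a, that of the lower half of the merge by n, which
  \<open>standardise_Un_shift\<close> absorbs.\<close>

lemma left_part_merge:
  "left_part i (merge n m S f g) = merge a b (S \<inter> {..i}) (left_part a f) (left_part b g)"
proof -
  define \<alpha> where "\<alpha> = rank (\<Union>(Domain (lower a f)))"
  define \<beta> where "\<beta> = rank (\<Union>(Domain (lower b g)))"
  have compl: "{1..a + b} - S \<inter> {..i} = T \<inter> {..i}"
    using i unfolding ab(1) by auto
  have left: "left_part a f = relabel \<alpha> (\<lambda>x. x) (lower a f)"
    "left_part b g = relabel \<beta> (\<lambda>x. x) (lower b g)"
    unfolding \<alpha>_def \<beta>_def by (rule left_part_eq [OF f a] left_part_eq [OF g b])+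
  have "merge a b (S \<inter> {..i}) (left_part a f) (left_part b g)
      = relabel \<alpha> (nth_elem (S \<inter> {..i})) (lower a f)
        \<union> relabel (\<lambda>x. \<beta> x + a) (nth_elem (T \<inter> {..i})) (lower b g)"
    by (simp only: merge_def left relabel_relabel compl)
  \<comment> \<open>Only the first a and b positions occur, and there cutting S and T at i does not
    affect the enumeration.\<close>
  also have "\<dots> = relabel \<alpha> (nth_elem S) (lower a f) \<union> relabel (\<lambda>x. \<beta> x + a) (nth_elem T) (lower b g)"
    using nth_elem_initial [OF fin(1)] nth_elem_initial [OF fin(2)]
    by (intro arg_cong2 [of _ _ _ _ "(\<union>)"] relabel_cong refl)
      (simp_all only: Union_Range_lower [OF f a] Union_Range_lower [OF g b])
  also have "\<dots> = relabel \<alpha> (\<lambda>x. x) (relabel (\<lambda>x. x) (nth_elem S) (lower a f))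
      \<union> relabel (\<lambda>x. \<beta> x + a) (\<lambda>x. x) (relabel (\<lambda>x. x) (nth_elem T) (lower b g))"
    by (simp only: relabel_relabel)
  finally have "standardise (merge a b (S \<inter> {..i}) (left_part a f) (left_part b g))
      = standardise (relabel \<alpha> (\<lambda>x. x) (relabel (\<lambda>x. x) (nth_elem S) (lower a f))
        \<union> relabel (\<lambda>x. \<beta> x + a) (\<lambda>x. x) (relabel (\<lambda>x. x) (nth_elem T) (lower b g)))"
    by (rule arg_cong)
  also have "\<dots> = standardise (relabel (\<lambda>x. x) (nth_elem S) (lower a f)
      \<union> relabel (\<lambda>x. x + n) (\<lambda>x. x) (relabel (\<lambda>x. x) (nth_elem T) (lower b g)))"
    using strict_mono_on_rank [OF finite_Union_Domain_lower [OF f a]]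
      strict_mono_on_rank [OF finite_Union_Domain_lower [OF g b]]
      rank_mem [OF finite_Union_Domain_lower [OF f a]] rank_mem [OF finite_Union_Domain_lower [OF g b]]
      Union_Domain_lower [OF f a] Union_Domain_lower [OF g b]
    by (intro standardise_Un_shift [where m = m])
      (simp_all only: \<alpha>_def \<beta>_def Union_Domain_relabel image_ident card_Union_Domain_lower [OF f a]
        card_Union_Domain_lower [OF g b] atLeastAtMost_iff, simp_all add: strict_mono_on_def)
  also have "\<dots> = left_part i (merge n m S f g)"
    by (simp only: left_part_def lower_merge relabel_relabel)
  finally show ?thesis
    using standardise_ident [OF merge_UBP [OF shuffle_set_lower left_part_UBP [OF f a]
          left_part_UBP [OF g b]]] by simp
qed

text \<open>As for the left parts, with the additional renumbering x - i of the codomain, which is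
  strictly increasing because all values concerned lie beyond i.\<close>

lemma right_part_merge: "right_part i (merge n m S f g)
    = merge (n - a) (m - b) ((\<lambda>x. x - i) ` (S \<inter> {i<..})) (right_part a f) (right_part b g)"
proof -
  define S' where "S' = (\<lambda>x. x - i) ` (S \<inter> {i<..})"
  define T' where "T' = (\<lambda>x. x - i) ` (T \<inter> {i<..})"
  define \<alpha> where "\<alpha> = rank (\<Union>(Domain (upper a f)))"
  define \<beta> where "\<beta> = rank (\<Union>(Domain (upper b g)))"
  \<comment> \<open>The condition 0 < x records that only elements beyond i have been moved
    back.\<close>
  have mem: "x \<in> S' \<longleftrightarrow> x + i \<in> S \<and> 0 < x" "x \<in> T' \<longleftrightarrow> x + i \<in> T \<and> 0 < x" for x
    unfolding S'_def T'_def by (force simp: image_iff intro: bexI [of _ "x + i"])+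
  have compl: "{1..n - a + (m - b)} - S' = T'"
    unfolding set_eq_iff using ab by (auto simp: mem)
  have right: "right_part a f = relabel \<alpha> (\<lambda>x. x - a) (upper a f)"
    "right_part b g = relabel \<beta> (\<lambda>x. x - b) (upper b g)"
    unfolding \<alpha>_def \<beta>_def by (rule right_part_eq [OF f a] right_part_eq [OF g b])+
  have "merge (n - a) (m - b) S' (right_part a f) (right_part b g)
      = relabel \<alpha> (\<lambda>x. nth_elem S' (x - a)) (upper a f)
        \<union> relabel (\<lambda>x. \<beta> x + (n - a)) (\<lambda>x. nth_elem T' (x - b)) (upper b g)"
    by (simp only: merge_def right relabel_relabel compl)
  also have "\<dots> = relabel \<alpha> (\<lambda>x. nth_elem S x - i) (upper a f)
      \<union> relabel (\<lambda>x. \<beta> x + (n - a)) (\<lambda>x. nth_elem T x - i) (upper b g)"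
    using nth_elem_final [OF fin(1), of _ i] nth_elem_final [OF fin(2), of _ i]
    by (intro arg_cong2 [of _ _ _ _ "(\<union>)"] relabel_cong refl)
      (simp_all only: Union_Range_upper [OF f a] Union_Range_upper [OF g b] card S'_def T'_def)
  also have "\<dots> = relabel \<alpha> (\<lambda>x. x - i) (relabel (\<lambda>x. x) (nth_elem S) (upper a f))
      \<union> relabel (\<lambda>x. \<beta> x + (n - a)) (\<lambda>x. x - i) (relabel (\<lambda>x. x) (nth_elem T) (upper b g))"
    by (simp only: relabel_relabel)
  finally have "standardise (merge (n - a) (m - b) S' (right_part a f) (right_part b g))
      = standardise (relabel \<alpha> (\<lambda>x. x - i) (relabel (\<lambda>x. x) (nth_elem S) (upper a f))
        \<union> relabel (\<lambda>x. \<beta> x + (n - a)) (\<lambda>x. x - i) (relabel (\<lambda>x. x) (nth_elem T) (upper b g)))"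
    by (rule arg_cong)
  also have "\<dots> = standardise (relabel (\<lambda>x. x) (nth_elem S) (upper a f)
      \<union> relabel (\<lambda>x. x + n) (\<lambda>x. x) (relabel (\<lambda>x. x) (nth_elem T) (upper b g)))"
  proof (rule standardise_Un_shift [where m = m])
    let ?R = "\<Union>(Range (relabel (\<lambda>x. x) (nth_elem S) (upper a f)))
        \<union> \<Union>(Range (relabel (\<lambda>x. x) (nth_elem T) (upper b g)))"
    have "?R = \<Union>(Range (upper i (merge n m S f g)))"
      by (simp only: upper_merge Range_Un_eq Union_Un_distrib Union_Range_relabel)
    then have "?R \<subseteq> {i<..}"
      by (auto simp: upper_def)
    then show "strict_mono_on ?R (\<lambda>x. x - i)"
      unfolding strict_mono_on_def subset_iff greaterThan_iff by (meson diff_less_mono less_imp_le)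
  next
    show "\<Union>(Domain (relabel (\<lambda>x. x) (nth_elem S) (upper a f))) \<subseteq> {1..n}"
      "\<Union>(Domain (relabel (\<lambda>x. x) (nth_elem T) (upper b g))) \<subseteq> {1..m}"
      unfolding Union_Domain_relabel image_ident Union_Domain_upper [OF f a] Union_Domain_upper [OF g b]
      by (rule Diff_subset)+
    show "strict_mono_on (\<Union>(Domain (relabel (\<lambda>x. x) (nth_elem S) (upper a f)))) \<alpha>"
      "strict_mono_on (\<Union>(Domain (relabel (\<lambda>x. x) (nth_elem T) (upper b g)))) \<beta>"
      unfolding Union_Domain_relabel image_ident \<alpha>_def \<beta>_def
      by (rule strict_mono_on_rank [OF finite_Union_Domain_upper [OF f a]]
          strict_mono_on_rank [OF finite_Union_Domain_upper [OF g b]])+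
    show "\<alpha> x \<le> n - a" if "x \<in> \<Union>(Domain (relabel (\<lambda>x. x) (nth_elem S) (upper a f)))" for x
      using rank_mem [OF finite_Union_Domain_upper [OF f a]] that
      unfolding \<alpha>_def card_Union_Domain_upper [OF f a] Union_Domain_relabel image_ident by simp
    show "1 \<le> \<beta> x" if "x \<in> \<Union>(Domain (relabel (\<lambda>x. x) (nth_elem T) (upper b g)))" for x
      using rank_mem [OF finite_Union_Domain_upper [OF g b]] that
      unfolding \<beta>_def Union_Domain_relabel image_ident by simp
  qed
  also have "\<dots> = right_part i (merge n m S f g)"
    by (simp only: right_part_def upper_merge relabel_relabel)
  finally show ?thesis
    using standardise_ident [OF merge_UBP [OF shuffle_set_upper right_part_UBP [OF f a]
          right_part_UBP [OF g b]]] by (simp add: S'_def)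
qed

end

end

lemma tensor_sum_basis:
  "tensor (\<Sum>x\<in>X. basis (p x)) (\<Sum>y\<in>Y. basis (q y)) = (\<Sum>(x, y)\<in>X \<times> Y. basis (p x, q y))"
proof -
  have "tensor (\<Sum>x\<in>X. basis (p x)) (\<Sum>y\<in>Y. basis (q y)) = (\<Sum>x\<in>X. \<Sum>y\<in>Y. basis (p x, q y))"
    unfolding lin_sum [OF lin_tensor_left] lin_sum [OF lin_tensor_right] by simp (rule sum.swap)
  then show ?thesis
    by (simp only: sum.cartesian_product)
qed

lemma finite_shuffle_sets: "finite (shuffle_sets n m)"
  by (rule finite_subset [of _ "Pow {1..n + m}"]) (auto simp: shuffle_sets_def)

text \<open>A reindexing: a pair (S, i) is a shuffle with a cut of its merge; the corresponding
  tuple consists of cuts a, b of the factors, a shuffle of their left parts and one of their right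
  parts. \<open>left_part_merge\<close> and \<open>right_part_merge\<close> match the
  summands.\<close>

lemma ubp_comult_mult_basis:
  assumes f: "f \<in> UBP n" and g: "g \<in> UBP m"
  shows "ubp_comult (ubp_mult (basis f) (basis g))
    = (tensor_mult ubp_mult (ubp_comult (basis f)) (ubp_comult (basis g))
        :: _ \<Rightarrow>\<^sub>0 'k::{comm_ring,comm_monoid_mult})"
proof -
  let ?I = "SIGMA S:shuffle_sets n m. breaks (merge n m S f g)"
  let ?J = "SIGMA (a, b):breaks f \<times> breaks g. shuffle_sets a b \<times> shuffle_sets (n - a) (m - b)"
  let ?T = "\<lambda>S. {1..n + m} - S"
  \<comment> \<open>The cuts a and b are counted in S and in its complement. Conversely the cut is a
    + b, and the upper set is moved back beyond it.\<close>
  let ?split = "\<lambda>(S, i). ((rank S i, rank (?T S) i), (S \<inter> {..i}, (\<lambda>x. x - i) ` (S \<inter> {i<..})))"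
  let ?join = "\<lambda>((a, b), (S, S')). (S \<union> (\<lambda>x. x + (a + b)) ` S', a + b)"
  have "ubp_comult (ubp_mult (basis f) (basis g))
      = (\<Sum>S\<in>shuffle_sets n m. \<Sum>i\<in>breaks (merge n m S f g).
          basis (left_part i (merge n m S f g), right_part i (merge n m S f g)))"
    unfolding ubp_mult_basis [OF f g] lin_sum [OF lin_ubp_comult]
    by (intro sum.cong refl ubp_comult_basis [OF merge_UBP [OF _ f g]])
  also have "\<dots> = (\<Sum>(S, i)\<in>?I. basis (left_part i (merge n m S f g), right_part i (merge n m S f g)))"
    by (simp add: sum.Sigma finite_shuffle_sets)
  also have "\<dots> = (\<Sum>((a, b), (S, S'))\<in>?J. basis (merge a b S (left_part a f) (left_part b g),
      merge (n - a) (m - b) S' (right_part a f) (right_part b g)) :: _ \<Rightarrow>\<^sub>0 'k)"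
  proof -
    have split: "rank S i \<in> breaks f \<and> rank (?T S) i \<in> breaks g
        \<and> S \<inter> {..i} \<in> shuffle_sets (rank S i) (rank (?T S) i)
        \<and> (\<lambda>x. x - i) ` (S \<inter> {i<..}) \<in> shuffle_sets (n - rank S i) (m - rank (?T S) i)
        \<and> rank S i + rank (?T S) i = i
        \<and> S \<inter> {..i} \<union> (\<lambda>x. x + i) ` (\<lambda>x. x - i) ` (S \<inter> {i<..}) = S
        \<and> left_part i (merge n m S f g)
          = merge (rank S i) (rank (?T S) i) (S \<inter> {..i}) (left_part (rank S i) f) (left_part (rank (?T S) i) g)
        \<and> right_part i (merge n m S f g)
          = merge (n - rank S i) (m - rank (?T S) i) ((\<lambda>x. x - i) ` (S \<inter> {i<..}))
              (right_part (rank S i) f) (right_part (rank (?T S) i) g)"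
      if S: "S \<in> shuffle_sets n m" and i: "i \<in> breaks (merge n m S f g)" for S i
    proof -
      have "i \<le> n + m"
        using i ubp_size_eq [OF merge_UBP [OF S f g]] by (simp add: breaks_def)
      note * = S f g this
      have ab: "rank S i \<in> breaks f" "rank (?T S) i \<in> breaks g"
        using i breaks_merge [OF *] by blast+
      \<comment> \<open>Adding i undoes the truncated subtraction since only elements beyond i are
        involved.\<close>
      have "(\<lambda>x. x + i) ` (\<lambda>x. x - i) ` (S \<inter> {i<..}) = S \<inter> {i<..}"
        by (force simp: image_image)
      then have "S \<inter> {..i} \<union> (\<lambda>x. x + i) ` (\<lambda>x. x - i) ` (S \<inter> {i<..}) = S"
        by auto
      moreover have "rank S i + rank (?T S) i = i"
        using S \<open>i \<le> n + m\<close> by (intro rank_add_rank_compl) (simp_all add: shuffle_sets_def)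
      ultimately show ?thesis
        using ab shuffle_set_lower [OF *] shuffle_set_upper [OF *] left_part_merge [OF * ab]
          right_part_merge [OF * ab] by blast
    qed
    have join: "R \<in> shuffle_sets n m \<and> a + b \<in> breaks (merge n m R f g)
        \<and> rank R (a + b) = a \<and> rank (?T R) (a + b) = b
        \<and> R \<inter> {..a + b} = S \<and> (\<lambda>x. x - (a + b)) ` (R \<inter> {a + b<..}) = S'"
      if a: "a \<in> breaks f" and b: "b \<in> breaks g" and S: "S \<in> shuffle_sets a b"
        and S': "S' \<in> shuffle_sets (n - a) (m - b)" and R: "R = S \<union> (\<lambda>x. x + (a + b)) ` S'"
      for a b S S' R
    proof -
      have le: "a \<le> n" "b \<le> m"
        using a b ubp_size_eq [OF f] ubp_size_eq [OF g] by (simp_all add: breaks_def)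
      have sub: "S \<subseteq> {1..a + b}" "S' \<subseteq> {1..n - a + (m - b)}" and card: "card S = a" "card S' = n - a"
        using S S' by (simp_all add: shuffle_sets_def)
      have shift: "(\<lambda>x. x + (a + b)) ` S' \<subseteq> {a + b<..n + m}"
        using sub(2) le by force
      have fin: "finite S" "finite S'"
        using S S' shuffle_set_finite by blast+
      have "card R = card S + card ((\<lambda>x. x + (a + b)) ` S')"
        unfolding R using sub(1) shift fin by (intro card_Un_disjoint) force+
      then have "card R = n"
        using card le by (simp add: card_image)
      moreover have "R \<subseteq> {1..n + m}"
      proof -
        have "{1..a + b} \<subseteq> {1..n + m}" "{a + b<..n + m} \<subseteq> {1..n + m}"
          using le by auto
        then show ?thesis
          unfolding R using sub(1) shift by blast
      qed
      ultimately have R_shuffle: "R \<in> shuffle_sets n m"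
        by (simp add: shuffle_sets_def)
      have lower: "R \<inter> {..a + b} = S"
        unfolding R using sub(1) shift by (auto simp: subset_iff)
      have upper: "R \<inter> {a + b<..} = (\<lambda>x. x + (a + b)) ` S'"
        unfolding R using sub(1) shift by (auto simp: subset_iff)
      have "{y \<in> R. y \<le> a + b} = S"
        using lower by auto
      then have rank: "rank R (a + b) = a"
        using card(1) by (simp add: rank_def)
      then have rank': "rank (?T R) (a + b) = b"
        using rank_add_rank_compl [OF \<open>R \<subseteq> {1..n + m}\<close>, of "a + b"] le by simp
      have "a + b \<in> breaks (merge n m R f g)"
        using breaks_merge [OF R_shuffle f g, of "a + b"] le a b unfolding rank rank' by simp
      then show ?thesis
        using R_shuffle lower rank rank' upper by (simp add: image_image)
    qed
    show ?thesis
    proof (rule sum.reindex_bij_witness [of _ ?join ?split])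
      fix x assume "x \<in> ?I"
      then obtain S i where x: "x = (S, i)" "S \<in> shuffle_sets n m" "i \<in> breaks (merge n m S f g)"
        by blast
      note * = split [OF x(2,3)]
      show "?join (?split x) = x" "?split x \<in> ?J"
        using * by (simp_all add: x(1))
      show "(\<lambda>((a, b), (S, S')). basis (merge a b S (left_part a f) (left_part b g),
          merge (n - a) (m - b) S' (right_part a f) (right_part b g))) (?split x)
        = (case x of (S, i) \<Rightarrow>
            (basis (left_part i (merge n m S f g), right_part i (merge n m S f g)) :: _ \<Rightarrow>\<^sub>0 'k))"
        using * by (simp add: x(1))
    next
      fix y assume "y \<in> ?J"
      then obtain a b S S' where y: "y = ((a, b), (S, S'))" "a \<in> breaks f" "b \<in> breaks g"
        "S \<in> shuffle_sets a b" "S' \<in> shuffle_sets (n - a) (m - b)"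
        by auto
      note * = join [OF y(2-5) refl]
      show "?split (?join y) = y" "?join y \<in> ?I"
        using * by (simp_all add: y(1))
    qed
  qed
  also have "\<dots> = (\<Sum>(a, b)\<in>breaks f \<times> breaks g. \<Sum>(S, S')\<in>shuffle_sets a b \<times> shuffle_sets (n - a) (m - b).
      basis (merge a b S (left_part a f) (left_part b g),
        merge (n - a) (m - b) S' (right_part a f) (right_part b g)))"
    by (subst sum.Sigma [symmetric]) (auto simp: finite_shuffle_sets split_def)
  also have "\<dots> = (\<Sum>(a, b)\<in>breaks f \<times> breaks g.
      tensor (ubp_mult (basis (left_part a f)) (basis (left_part b g)))
        (ubp_mult (basis (right_part a f)) (basis (right_part b g))))"
  proof (intro sum.cong refl, clarify)
    fix a b assume a: "a \<in> breaks f" and b: "b \<in> breaks g"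
    show "(\<Sum>(S, S')\<in>shuffle_sets a b \<times> shuffle_sets (n - a) (m - b).
        basis (merge a b S (left_part a f) (left_part b g),
          merge (n - a) (m - b) S' (right_part a f) (right_part b g)))
      = (tensor (ubp_mult (basis (left_part a f)) (basis (left_part b g)))
          (ubp_mult (basis (right_part a f)) (basis (right_part b g))) :: _ \<Rightarrow>\<^sub>0 'k)"
      unfolding ubp_mult_basis [OF left_part_UBP [OF f a] left_part_UBP [OF g b]]
        ubp_mult_basis [OF right_part_UBP [OF f a] right_part_UBP [OF g b]] tensor_sum_basis ..
  qed
  also have "\<dots> = tensor_mult ubp_mult (ubp_comult (basis f)) (ubp_comult (basis g))"
    by (simp add: ubp_comult_basis [OF f] ubp_comult_basis [OF g] lin_sum [OF lin_tensor_mult_left]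
        lin_sum [OF lin_tensor_mult_right] sum.cartesian_product [symmetric]) (rule sum.swap)
  finally show ?thesis .
qed


section \<open>The bialgebra axioms\<close>

lemma UBPs_UBP: "f \<in> UBP n \<Longrightarrow> f \<in> UBPs"
  by (auto simp: UBPs_def)

lemma UBPsE:
  assumes "f \<in> UBPs"
  obtains n where "f \<in> UBP n"
  using assms by (auto simp: UBPs_def)

lemma empty_UBP: "{} \<in> UBP 0"
  by (simp add: UBP_0)

lemma UBP_eq_empty_iff: "f \<in> UBP n \<Longrightarrow> f = {} \<longleftrightarrow> n = 0"
  using UBP_unique [OF _ empty_UBP] by (auto simp: UBP_0)

lemma free_module_UBP_UBPs: "x \<in> free_module (UBP n) \<Longrightarrow> x \<in> free_module UBPs"
  by (rule free_module_mono) (auto simp: UBPs_def)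

section \<open>Algebra axioms\<close>

lemma ubp_mult_graded:
  assumes "x \<in> free_module (UBP n)" "y \<in> free_module (UBP m)"
  shows "ubp_mult x y \<in> free_module (UBP (n + m))"
proof (rule lin_in_free_module [OF assms(1) lin_ubp_mult_left])
  fix f assume f: "f \<in> UBP n"
  show "ubp_mult (basis f) y \<in> free_module (UBP (n + m))"
  proof (rule lin_in_free_module [OF assms(2) lin_ubp_mult_right])
    fix g assume "g \<in> UBP m"
    then show "ubp_mult (basis f) (basis g) \<in> free_module (UBP (n + m))"
      using f merge_UBP by (auto simp: ubp_mult_basis intro!: free_module_sum)
  qed
qed

lemma ubp_mult_closed:
  assumes "x \<in> free_module UBPs" "y \<in> free_module UBPs"
  shows "ubp_mult x y \<in> free_module UBPs"
proof (rule lin_in_free_module [OF assms(1) lin_ubp_mult_left])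
  fix f assume f: "f \<in> UBPs"
  show "ubp_mult (basis f) y \<in> free_module UBPs"
  proof (rule lin_in_free_module [OF assms(2) lin_ubp_mult_right])
    fix g assume "g \<in> UBPs"
    with f obtain n m where "f \<in> UBP n" "g \<in> UBP m"
      by (auto elim!: UBPsE)
    then show "ubp_mult (basis f) (basis g) \<in> free_module UBPs"
      by (intro free_module_UBP_UBPs [OF ubp_mult_graded] basis_in_free_module)
  qed
qed

lemma ubp_mult_assoc:
  assumes "x \<in> free_module UBPs" "y \<in> free_module UBPs" "z \<in> free_module UBPs"
  shows "ubp_mult (ubp_mult x y) z = ubp_mult x (ubp_mult y z)"
proof (rule lin_eqI [OF assms(1)])
  show "lin (\<lambda>x. ubp_mult (ubp_mult x y) z)" "lin (\<lambda>x. ubp_mult x (ubp_mult y z))"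
    by (rule lin_comp [OF lin_ubp_mult_left lin_ubp_mult_left] lin_ubp_mult_left)+
  fix f assume f: "f \<in> UBPs"
  show "ubp_mult (ubp_mult (basis f) y) z = ubp_mult (basis f) (ubp_mult y z)"
  proof (rule lin_eqI [OF assms(2)])
    show "lin (\<lambda>y. ubp_mult (ubp_mult (basis f) y) z)" "lin (\<lambda>y. ubp_mult (basis f) (ubp_mult y z))"
      by (rule lin_comp [OF lin_ubp_mult_left lin_ubp_mult_right]
          lin_comp [OF lin_ubp_mult_right lin_ubp_mult_left])+
    fix g assume g: "g \<in> UBPs"
    show "ubp_mult (ubp_mult (basis f) (basis g)) z = ubp_mult (basis f) (ubp_mult (basis g) z)"
    proof (rule lin_eqI [OF assms(3)])
      show "lin (ubp_mult (ubp_mult (basis f) (basis g)))"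
        "lin (\<lambda>z. ubp_mult (basis f) (ubp_mult (basis g) z))"
        by (rule lin_comp [OF lin_ubp_mult_right lin_ubp_mult_right] lin_ubp_mult_right)+
      fix h assume "h \<in> UBPs"
      then show "ubp_mult (ubp_mult (basis f) (basis g)) (basis h)
          = ubp_mult (basis f) (ubp_mult (basis g) (basis h))"
        using f g ubp_mult_assoc_basis by (metis UBPsE)
    qed
  qed
qed

text \<open>Splitting at 0 always succeeds and returns the whole element as right part, so the
  relevant fibre is a singleton.\<close>

lemma ubp_mult_unit_left: "x \<in> free_module UBPs \<Longrightarrow> ubp_mult (basis {}) x = x"
proof (rule lin_eqI [OF _ lin_ubp_mult_right lin_id])
  fix f assume "f \<in> UBPs"
  then obtain n where f: "f \<in> UBP n"
    by (rule UBPsE)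
  then have "unsplits 0 n {} (f\<inverse>) = {f\<inverse>}"
    using zero_in_breaks left_part_zero right_part_zero UBP_converse [OF f] by (auto simp: unsplits_def)
  then show "ubp_mult (basis {}) (basis f) = basis f"
    by (simp add: ubp_mult_basis_unsplits [OF empty_UBP f])
qed

lemma ubp_mult_unit_right: "x \<in> free_module UBPs \<Longrightarrow> ubp_mult x (basis {}) = x"
proof (rule lin_eqI [OF _ lin_ubp_mult_left lin_id])
  fix f assume "f \<in> UBPs"
  then obtain n where f: "f \<in> UBP n"
    by (rule UBPsE)
  then have "unsplits n 0 (f\<inverse>) {} = {f\<inverse>}"
    using size_in_breaks left_part_size right_part_size UBP_converse [OF f] by (auto simp: unsplits_def)
  then show "ubp_mult (basis f) (basis {}) = basis f"
    by (simp add: ubp_mult_basis_unsplits [OF f empty_UBP])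
qed

lemma algebra_ubp: "algebra_on UBPs ubp_mult (ubp_unit :: ubp \<Rightarrow>\<^sub>0 'k::{comm_ring,comm_monoid_mult})"
  by unfold_locales
    (auto simp: ubp_unit_def ubp_mult_assoc ubp_mult_unit_left ubp_mult_unit_right
      UBPs_UBP [OF empty_UBP] intro!: lin_imp_linear_map lin_ubp_mult_left lin_ubp_mult_right
      ubp_mult_closed)

text \<open>\<open>lin\<close> covers only maps into free modules; reading the counit as a
  coefficient gives its linearity at once.\<close>

lemma ubp_counit_eq: "ubp_counit x = Poly_Mapping.lookup x {}"
  unfolding ubp_counit_def linear_extension_def
  by (auto simp: if_distrib [of "\<lambda>c. _ * c"] sum.delta' not_in_keys_iff_lookup_eq_zero cong: if_cong)

lemma ubp_counit_basis: "ubp_counit (basis f) = (if f = {} then 1 else 0)"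
  by (simp add: ubp_counit_eq lookup_basis)

section \<open>Counit and bialgebra axioms\<close>

lemma left_part_eq_empty_iff: "f \<in> UBP n \<Longrightarrow> i \<in> breaks f \<Longrightarrow> left_part i f = {} \<longleftrightarrow> i = 0"
  using UBP_eq_empty_iff left_part_UBP by blast

lemma right_part_eq_empty_iff: "f \<in> UBP n \<Longrightarrow> i \<in> breaks f \<Longrightarrow> right_part i f = {} \<longleftrightarrow> i = n"
  using UBP_eq_empty_iff [OF right_part_UBP] ubp_size_eq [of f n] by (fastforce simp: breaks_def)

text \<open>A left part at i has degree i, so it is empty at i = 0 only. This isolates the surviving
  term in the counit laws and in the unit laws of convolution.\<close>

lemma sum_breaks_left_empty:
  assumes f: "f \<in> UBP n" and "\<And>i. left_part i f \<noteq> {} \<Longrightarrow> F i = 0"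
  shows "(\<Sum>i\<in>breaks f. F i) = F 0"
  using zero_in_breaks [OF f] left_part_eq_empty_iff [OF f] assms(2)
  by (subst sum.remove [of _ 0]) (auto intro!: sum.neutral)

lemma sum_breaks_right_empty:
  assumes f: "f \<in> UBP n" and "\<And>i. right_part i f \<noteq> {} \<Longrightarrow> F i = 0"
  shows "(\<Sum>i\<in>breaks f. F i) = F n"
  using size_in_breaks [OF f] right_part_eq_empty_iff [OF f] assms(2)
  by (subst sum.remove [of _ n]) (auto intro!: sum.neutral)

lemma coalgebra_ubp:
  "coalgebra_on UBPs (ubp_comult :: (ubp \<Rightarrow>\<^sub>0 'k::{comm_ring,comm_monoid_mult}) \<Rightarrow> _) ubp_counit"
proof
  show "linear_map (free_module UBPs) (free_module (UBPs \<times> UBPs)) scale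
      (ubp_comult :: (ubp \<Rightarrow>\<^sub>0 'k) \<Rightarrow> _)"
  proof (rule lin_imp_linear_map [OF lin_ubp_comult])
    fix f assume "f \<in> UBPs"
    then obtain n where f: "f \<in> UBP n"
      by (rule UBPsE)
    show "(ubp_comult (basis f) :: _ \<Rightarrow>\<^sub>0 'k) \<in> free_module (UBPs \<times> UBPs)"
      unfolding ubp_comult_basis [OF f]
      by (intro free_module_sum basis_in_free_module SigmaI UBPs_UBP [OF left_part_UBP [OF f]]
          UBPs_UBP [OF right_part_UBP [OF f]])
  qed
  show "linear_map (free_module UBPs) UNIV (*) (ubp_counit :: (ubp \<Rightarrow>\<^sub>0 'k) \<Rightarrow> _)"
    by (simp add: linear_map_def ubp_counit_eq lookup_add)
  fix x :: "ubp \<Rightarrow>\<^sub>0 'k"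
  assume x: "x \<in> free_module UBPs"
  show "tensor_assoc (tensor_map ubp_comult (\<lambda>y. y) (ubp_comult x))
      = tensor_map (\<lambda>y. y) ubp_comult (ubp_comult x)"
  proof (rule lin_eqI [OF x])
    show "lin (\<lambda>x. tensor_assoc (tensor_map ubp_comult (\<lambda>y. y) (ubp_comult x)) :: _ \<Rightarrow>\<^sub>0 'k)"
      "lin (\<lambda>x. tensor_map (\<lambda>y. y) ubp_comult (ubp_comult x) :: _ \<Rightarrow>\<^sub>0 'k)"
      by (rule lin_comp [OF lin_tensor_assoc lin_comp [OF lin_tensor_map lin_ubp_comult]]
          lin_comp [OF lin_tensor_map lin_ubp_comult])+
  qed (auto elim!: UBPsE intro: ubp_comult_coassoc_basis)
  show "counit_tensor_left ubp_counit (ubp_comult x) = x"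
  proof (rule lin_eqI [OF x lin_comp [OF lin_counit_tensor_left lin_ubp_comult] lin_id])
    fix f assume "f \<in> UBPs"
    then obtain n where f: "f \<in> UBP n"
      by (rule UBPsE)
    show "counit_tensor_left ubp_counit (ubp_comult (basis f)) = (basis f :: _ \<Rightarrow>\<^sub>0 'k)"
      by (simp add: ubp_comult_basis [OF f] lin_sum [OF lin_counit_tensor_left] ubp_counit_basis
          sum_breaks_left_empty [OF f] left_part_zero [OF f] right_part_zero [OF f])
  qed
  show "counit_tensor_right ubp_counit (ubp_comult x) = x"
  proof (rule lin_eqI [OF x lin_comp [OF lin_counit_tensor_right lin_ubp_comult] lin_id])
    fix f assume "f \<in> UBPs"
    then obtain n where f: "f \<in> UBP n"
      by (rule UBPsE)
    show "counit_tensor_right ubp_counit (ubp_comult (basis f)) = (basis f :: _ \<Rightarrow>\<^sub>0 'k)"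
      by (simp add: ubp_comult_basis [OF f] lin_sum [OF lin_counit_tensor_right] ubp_counit_basis
          sum_breaks_right_empty [OF f] left_part_size [OF f] right_part_size [OF f])
  qed
qed

lemma ubp_counit_mult:
  fixes x y :: "ubp \<Rightarrow>\<^sub>0 'k::{comm_ring,comm_monoid_mult}"
  assumes x: "x \<in> free_module UBPs" and y: "y \<in> free_module UBPs"
  shows "ubp_counit (ubp_mult x y) = ubp_counit x * ubp_counit y"
proof -
  have basis: "ubp_counit (ubp_mult (basis f) (basis g) :: _ \<Rightarrow>\<^sub>0 'k)
      = ubp_counit (basis f) * ubp_counit (basis g)"
    if f: "f \<in> UBPs" and g: "g \<in> UBPs" for f g
  proof (cases "f = {}")
    case True
    then show ?thesis
      using ubp_mult_unit_left [of "basis g :: _ \<Rightarrow>\<^sub>0 'k"] g by (simp add: ubp_counit_basis)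
  next
    case False
    obtain n m where f: "f \<in> UBP n" and g: "g \<in> UBP m"
      using f g by (auto elim!: UBPsE)
    \<comment> \<open>All merges have positive degree, so the coefficient at \<open>{}\<close> of
      their sum is 0.\<close>
    then have "{} \<noteq> merge n m S f g" if "S \<in> shuffle_sets n m" for S
      using UBP_eq_empty_iff [OF merge_UBP [OF that f g]] UBP_eq_empty_iff [OF f] False by auto
    then show ?thesis
      using False by (simp add: ubp_mult_basis [OF f g] ubp_counit_eq lookup_sum lookup_basis)
  qed
  have "ubp_counit (ubp_mult (basis f) y) = ubp_counit (basis f) * ubp_counit y" if f: "f \<in> UBPs" for f
    using y
  proof (induction rule: free_module_induct)
    case zero
    then show ?case
      by (simp add: lin_zero [OF lin_ubp_mult_right] ubp_counit_eq)
  next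
    case (scale_basis c g)
    then show ?case
      using basis [OF f] by (simp add: lin_scale [OF lin_ubp_mult_right] ubp_counit_eq mult_ac)
  next
    case (add u v)
    then show ?case
      by (simp add: lin_add [OF lin_ubp_mult_right] ubp_counit_eq lookup_add distrib_left)
  qed
  with x show ?thesis
  proof (induction rule: free_module_induct)
    case zero
    then show ?case
      by (simp add: lin_zero [OF lin_ubp_mult_left] ubp_counit_eq)
  next
    case (scale_basis c g)
    then show ?case
      by (simp add: lin_scale [OF lin_ubp_mult_left] ubp_counit_eq mult_ac)
  next
    case (add u v)
    then show ?case
      by (simp add: lin_add [OF lin_ubp_mult_left] ubp_counit_eq lookup_add distrib_right)
  qed
qed

lemma bialgebra_ubp:
  "bialgebra_on UBPs (ubp_mult :: (ubp \<Rightarrow>\<^sub>0 'k::{comm_ring,comm_monoid_mult}) \<Rightarrow> _)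
    ubp_unit ubp_comult ubp_counit"
proof (intro bialgebra_on.intro algebra_ubp coalgebra_ubp bialgebra_on_axioms.intro)
  fix x y :: "ubp \<Rightarrow>\<^sub>0 'k"
  assume x: "x \<in> free_module UBPs" and y: "y \<in> free_module UBPs"
  show "ubp_counit (ubp_mult x y) = ubp_counit x * ubp_counit y"
    using x y by (rule ubp_counit_mult)
  show "ubp_comult (ubp_mult x y) = tensor_mult ubp_mult (ubp_comult x) (ubp_comult y)"
  proof (rule lin_eqI [OF x])
    show "lin (\<lambda>x. ubp_comult (ubp_mult x y))"
      "lin (\<lambda>x. tensor_mult ubp_mult (ubp_comult x) (ubp_comult y))"
      by (rule lin_comp [OF lin_ubp_comult lin_ubp_mult_left]
          lin_comp [OF lin_tensor_mult_left lin_ubp_comult])+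
    fix f assume f: "f \<in> UBPs"
    show "ubp_comult (ubp_mult (basis f) y) = tensor_mult ubp_mult (ubp_comult (basis f)) (ubp_comult y)"
    proof (rule lin_eqI [OF y])
      show "lin (\<lambda>y. ubp_comult (ubp_mult (basis f) y) :: _ \<Rightarrow>\<^sub>0 'k)"
        "lin (\<lambda>y. tensor_mult ubp_mult (ubp_comult (basis f)) (ubp_comult y) :: _ \<Rightarrow>\<^sub>0 'k)"
        by (rule lin_comp [OF lin_ubp_comult lin_ubp_mult_right]
            lin_comp [OF lin_tensor_mult_right lin_ubp_comult])+
    qed (use f in \<open>auto elim!: UBPsE intro: ubp_comult_mult_basis\<close>)
  qed
next
  have "breaks {} = {0}"
    using zero_in_breaks [OF empty_UBP] ubp_size_eq [OF empty_UBP] by (auto simp: breaks_def)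
  then show "ubp_comult ubp_unit = tensor ubp_unit (ubp_unit :: ubp \<Rightarrow>\<^sub>0 'k)"
    by (simp add: ubp_unit_def ubp_comult_basis [OF empty_UBP] left_part_zero [OF empty_UBP]
        right_part_zero [OF empty_UBP])
qed (simp add: ubp_unit_def ubp_counit_basis)


section \<open>Convolution and the antipode\<close>

text \<open>The convolution product of linear endomorphisms, each recorded by its values on basis
  elements.\<close>

definition conv :: "(ubp \<Rightarrow> ubp \<Rightarrow>\<^sub>0 'k) \<Rightarrow> (ubp \<Rightarrow> ubp \<Rightarrow>\<^sub>0 'k)
    \<Rightarrow> ubp \<Rightarrow> ubp \<Rightarrow>\<^sub>0 'k::{comm_ring,comm_monoid_mult}" where
  "conv \<phi> \<psi> f = (\<Sum>i\<in>breaks f. ubp_mult (\<phi> (left_part i f)) (\<psi> (right_part i f)))"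

text \<open>The composite of counit and unit, neutral for convolution.\<close>

definition conv_unit :: "ubp \<Rightarrow> ubp \<Rightarrow>\<^sub>0 'k::{comm_ring,comm_monoid_mult}" where
  "conv_unit f = (if f = {} then basis {} else 0)"

lemma conv_cong:
  assumes "f \<in> UBPs" "\<And>g. g \<in> UBPs \<Longrightarrow> \<phi> g = \<phi>' g" "\<And>g. g \<in> UBPs \<Longrightarrow> \<psi> g = \<psi>' g"
  shows "conv \<phi> \<psi> f = conv \<phi>' \<psi>' f"
proof -
  obtain n where f: "f \<in> UBP n"
    using assms(1) by (rule UBPsE)
  show ?thesis
    unfolding conv_def
    by (intro sum.cong refl arg_cong2 [of _ _ _ _ ubp_mult] assms(2,3)
        UBPs_UBP [OF left_part_UBP [OF f]] UBPs_UBP [OF right_part_UBP [OF f]])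
qed

lemma conv_unit_left:
  assumes f: "f \<in> UBPs" and "\<phi> f \<in> free_module UBPs"
  shows "conv conv_unit \<phi> f = \<phi> f"
proof -
  obtain n where f: "f \<in> UBP n"
    using f by (rule UBPsE)
  then show ?thesis
    using assms(2) unfolding conv_def
    by (subst sum_breaks_left_empty [OF f])
      (simp_all add: conv_unit_def lin_zero [OF lin_ubp_mult_left] left_part_zero [OF f]
        right_part_zero [OF f] ubp_mult_unit_left)
qed

lemma conv_unit_right:
  assumes f: "f \<in> UBPs" and "\<phi> f \<in> free_module UBPs"
  shows "conv \<phi> conv_unit f = \<phi> f"
proof -
  obtain n where f: "f \<in> UBP n"
    using f by (rule UBPsE)
  then show ?thesis
    using assms(2) unfolding conv_def
    by (subst sum_breaks_right_empty [OF f])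
      (simp_all add: conv_unit_def lin_zero [OF lin_ubp_mult_right] left_part_size [OF f]
        right_part_size [OF f] ubp_mult_unit_right)
qed

text \<open>Coassociative reindexing followed by associativity of the product; the closure
  assumptions are there for the latter, which is established on
  \<open>free_module UBPs\<close>.\<close>

lemma conv_assoc:
  fixes \<phi> \<psi> \<chi> :: "ubp \<Rightarrow> ubp \<Rightarrow>\<^sub>0 'k::{comm_ring,comm_monoid_mult}"
  assumes "f \<in> UBPs" and closed: "\<And>g. g \<in> UBPs \<Longrightarrow> \<phi> g \<in> free_module UBPs"
    "\<And>g. g \<in> UBPs \<Longrightarrow> \<psi> g \<in> free_module UBPs" "\<And>g. g \<in> UBPs \<Longrightarrow> \<chi> g \<in> free_module UBPs"
  shows "conv (conv \<phi> \<psi>) \<chi> f = conv \<phi> (conv \<psi> \<chi>) f"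
proof -
  obtain n where f: "f \<in> UBP n"
    using assms(1) by (rule UBPsE)
  have "conv (conv \<phi> \<psi>) \<chi> f = (\<Sum>j\<in>breaks f. \<Sum>i\<in>breaks (left_part j f).
      ubp_mult (ubp_mult (\<phi> (left_part i (left_part j f))) (\<psi> (right_part i (left_part j f))))
        (\<chi> (right_part j f)))"
    by (simp add: conv_def lin_sum [OF lin_ubp_mult_left])
  also have "\<dots> = (\<Sum>i\<in>breaks f. \<Sum>k\<in>breaks (right_part i f).
      ubp_mult (ubp_mult (\<phi> (left_part i f)) (\<psi> (left_part k (right_part i f))))
        (\<chi> (right_part k (right_part i f))))"
    by (rule sum_split_coassoc [OF f, of "\<lambda>p q r. ubp_mult (ubp_mult (\<phi> p) (\<psi> q)) (\<chi> r)"])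
  also have "\<dots> = (\<Sum>i\<in>breaks f. \<Sum>k\<in>breaks (right_part i f).
      ubp_mult (\<phi> (left_part i f)) (ubp_mult (\<psi> (left_part k (right_part i f)))
        (\<chi> (right_part k (right_part i f)))))"
  proof (intro sum.cong refl ubp_mult_assoc closed)
    fix i k assume i: "i \<in> breaks f" and k: "k \<in> breaks (right_part i f)"
    show "left_part i f \<in> UBPs"
      using UBPs_UBP [OF left_part_UBP [OF f i]] .
    show "left_part k (right_part i f) \<in> UBPs"
      using UBPs_UBP [OF left_part_UBP [OF right_part_UBP [OF f i] k]] .
    show "right_part k (right_part i f) \<in> UBPs"
      using UBPs_UBP [OF right_part_UBP [OF right_part_UBP [OF f i] k]] .
  qed
  also have "\<dots> = conv \<phi> (conv \<psi> \<chi>) f"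
    by (simp add: conv_def lin_sum [OF lin_ubp_mult_right])
  finally show ?thesis .
qed

section \<open>One-sided antipodes by recursion on the degree\<close>

lemma ubp_size_left_part:
  assumes "f \<in> UBPs" "i \<in> breaks f - {ubp_size f}"
  shows "ubp_size (left_part i f) < ubp_size f"
proof -
  obtain n where f: "f \<in> UBP n"
    using assms(1) by (rule UBPsE)
  then show ?thesis
    using assms(2) ubp_size_eq [OF left_part_UBP [OF f]] by (auto simp: breaks_def)
qed

lemma ubp_size_right_part:
  assumes "f \<in> UBPs" "i \<in> breaks f - {0}"
  shows "ubp_size (right_part i f) < ubp_size f"
proof -
  obtain n where f: "f \<in> UBP n"
    using assms(1) by (rule UBPsE)
  then show ?thesis
    using assms(2) ubp_size_eq [OF right_part_UBP [OF f]] ubp_size_eq [OF f]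
    by (auto simp: breaks_def)
qed

text \<open>
  The recursions solve for the term of the convolution with \<open>basis\<close> that contains \<open>f\<close> itself.
  Only the values on \<open>UBPs\<close> matter; elsewhere the recursion need not terminate.
\<close>

function left_antipode :: "ubp \<Rightarrow> ubp \<Rightarrow>\<^sub>0 'k::{comm_ring,comm_monoid_mult}" where
  "left_antipode f = (if f \<in> UBPs - {{}}
     then - (\<Sum>i\<in>breaks f - {ubp_size f}.
       ubp_mult (left_antipode (left_part i f)) (basis (right_part i f)))
     else basis {})"
  by pat_completeness auto
termination
  \<comment> \<open>The excluded cut is the only one whose left part has the full degree.\<close>
  by (relation "measure ubp_size") (auto intro: ubp_size_left_part)

function right_antipode :: "ubp \<Rightarrow> ubp \<Rightarrow>\<^sub>0 'k::{comm_ring,comm_monoid_mult}" where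
  "right_antipode f = (if f \<in> UBPs - {{}}
     then - (\<Sum>i\<in>breaks f - {0}.
       ubp_mult (basis (left_part i f)) (right_antipode (right_part i f)))
     else basis {})"
  by pat_completeness auto
termination
  by (relation "measure ubp_size") (auto intro: ubp_size_right_part)

declare left_antipode.simps [simp del] right_antipode.simps [simp del]

lemma left_antipode_closed:
  "f \<in> UBPs \<Longrightarrow> (left_antipode f :: _ \<Rightarrow>\<^sub>0 'k::{comm_ring,comm_monoid_mult}) \<in> free_module UBPs"
proof (induction f rule: measure_induct_rule [of ubp_size])
  case (less f)
  obtain n where f: "f \<in> UBP n"
    using less.prems by (rule UBPsE)
  have "ubp_mult (left_antipode (left_part i f)) (basis (right_part i f)) \<in> (free_module UBPs :: (_ \<Rightarrow>\<^sub>0 'k) set)"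
    if "i \<in> breaks f - {ubp_size f}" for i
  proof (intro ubp_mult_closed basis_in_free_module)
    have i: "i \<in> breaks f"
      using that by simp
    show "(left_antipode (left_part i f) :: _ \<Rightarrow>\<^sub>0 'k) \<in> free_module UBPs" "right_part i f \<in> UBPs"
      using less.IH [OF ubp_size_left_part [OF less.prems that]] UBPs_UBP [OF left_part_UBP [OF f i]]
        UBPs_UBP [OF right_part_UBP [OF f i]] by simp_all
  qed
  then show ?case
    unfolding left_antipode.simps [of f]
    by (auto simp: UBPs_UBP [OF empty_UBP] intro!: free_module_uminus free_module_sum)
qed

lemma right_antipode_closed:
  "f \<in> UBPs \<Longrightarrow> (right_antipode f :: _ \<Rightarrow>\<^sub>0 'k::{comm_ring,comm_monoid_mult}) \<in> free_module UBPs"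
proof (induction f rule: measure_induct_rule [of ubp_size])
  case (less f)
  obtain n where f: "f \<in> UBP n"
    using less.prems by (rule UBPsE)
  have "ubp_mult (basis (left_part i f)) (right_antipode (right_part i f)) \<in> (free_module UBPs :: (_ \<Rightarrow>\<^sub>0 'k) set)"
    if "i \<in> breaks f - {0}" for i
  proof (intro ubp_mult_closed basis_in_free_module)
    have i: "i \<in> breaks f"
      using that by simp
    show "(right_antipode (right_part i f) :: _ \<Rightarrow>\<^sub>0 'k) \<in> free_module UBPs" "left_part i f \<in> UBPs"
      using less.IH [OF ubp_size_right_part [OF less.prems that]] UBPs_UBP [OF left_part_UBP [OF f i]]
        UBPs_UBP [OF right_part_UBP [OF f i]] by simp_all
  qed
  then show ?case
    unfolding right_antipode.simps [of f]
    by (auto simp: UBPs_UBP [OF empty_UBP] intro!: free_module_uminus free_module_sum)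
qed

text \<open>The term at i = n is \<open>left_antipode f\<close> times the unit, and the recursion
  chose it to cancel the other terms. In degree 0 there are no other terms.\<close>

lemma conv_left_antipode:
  assumes "f \<in> UBPs"
  shows "conv left_antipode basis f = (conv_unit f :: _ \<Rightarrow>\<^sub>0 'k::{comm_ring,comm_monoid_mult})"
proof -
  obtain n where f: "f \<in> UBP n"
    using assms by (rule UBPsE)
  have "conv left_antipode basis f = left_antipode f
      + (\<Sum>i\<in>breaks f - {n}. ubp_mult (left_antipode (left_part i f)) (basis (right_part i f)) :: _ \<Rightarrow>\<^sub>0 'k)"
    unfolding conv_def
    using size_in_breaks [OF f] ubp_mult_unit_right [OF left_antipode_closed [OF assms]]
    by (subst sum.remove [of _ n]) (simp_all add: left_part_size [OF f] right_part_size [OF f])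
  also have "\<dots> = conv_unit f"
  proof (cases "f = {}")
    case True
    then have "breaks f - {n} = {}"
      using f UBP_eq_empty_iff [OF f] ubp_size_eq [OF f] by (auto simp: breaks_def)
    then show ?thesis
      using True by (simp only: sum.empty) (simp add: conv_unit_def left_antipode.simps [of "{}"])
  next
    case False
    then show ?thesis
      using assms by (simp add: left_antipode.simps [of f] ubp_size_eq [OF f] conv_unit_def)
  qed
  finally show ?thesis .
qed

lemma conv_right_antipode:
  assumes "f \<in> UBPs"
  shows "conv basis right_antipode f = (conv_unit f :: _ \<Rightarrow>\<^sub>0 'k::{comm_ring,comm_monoid_mult})"
proof -
  obtain n where f: "f \<in> UBP n"
    using assms by (rule UBPsE)
  have "conv basis right_antipode f = right_antipode f
      + (\<Sum>i\<in>breaks f - {0}. ubp_mult (basis (left_part i f)) (right_antipode (right_part i f)) :: _ \<Rightarrow>\<^sub>0 'k)"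
    unfolding conv_def
    using zero_in_breaks [OF f] ubp_mult_unit_left [OF right_antipode_closed [OF assms]]
    by (subst sum.remove [of _ 0]) (simp_all add: left_part_zero [OF f] right_part_zero [OF f])
  also have "\<dots> = conv_unit f"
  proof (cases "f = {}")
    case True
    then have "breaks f - {0} = {}"
      using f UBP_eq_empty_iff [OF f] ubp_size_eq [OF f] by (auto simp: breaks_def)
    then show ?thesis
      using True by (simp only: sum.empty) (simp add: conv_unit_def right_antipode.simps [of "{}"])
  next
    case False
    then show ?thesis
      using assms by (simp add: right_antipode.simps [of f] conv_unit_def)
  qed
  finally show ?thesis .
qed

text \<open>The usual monoid argument: with left inverse L and right inverse R of the identity I, L
  = L (I R) = (L I) R = R.\<close>

lemma left_antipode_eq_right_antipode:
  assumes "f \<in> UBPs"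
  shows "left_antipode f = (right_antipode f :: _ \<Rightarrow>\<^sub>0 'k::{comm_ring,comm_monoid_mult})"
proof -
  have "left_antipode f = (conv left_antipode conv_unit f :: _ \<Rightarrow>\<^sub>0 'k)"
    by (rule conv_unit_right [where \<phi> = left_antipode, OF assms left_antipode_closed [OF assms], symmetric])
  also have "\<dots> = conv left_antipode (conv basis right_antipode) f"
    by (rule conv_cong [OF assms]) (simp_all add: conv_right_antipode)
  also have "\<dots> = conv (conv left_antipode basis) right_antipode f"
    using assms by (intro conv_assoc [symmetric]) (simp_all add: left_antipode_closed right_antipode_closed)
  also have "\<dots> = conv conv_unit right_antipode f"
    by (rule conv_cong [OF assms]) (simp_all add: conv_left_antipode)
  also have "\<dots> = right_antipode f"
    by (rule conv_unit_left [where \<phi> = right_antipode, OF assms right_antipode_closed [OF assms]])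
  finally show ?thesis .
qed

section \<open>Antipode axioms and homogeneity\<close>

lemma
  fixes S :: "(ubp \<Rightarrow>\<^sub>0 'k::{comm_ring,comm_monoid_mult}) \<Rightarrow> (ubp \<Rightarrow>\<^sub>0 'k)"
  assumes "f \<in> UBPs"
  shows tensor_lift_tensor_map_left:
      "tensor_lift ubp_mult (tensor_map S (\<lambda>y. y) (ubp_comult (basis f))) = conv (\<lambda>g. S (basis g)) basis f"
    and tensor_lift_tensor_map_right:
      "tensor_lift ubp_mult (tensor_map (\<lambda>y. y) S (ubp_comult (basis f))) = conv basis (\<lambda>g. S (basis g)) f"
proof -
  obtain n where f: "f \<in> UBP n"
    using assms by (rule UBPsE)
  show "tensor_lift ubp_mult (tensor_map S (\<lambda>y. y) (ubp_comult (basis f))) = conv (\<lambda>g. S (basis g)) basis f"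
    "tensor_lift ubp_mult (tensor_map (\<lambda>y. y) S (ubp_comult (basis f))) = conv basis (\<lambda>g. S (basis g)) f"
    by (simp_all add: ubp_comult_basis [OF f] conv_def lin_sum [OF lin_tensor_map]
        lin_sum [OF lin_tensor_lift] tensor_lift_tensor lin_ubp_mult_left lin_ubp_mult_right)
qed

lemma scale_counit_unit_basis: "scale (ubp_counit (basis f)) ubp_unit = conv_unit f"
  by (simp add: ubp_counit_basis ubp_unit_def conv_unit_def)

lemma lin_scale_counit_unit: "lin (\<lambda>x. scale (ubp_counit x) ubp_unit)"
  by (simp add: linear_map_def ubp_counit_eq lookup_add scale_add_left scale_scale)

lemma ubp_antipode:
  "is_antipode UBPs (ubp_mult :: (ubp \<Rightarrow>\<^sub>0 'k::{comm_ring,comm_monoid_mult}) \<Rightarrow> _)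
    ubp_unit ubp_comult ubp_counit (linear_extension scale left_antipode)"
proof -
  let ?S = "linear_extension scale left_antipode :: (ubp \<Rightarrow>\<^sub>0 'k) \<Rightarrow> _"
  have "tensor_lift ubp_mult (tensor_map ?S (\<lambda>y. y) (ubp_comult x)) = scale (ubp_counit x) ubp_unit"
    if x: "x \<in> free_module UBPs" for x
  proof (rule lin_eqI [OF x lin_comp [OF lin_tensor_lift lin_comp [OF lin_tensor_map lin_ubp_comult]]
        lin_scale_counit_unit])
    fix f assume f: "f \<in> UBPs"
    show "tensor_lift ubp_mult (tensor_map ?S (\<lambda>y. y) (ubp_comult (basis f)))
        = scale (ubp_counit (basis f)) ubp_unit"
      unfolding tensor_lift_tensor_map_left [OF f] scale_counit_unit_basis
      using conv_left_antipode [OF f] by simp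
  qed
  moreover have "tensor_lift ubp_mult (tensor_map (\<lambda>y. y) ?S (ubp_comult x)) = scale (ubp_counit x) ubp_unit"
    if x: "x \<in> free_module UBPs" for x
  proof (rule lin_eqI [OF x lin_comp [OF lin_tensor_lift lin_comp [OF lin_tensor_map lin_ubp_comult]]
        lin_scale_counit_unit])
    fix f assume f: "f \<in> UBPs"
    \<comment> \<open>The second law is known for \<open>right_antipode\<close>, so the values are
      exchanged inside the convolution.\<close>
    have "conv basis (\<lambda>g. ?S (basis g)) f = conv basis right_antipode f"
      by (rule conv_cong [OF f]) (simp_all add: left_antipode_eq_right_antipode)
    then show "tensor_lift ubp_mult (tensor_map (\<lambda>y. y) ?S (ubp_comult (basis f)))
        = scale (ubp_counit (basis f)) ubp_unit"
      unfolding tensor_lift_tensor_map_right [OF f] scale_counit_unit_basis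
      using conv_right_antipode [OF f] by simp
  qed
  moreover have "linear_map (free_module UBPs) (free_module UBPs) scale ?S"
    using lin_linear_extension by (rule lin_imp_linear_map) (simp add: left_antipode_closed)
  ultimately show ?thesis
    by (simp add: is_antipode_def)
qed

text \<open>For an arbitrary antipode, the left law expresses the value at f through values at left
  parts of smaller degree, multiplied by right parts of complementary degree; strong induction on
  the degree applies.\<close>

lemma antipode_graded_basis:
  fixes S :: "(ubp \<Rightarrow>\<^sub>0 'k::{comm_ring,comm_monoid_mult}) \<Rightarrow> (ubp \<Rightarrow>\<^sub>0 'k)"
  assumes S: "is_antipode UBPs ubp_mult ubp_unit ubp_comult ubp_counit S"
  shows "f \<in> UBP n \<Longrightarrow> S (basis f) \<in> free_module (UBP n)"
proof (induction n arbitrary: f rule: less_induct)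
  case (less n)
  note f = less.prems
  have closed: "S (basis f) \<in> free_module UBPs"
    using S UBPs_UBP [OF f] by (simp add: is_antipode_def linear_map_def)
  let ?rest = "\<Sum>i\<in>breaks f - {n}. ubp_mult (S (basis (left_part i f))) (basis (right_part i f))"
  have "conv (\<lambda>g. S (basis g)) basis f = conv_unit f"
    using S UBPs_UBP [OF f] tensor_lift_tensor_map_left [of f S]
    by (simp add: is_antipode_def scale_counit_unit_basis)
  moreover have "conv (\<lambda>g. S (basis g)) basis f = S (basis f) + ?rest"
    unfolding conv_def using size_in_breaks [OF f] ubp_mult_unit_right [OF closed]
    by (subst sum.remove [of _ n]) (simp_all add: left_part_size [OF f] right_part_size [OF f])
  ultimately have eq: "S (basis f) = conv_unit f + - ?rest"
    by (simp add: eq_diff_eq)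
  have "ubp_mult (S (basis (left_part i f))) (basis (right_part i f)) \<in> free_module (UBP n)"
    if i: "i \<in> breaks f - {n}" for i
  proof -
    have "i < n"
      using i ubp_size_eq [OF f] by (auto simp: breaks_def)
    then have "S (basis (left_part i f)) \<in> free_module (UBP i)"
      using i left_part_UBP [OF f] by (intro less.IH) auto
    then show ?thesis
      using ubp_mult_graded [of _ i _ "n - i"] right_part_UBP [OF f] i \<open>i < n\<close> by fastforce
  qed
  moreover have "conv_unit f \<in> free_module (UBP n)"
    using UBP_eq_empty_iff [OF f] f by (auto simp: conv_unit_def)
  ultimately show ?case
    unfolding eq by (intro free_module_add free_module_uminus free_module_sum)
qed

lemma antipode_graded:
  fixes S :: "(ubp \<Rightarrow>\<^sub>0 'k::{comm_ring,comm_monoid_mult}) \<Rightarrow> (ubp \<Rightarrow>\<^sub>0 'k)"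
  assumes S: "is_antipode UBPs ubp_mult ubp_unit ubp_comult ubp_counit S"
    and x: "x \<in> free_module (UBP n)"
  shows "S x \<in> free_module (UBP n)"
proof -
  have lin: "linear_map (free_module UBPs) (free_module UBPs) scale S"
    using S by (simp add: is_antipode_def)
  \<comment> \<open>Membership is carried through the induction because S is additive on
    \<open>free_module UBPs\<close> only.\<close>
  have "x \<in> free_module UBPs \<and> S x \<in> free_module (UBP n)"
    using x
  proof (induction rule: free_module_induct)
    case zero
    have "S (scale 0 0) = scale 0 (S 0)"
      using lin unfolding linear_map_def by (metis free_module_zero)
    then show ?case
      by simp
  next
    case (scale_basis c f)
    have "S (scale c (basis f)) = scale c (S (basis f))"
      using lin UBPs_UBP [OF scale_basis] by (simp add: linear_map_def)
    then show ?case
      using antipode_graded_basis [OF S scale_basis] UBPs_UBP [OF scale_basis]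
      by (simp add: free_module_scale)
  next
    case (add x y)
    then have "S (x + y) = S x + S y"
      using lin by (simp add: linear_map_def)
    then show ?case
      using add by (simp add: free_module_add)
  qed
  then show ?thesis ..
qed

text \<open>The cut at i yields parts of degrees i and n - i. As the span is an intersection, one
  submodule containing the homogeneous tensors is treated at a time.\<close>

lemma ubp_comult_graded:
  fixes x :: "ubp \<Rightarrow>\<^sub>0 'k::{comm_ring,comm_monoid_mult}"
  assumes x: "x \<in> free_module (UBP n)"
  shows "ubp_comult x \<in> submodule_span
    {tensor y z | y z p q. p + q = n \<and> y \<in> free_module (UBP p) \<and> z \<in> free_module (UBP q)}"
  unfolding submodule_span_def
proof (rule InterI, elim CollectE conjE)
  fix V :: "(ubp \<times> ubp \<Rightarrow>\<^sub>0 'k) set"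
  assume V: "submodule V" and sub: "{tensor y z | y z p q.
      p + q = n \<and> y \<in> free_module (UBP p) \<and> z \<in> free_module (UBP q)} \<subseteq> V"
  have V_sum: "(\<Sum>i\<in>I. y i) \<in> V" if "\<And>i. i \<in> I \<Longrightarrow> y i \<in> V" for I :: "nat set" and y
    using that V by (induction I rule: infinite_finite_induct) (auto simp: submodule_def)
  have "ubp_comult (basis f) \<in> V" if f: "f \<in> UBP n" for f
    unfolding ubp_comult_basis [OF f]
  proof (rule V_sum)
    fix i assume i: "i \<in> breaks f"
    then have "i + (n - i) = n"
      using ubp_size_eq [OF f] by (simp add: breaks_def)
    then have "tensor (basis (left_part i f)) (basis (right_part i f)) \<in> V"
      using left_part_UBP [OF f i] right_part_UBP [OF f i] by (intro subsetD [OF sub]) fastforce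
    then show "basis (left_part i f, right_part i f) \<in> V"
      by simp
  qed
  with x show "ubp_comult x \<in> V"
    using V by (induction rule: free_module_induct)
      (auto simp: submodule_def lin_zero [OF lin_ubp_comult] lin_add [OF lin_ubp_comult]
        lin_scale [OF lin_ubp_comult])
qed

theorem theorem2p3:
  shows "graded_connected_hopf_algebra_on UBPs
    (ubp_mult :: (ubp \<Rightarrow>\<^sub>0 'k::{comm_ring,comm_monoid_mult}) \<Rightarrow> (ubp \<Rightarrow>\<^sub>0 'k) \<Rightarrow> (ubp \<Rightarrow>\<^sub>0 'k))
    ubp_unit ubp_comult ubp_counit ubp_degree_component"
proof (intro graded_connected_hopf_algebra_on.intro graded_hopf_algebra_on.intro hopf_algebra_on.intro
    bialgebra_ubp hopf_algebra_on_axioms.intro graded_hopf_algebra_on_axioms.intro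
    graded_connected_hopf_algebra_on_axioms.intro)
  show "\<exists>S. is_antipode UBPs (ubp_mult :: (ubp \<Rightarrow>\<^sub>0 'k) \<Rightarrow> _) ubp_unit ubp_comult ubp_counit S"
    using ubp_antipode by blast
  have "UBP m \<inter> UBP n = {}" if "m \<noteq> n" for m n
    using that UBP_unique by blast
  then show "direct_sum_decomposition (free_module UBPs) (ubp_degree_component :: nat \<Rightarrow> (ubp \<Rightarrow>\<^sub>0 'k) set)"
    unfolding ubp_degree_component_def [abs_def] UBPs_def by (rule direct_sum_decomposition_free_module)
  show "bij_betw (\<lambda>c. scale c ubp_unit) UNIV (ubp_degree_component 0 :: (ubp \<Rightarrow>\<^sub>0 'k) set)"
  \<comment> \<open>The inverse map takes the coefficient at \<open>{}\<close>, the only basis index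
    in degree 0.\<close>
  proof (rule bij_betw_byWitness [of _ "\<lambda>x. Poly_Mapping.lookup x {}"])
    show "\<forall>x\<in>ubp_degree_component 0. scale (Poly_Mapping.lookup x {}) ubp_unit = (x :: ubp \<Rightarrow>\<^sub>0 'k)"
    proof
      fix x :: "ubp \<Rightarrow>\<^sub>0 'k"
      assume "x \<in> ubp_degree_component 0"
      then have "Poly_Mapping.lookup x f = 0" if "f \<noteq> {}" for f
        using that by (auto simp: ubp_degree_component_def free_module_def UBP_0 subset_iff in_keys_iff)
      then show "scale (Poly_Mapping.lookup x {}) ubp_unit = x"
        by (intro poly_mapping_eqI) (auto simp: ubp_unit_def lookup_basis)
    qed
  qed (auto simp: ubp_unit_def lookup_basis ubp_degree_component_def UBP_0 intro: free_module_scale)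
  show "ubp_unit \<in> (ubp_degree_component 0 :: (ubp \<Rightarrow>\<^sub>0 'k) set)"
    by (simp add: ubp_unit_def ubp_degree_component_def empty_UBP)
next
  fix x :: "ubp \<Rightarrow>\<^sub>0 'k" and n
  assume x: "x \<in> ubp_degree_component n"
  show "ubp_comult x \<in> submodule_span
      {tensor y z | y z p q. p + q = n \<and> y \<in> ubp_degree_component p \<and> z \<in> ubp_degree_component q}"
    using x ubp_comult_graded by (simp add: ubp_degree_component_def)
  show "ubp_counit x = 0" if "1 \<le> n"
  proof -
    have "{} \<notin> UBP n"
      using UBP_eq_empty_iff [of "{}" n] that by auto
    then show ?thesis
      using x by (auto simp: ubp_counit_eq ubp_degree_component_def free_module_def subset_iff in_keys_iff)
  qed
  show "S x \<in> ubp_degree_component n"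
    if "is_antipode UBPs ubp_mult ubp_unit ubp_comult ubp_counit S" for S
    using x antipode_graded [OF that] by (simp add: ubp_degree_component_def)
  show "ubp_mult x y \<in> ubp_degree_component (n + q)" if "y \<in> ubp_degree_component q" for y q
    using x that ubp_mult_graded by (simp add: ubp_degree_component_def)
qed

end
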